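(* Let $\theta>0$ be an arbitrary constant, let $p=p(n)<1-\theta$, and let $\Delta$ denote the maximum degree of the random graph $G_{n,p}$. (i) If $p \gg \left(\frac{\log^4 n}{n}\right)^{1/3}$, then almost surely the strong chromatic number of $G_{n,p}$ equals $\Delta+1$. (ii) If $p \gg \left(\frac{\log n}{n}\right)^{1/2}$, then almost surely the strong chromatic number of $G_{n,p}$ is $(1+o(1))\Delta$; that is, for every fixed $\epsilon>0$, almost surely $(1-\epsilon)\Delta \le s\chi(G_{n,p}) \le (1+\epsilon)\Delta$.
   Context: $G_{n,p}$ is the probability space of all labeled graphs on $n$ vertices in which every edge appears randomly and independently with probability $p=p(n)$. A property holds almost surely (a.s.) if the probability that it holds tends to $1$ as $n\to\infty$. The notation $f(n)\gg g(n)$ means $f/g\to\infty$ as $n\to\infty$. All logarithms are natural. Let $G$ be a graph with $n$ vertices and $k$ a positive integer dividing $n$. $G$ is strongly $k$-colorable if for every partition of $V(G)$ into disjoint sets $V_1\cup\dots\cup V_r$, all of size exactly $k$, there exists a proper vertex $k$-coloring of $G$ in which each color appears exactly once in each $V_i$. If $k$ does not divide $n$, $G$ is called strongly $k$-colorable if the graph obtained from $G$ by adding $k\lceil n/k\rceil-n$ isolated vertices is strongly $k$-colorable. The strong chromatic number $s\chi(G)$ is the minimum $k$ for which $G$ is strongly $k$-colorable. *)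

theory Defs
  imports "HOL-Probability.Probability" "HOL-Library.Disjoint_Sets"
begin

type_synonym 'a graph = "'a set \<times> 'a set set"

abbreviation verts :: "'a graph \<Rightarrow> 'a set" where
  "verts \<equiv> fst"

abbreviation edges :: "'a graph \<Rightarrow> 'a set set" where
  "edges \<equiv> snd"

definition degree :: "'a graph \<Rightarrow> 'a \<Rightarrow> nat" where
  "degree G v = card {e \<in> edges G. v \<in> e}"

definition max_degree :: "'a graph \<Rightarrow> nat" where
  "max_degree G = Max (degree G ` verts G)"

definition proper_coloring :: "'a graph \<Rightarrow> nat \<Rightarrow> ('a \<Rightarrow> nat) \<Rightarrow> bool" where
  "proper_coloring G k c \<longleftrightarrow>
     (\<forall>v\<in>verts G. c v < k) \<and> (\<forall>u v. {u, v} \<in> edges G \<longrightarrow> c u \<noteq> c v)"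

(* The case k dvd card (verts G). *)
definition strongly_colorable_dvd :: "'a graph \<Rightarrow> nat \<Rightarrow> bool" where
  "strongly_colorable_dvd G k \<longleftrightarrow>
     (\<forall>P. partition_on (verts G) P \<and> (\<forall>B\<in>P. card B = k) \<longrightarrow>
        (\<exists>c. proper_coloring G k c \<and> (\<forall>B\<in>P. \<forall>i<k. \<exists>!v. v \<in> B \<and> c v = i)))"

(* The new vertices are taken from the right summand of 'a + nat, so they are fresh. *)
definition add_isolated :: "nat \<Rightarrow> 'a graph \<Rightarrow> ('a + nat) graph" where
  "add_isolated m G = (verts G <+> {..<m}, (`) Inl ` edges G)"

definition strongly_colorable :: "'a graph \<Rightarrow> nat \<Rightarrow> bool" where
  "strongly_colorable G k \<longleftrightarrow>
     (let n = card (verts G) in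
      if k dvd n then strongly_colorable_dvd G k
      else strongly_colorable_dvd
             (add_isolated (k * nat \<lceil>real n / real k\<rceil> - n) G) k)"

(* The minimum exists for every finite graph: any k \<ge> card (verts G), k > 0, qualifies. *)
definition strong_chromatic_number :: "'a graph \<Rightarrow> nat" where
  "strong_chromatic_number G = (LEAST k. k > 0 \<and> strongly_colorable G k)"

definition all_edges :: "nat \<Rightarrow> nat set set" where
  "all_edges n = {e. e \<subseteq> {..<n} \<and> card e = 2}"

definition Gnp :: "nat \<Rightarrow> real \<Rightarrow> nat graph pmf" where
  "Gnp n p = map_pmf (\<lambda>f. ({..<n}, {e \<in> all_edges n. f e}))
                     (Pi_pmf (all_edges n) False (\<lambda>_. bernoulli_pmf p))"

definition almost_surely :: "(nat \<Rightarrow> real) \<Rightarrow> (nat graph \<Rightarrow> bool) \<Rightarrow> bool" where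
  "almost_surely p Q \<longleftrightarrow>
     (\<lambda>n. measure_pmf.prob (Gnp n (p n)) {G. Q G}) \<longlonglongrightarrow> 1"

end

theory Submission imports Defs
begin

text \<open>The lower bound is deterministic: if \<open>k \<le> \<Delta>\<close>, take a part inside the neighbourhood of a vertex of
  degree \<open>\<Delta>\<close>. For the upper bound the only pseudorandomness needed is the property \<open>spread\<close>: among \<open>t\<close>
  disjoint sets of at most \<open>r\<close> vertices, some set leaves a constant fraction of any given disjoint set of
  at least \<open>s\<close> vertices without neighbours in it. A union bound gives this for \<open>G\<^bsub>n,p\<^esub>\<close> with
  \<open>r\<close> of order \<open>1/p\<close>, \<open>t\<close> of order \<open>log n\<close> and \<open>s\<close> of order \<open>(log n)/p\<close>.

  Now colour the parts one after the other, the classes being partial independent transversals. Hall's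
  theorem assigns the vertices of the next part: a vertex has at least \<open>s\<close> admissible classes as soon as
  its degree is at most \<open>k - 4s\<close>, a class has at least \<open>t\<close> admissible vertices as long as it does not
  dominate the part, and \<open>spread\<close> deals with the intermediate sets. A class that starts to dominate almost
  all of some later part is completed at once to a full transversal; since the classes are disjoint,
  \<open>spread\<close> allows fewer than \<open>t\<close> such classes per part, so at most \<open>r t\<close> classes are ever completed early,
  and this is absorbed by the slack \<open>4s\<close>.

  In (ii) the slack is part of \<open>\<epsilon>\<Delta>\<close>. In (i), where \<open>k = \<Delta> + 1\<close>, it comes from the fact that almost
  surely the vertex of maximum degree is unique and all other degrees are smaller by a gap of order up to
  \<open>(n p / log n)\<^sup>\<half>\<close>, which exceeds \<open>s\<close> precisely because \<open>n p\<^sup>3\<close> is large; the class of that vertex is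
  completed first.\<close>

section \<open>Hall's theorem and independent transversals\<close>

text \<open>The partition is chosen by an adversary who sees the graph, so an estimate for one fixed
  partition is not enough. What is needed about edges between sets is therefore put into one uniform
  statement, \<open>spread\<close>, and the colouring itself is deterministic. The scale of the
  parameters is forced: a class has at most one vertex in each of the about n/k parts, and k >
  \<Delta> is at least np/2, so classes have O(1/p) vertices; such a class misses a given vertex
  with probability bounded below because p < 1 - \<theta>. The price is a slack s of order (log n)/p
  by which degrees must stay below k. Against \<epsilon>\<Delta>, of order np, this asks for np^2 >>
  log n, the hypothesis of (ii). The main danger is a class that slowly comes to dominate a part not
  yet reached. Hence two thresholds, ck and c^2 k: one step may take an unfinished class below the
  first but never below the second, and a class caught in between still has room to be
  completed.\<close>

lemma hall_marriage:
  fixes N :: "'i \<Rightarrow> 'b set"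
  assumes "finite I" "\<And>i. i \<in> I \<Longrightarrow> finite (N i)"
    and "\<And>J. J \<subseteq> I \<Longrightarrow> card J \<le> card (\<Union>(N ` J))"
  shows "\<exists>h. inj_on h I \<and> (\<forall>i\<in>I. h i \<in> N i)"
  using assms
proof (induction "card I" arbitrary: I N rule: less_induct)
  case less
  show ?case
  \<comment> \<open>Halmos-Vaughan split: a tight proper subset \<open>K\<close> is matched into its
    own neighbourhood and the rest outside it. If every nonempty proper subset has surplus, fixing
    one arbitrary pair costs each neighbourhood at most one element.\<close>
  proof (cases "\<exists>K. K \<noteq> {} \<and> K \<subset> I \<and> card (\<Union>(N ` K)) \<le> card K")
    case True
    then obtain K where K: "K \<noteq> {}" "K \<subset> I" "card (\<Union>(N ` K)) \<le> card K" by blast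
    have fK: "finite K" using K less.prems finite_subset by blast
    have fU: "finite (\<Union>(N ` J))" if "J \<subseteq> I" for J
      using that less.prems(1,2) finite_subset by blast
    have cK: "card K < card I" using K less.prems by (simp add: psubset_card_mono)
    have "\<exists>h. inj_on h K \<and> (\<forall>i\<in>K. h i \<in> N i)"
      by (rule less.hyps[OF cK fK]) (use K less.prems in auto)
    then obtain h where h: "inj_on h K" "\<forall>i\<in>K. h i \<in> N i" by blast
    define N' where "N' i = N i - \<Union>(N ` K)" for i
    have "card (I - K) < card I"
      using K less.prems(1) by (intro psubset_card_mono) auto
    moreover have "card J \<le> card (\<Union>(N' ` J))" if J: "J \<subseteq> I - K" for J
    proof -
      have fJ: "finite J" using J less.prems finite_subset by blast
      have "card J + card K = card (J \<union> K)"
        using J fJ fK by (subst card_Un_disjoint) auto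
      also have "\<dots> \<le> card (\<Union>(N ` (J \<union> K)))"
        using J K by (intro less.prems(3)) auto
      also have "\<Union>(N ` (J \<union> K)) = \<Union>(N' ` J) \<union> \<Union>(N ` K)"
        by (auto simp: N'_def)
      also have "card \<dots> \<le> card (\<Union>(N' ` J)) + card (\<Union>(N ` K))"
        by (rule card_Un_le)
      finally show ?thesis using K(3) by linarith
    qed
    ultimately have "\<exists>h. inj_on h (I - K) \<and> (\<forall>i\<in>I - K. h i \<in> N' i)"
      using less.prems by (intro less.hyps) (auto simp: N'_def)
    then obtain h' where h': "inj_on h' (I - K)" "\<forall>i\<in>I - K. h' i \<in> N' i" by blast
    let ?g = "\<lambda>i. if i \<in> K then h i else h' i"
    have "inj_on ?g I"
    proof (rule inj_onI)
      fix a b assume ab: "a \<in> I" "b \<in> I" "?g a = ?g b"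
      have 1: "h i \<in> \<Union>(N ` K)" if "i \<in> K" for i using h that by blast
      have 2: "h' i \<notin> \<Union>(N ` K)" if "i \<in> I" "i \<notin> K" for i using h' that by (auto simp: N'_def)
      consider "a \<in> K" "b \<in> K" | "a \<in> K" "b \<notin> K" | "a \<notin> K" "b \<in> K" | "a \<notin> K" "b \<notin> K"
        by blast
      thus "a = b"
      proof cases
        case c1: 1
        thus ?thesis using ab(3) h(1) by (auto dest: inj_onD)
      next
        case c2: 2
        thus ?thesis using ab(3) 1[of a] 2[OF ab(2)] by (metis (full_types))
      next
        case c3: 3
        thus ?thesis using ab(3) 1[of b] 2[OF ab(1)] by (metis (full_types))
      next
        case c4: 4
        thus ?thesis using ab h'(1) by (auto dest: inj_onD)
      qed
    qed
    moreover have "\<forall>i\<in>I. ?g i \<in> N i" using h h' by (auto simp: N'_def)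
    ultimately show ?thesis by blast
  next
    case False
    show ?thesis
    proof (cases "I = {}")
      case False': False
      then obtain a where a: "a \<in> I" by blast
      have "card {a} \<le> card (N a)" using less.prems(3)[of "{a}"] a by simp
      hence "N a \<noteq> {}" by auto
      then obtain y where y: "y \<in> N a" by blast
      define N' where "N' i = N i - {y}" for i
      have "card (I - {a}) < card I" using a less.prems(1) by (meson card_Diff1_less)
      moreover have "card J \<le> card (\<Union>(N' ` J))" if J: "J \<subseteq> I - {a}" for J
      proof (cases "J = {}")
        case False'': False
        have "J \<subset> I" using J a by blast
        hence "\<not> card (\<Union>(N ` J)) \<le> card J" using False False'' by blast
        moreover have "card (\<Union>(N' ` J)) = card (\<Union>(N ` J) - {y})"
          by (rule arg_cong[of _ _ card]) (auto simp: N'_def)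
        moreover have "card (\<Union>(N ` J)) - 1 \<le> card (\<Union>(N ` J) - {y})"
          by (simp add: card_Diff_singleton_if)
        ultimately show ?thesis by linarith
      qed simp
      ultimately have "\<exists>h. inj_on h (I - {a}) \<and> (\<forall>i\<in>I - {a}. h i \<in> N' i)"
        using less.prems by (intro less.hyps) (auto simp: N'_def)
      then obtain h where h: "inj_on h (I - {a})" "\<forall>i\<in>I - {a}. h i \<in> N' i" by blast
      have "inj_on (h(a := y)) I"
        using h by (auto simp: inj_on_def N'_def)
      moreover have "\<forall>i\<in>I. (h(a := y)) i \<in> N i" using h y by (auto simp: N'_def)
      ultimately show ?thesis by blast
    qed auto
  qed
qed

lemma greedy_injection:
  fixes N :: "'i \<Rightarrow> 'b set"
  assumes "finite I" "\<And>i. i \<in> I \<Longrightarrow> finite (N i)" "\<And>i. i \<in> I \<Longrightarrow> card I \<le> card (N i)"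
  shows "\<exists>h. inj_on h I \<and> (\<forall>i\<in>I. h i \<in> N i)"
proof (rule hall_marriage[OF assms(1,2)])
  fix J assume J: "J \<subseteq> I"
  show "card J \<le> card (\<Union>(N ` J))"
  proof (cases "J = {}")
    case False
    then obtain j where j: "j \<in> J" by blast
    have "card J \<le> card I" using J assms(1) by (rule card_mono[rotated])
    also have "\<dots> \<le> card (N j)" using assms(3) j J by blast
    also have "\<dots> \<le> card (\<Union>(N ` J))"
      using j J assms(1,2) finite_subset[OF J] by (intro card_mono) auto
    finally show ?thesis .
  qed simp
qed auto

definition nbhd :: "('v \<Rightarrow> 'v \<Rightarrow> bool) \<Rightarrow> 'v set \<Rightarrow> 'v set" where
  "nbhd adj C = {v. \<exists>u\<in>C. adj u v}"

text \<open>Disjointness of the sets, from each other and from \<open>A\<close>, makes the property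
  provable: the pairs (v, i) with v in \<open>A\<close> then involve disjoint sets of potential
  edges.\<close>

definition spread :: "('v \<Rightarrow> 'v \<Rightarrow> bool) \<Rightarrow> 'v set \<Rightarrow> nat \<Rightarrow> nat \<Rightarrow> nat \<Rightarrow> real \<Rightarrow> bool" where
  "spread adj V r s t c \<longleftrightarrow>
     (\<forall>A (C :: nat \<Rightarrow> 'v set). A \<subseteq> V \<and> s \<le> card A \<and> disjoint_family_on C {..<t} \<and>
        (\<forall>i<t. C i \<subseteq> V \<and> card (C i) \<le> r \<and> C i \<inter> A = {}) \<longrightarrow>
        (\<exists>i<t. c * real (card A) \<le> real (card (A - nbhd adj (C i)))))"

lemma nbhd_mono: "C \<subseteq> D \<Longrightarrow> nbhd adj C \<subseteq> nbhd adj D"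
  by (auto simp: nbhd_def)

lemma nbhd_insert: "nbhd adj (insert w C) = nbhd adj C \<union> nbhd adj {w}"
  by (auto simp: nbhd_def)

text \<open>The form in which \<open>spread\<close> is applied: \<open>t\<close> bad indices,
  renumbered by \<open>{..<t}\<close>, would contradict it. The bound \<open>b\<close> is free so
  that a threshold fixed in advance, such as \<open>c\<^sup>2 * real k\<close>, fits sets
  \<open>A\<close> whose size is only bounded below.\<close>

lemma spread_few_bad:
  fixes C :: "'i \<Rightarrow> 'v set"
  assumes sp: "spread adj V r s t c" and A: "A \<subseteq> V" "s \<le> card A" and I: "finite I"
    and C: "\<And>i. i \<in> I \<Longrightarrow> C i \<subseteq> V" "\<And>i. i \<in> I \<Longrightarrow> card (C i) \<le> r"
      "\<And>i. i \<in> I \<Longrightarrow> C i \<inter> A = {}"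
    and d: "disjoint_family_on C I" and b: "b \<le> c * real (card A)"
  shows "card {i \<in> I. real (card (A - nbhd adj (C i))) < b} < t"
proof (rule ccontr)
  let ?B = "{i \<in> I. real (card (A - nbhd adj (C i))) < b}"
  assume "\<not> ?thesis"
  hence "t \<le> card ?B" by simp
  then obtain B where B: "B \<subseteq> ?B" "card B = t" "finite B"
    by (rule obtain_subset_with_card_n)
  obtain h where h: "bij_betw h {..<t} B"
    using B ex_bij_betw_nat_finite[of B] by (auto simp: atLeast0LessThan)
  have hI: "h i \<in> I" "real (card (A - nbhd adj (C (h i)))) < b" if "i < t" for i
    using bij_betwE[OF h] B that by blast+
  have "disjoint_family_on (\<lambda>i. C (h i)) {..<t}"
    unfolding disjoint_family_on_def
  proof (intro ballI impI)
    fix m n assume mn: "m \<in> {..<t}" "n \<in> {..<t}" "m \<noteq> n"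
    have "h m \<noteq> h n" using bij_betw_imp_inj_on[OF h] mn by (auto dest: inj_onD)
    thus "C (h m) \<inter> C (h n) = {}" using d hI(1) mn by (auto simp: disjoint_family_on_def)
  qed
  hence "\<exists>i<t. c * real (card A) \<le> real (card (A - nbhd adj (C (h i))))"
    using A C hI(1) by (intro sp[unfolded spread_def, rule_format]) auto
  thus False using hI(2) b by force
qed

lemma card_Collect_bex_le:
  assumes "finite J" "card J \<le> (r::nat)" "\<And>j. j \<in> J \<Longrightarrow> card {i \<in> I. P j i} < t" "finite I"
  shows "card {i \<in> I. \<exists>j\<in>J. P j i} \<le> r * (t - 1)"
proof -
  have "{i \<in> I. \<exists>j\<in>J. P j i} = (\<Union>j\<in>J. {i \<in> I. P j i})" by auto
  also have "card \<dots> \<le> (\<Sum>j\<in>J. card {i \<in> I. P j i})" by (rule card_UN_le[OF assms(1)])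
  also have "\<dots> \<le> (\<Sum>j\<in>J. t - 1)" using assms(3) by (intro sum_mono) fastforce
  also have "\<dots> \<le> r * (t - 1)" using assms(2) by simp
  finally show ?thesis .
qed

definition indep :: "('v \<Rightarrow> 'v \<Rightarrow> bool) \<Rightarrow> 'v set \<Rightarrow> bool" where
  "indep adj C \<longleftrightarrow> (\<forall>u\<in>C. \<forall>v\<in>C. \<not> adj u v)"

lemma card_le_card_indices:
  assumes "finite J" "D \<subseteq> (\<Union>j\<in>J. B j)" "\<And>j. j \<in> J \<Longrightarrow> card (D \<inter> B j) \<le> 1"
  shows "card D \<le> card J"
proof -
  have "D = (\<Union>j\<in>J. D \<inter> B j)" using assms(2) by blast
  hence "card D = card (\<Union>j\<in>J. D \<inter> B j)" by (rule arg_cong)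
  also have "\<dots> \<le> (\<Sum>j\<in>J. card (D \<inter> B j))" by (rule card_UN_le[OF assms(1)])
  also have "\<dots> \<le> (\<Sum>j\<in>J. 1)" using assms(3) by (intro sum_mono) auto
  finally show ?thesis by simp
qed

text \<open>Run \<open>r t + 1\<close> disjoint partial transversals in parallel. Those that come to dominate some set are
  given up; by \<open>spread\<close> there are fewer than \<open>t\<close> of them for each set, so one survives.\<close>

lemma independent_transversal:
  fixes adj :: "'v \<Rightarrow> 'v \<Rightarrow> bool" and A :: "nat \<Rightarrow> 'v set"
  assumes sp: "spread adj V r s t c" and finV: "finite V"
    and sym: "\<And>u v. adj u v \<Longrightarrow> adj v u" and irr: "\<And>u. \<not> adj u u"
    and J: "finite J" "card J \<le> r" and A: "\<And>j. j \<in> J \<Longrightarrow> A j \<subseteq> V" "\<And>j. j \<in> J \<Longrightarrow> s \<le> card (A j)"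
    and dA: "disjoint_family_on A J" and c: "0 < c" "real (r * t + 1) \<le> c * real s"
  shows "\<exists>T. T \<subseteq> (\<Union>j\<in>J. A j) \<and> indep adj T \<and> (\<forall>j\<in>J. card (T \<inter> A j) = 1)"
proof -
  define M where "M = r * t + 1"
  define bad where "bad C j \<longleftrightarrow> real (card (A j - nbhd adj C)) < c * real (card (A j))" for C j
  have finA: "finite (A j)" if "j \<in> J" for j using A(1)[OF that] finV finite_subset by blast
  \<comment> \<open>Invariant once the sets with index in \<open>P\<close> are treated: a track
    \<open>C i\<close> is either dead, since it dominates some set that it misses, or alive, having
    met all of \<open>P\<close> while dominating nothing ahead. Dead tracks are frozen, so they keep
    their witness.\<close>
  have key: "\<exists>C. disjoint_family_on C {..<M} \<and>
      (\<forall>i<M. C i \<subseteq> (\<Union>j\<in>P. A j) \<and> indep adj (C i) \<and> (\<forall>j\<in>J. card (C i \<inter> A j) \<le> 1) \<and>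
         ((\<exists>j\<in>J. C i \<inter> A j = {} \<and> bad (C i) j) \<or>
          ((\<forall>j\<in>P. C i \<inter> A j \<noteq> {}) \<and> (\<forall>j\<in>J-P. \<not> bad (C i) j))))" if "P \<subseteq> J" for P
    using finite_subset[OF that J(1)] that
  proof (induction P rule: finite_induct)
    case empty
    have "disjoint_family_on (\<lambda>_. {}) {..<M}" by (simp add: disjoint_family_on_def)
    thus ?case
      by (intro exI[of _ "\<lambda>_. {}"]) (auto simp: indep_def)
  next
    case (insert q P)
    then obtain C where C: "disjoint_family_on C {..<M}"
      "\<And>i. i < M \<Longrightarrow> C i \<subseteq> (\<Union>j\<in>P. A j)" "\<And>i. i < M \<Longrightarrow> indep adj (C i)"
      "\<And>i j. i < M \<Longrightarrow> j \<in> J \<Longrightarrow> card (C i \<inter> A j) \<le> 1"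
      "\<And>i. i < M \<Longrightarrow> (\<exists>j\<in>J. C i \<inter> A j = {} \<and> bad (C i) j) \<or>
          ((\<forall>j\<in>P. C i \<inter> A j \<noteq> {}) \<and> (\<forall>j\<in>J-P. \<not> bad (C i) j))"
      by auto
    have q: "q \<in> J" "q \<notin> P" and PJ: "P \<subseteq> J" using insert by auto
    define L where "L = {i. i < M \<and> (\<forall>j\<in>P. C i \<inter> A j \<noteq> {}) \<and> (\<forall>j\<in>J-P. \<not> bad (C i) j)}"
    have fL: "finite L" "card L \<le> M"
      using card_mono[of "{..<M}" L] by (auto simp: L_def intro: finite_subset[of _ "{..<M}"])
    have Cq: "C i \<inter> A q = {}" if "i < M" for i
    proof -
      have "A j \<inter> A q = {}" if "j \<in> P" for j
        by (rule disjoint_family_onD[OF dA]) (use q PJ that in auto)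
      thus ?thesis using C(2)[OF that] by blast
    qed
    \<comment> \<open>Each live track has at least \<open>c * real s\<close>, hence at least
      \<open>M\<close>, free vertices in \<open>A q\<close>, and there are only \<open>M\<close>
      tracks; so distinct vertices can be picked.\<close>
    have "\<exists>h. inj_on h L \<and> (\<forall>i\<in>L. h i \<in> A q - nbhd adj (C i))"
    proof (rule greedy_injection[OF fL(1)])
      fix i assume i: "i \<in> L"
      show "finite (A q - nbhd adj (C i))" using finA q by blast
      have "\<not> bad (C i) q" using i q by (auto simp: L_def)
      hence "c * real (card (A q)) \<le> real (card (A q - nbhd adj (C i)))" by (simp add: bad_def)
      moreover have "c * real s \<le> c * real (card (A q))" using A(2)[OF q(1)] c by simp
      ultimately have "real M \<le> real (card (A q - nbhd adj (C i)))" using c unfolding M_def by linarith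
      thus "card L \<le> card (A q - nbhd adj (C i))" using fL by linarith
    qed
    then obtain h where h: "inj_on h L" "\<And>i. i \<in> L \<Longrightarrow> h i \<in> A q" "\<And>i. i \<in> L \<Longrightarrow> h i \<notin> nbhd adj (C i)"
      by blast
    define C' where "C' i = (if i \<in> L then insert (h i) (C i) else C i)" for i
    have LM: "i < M" if "i \<in> L" for i using that by (simp add: L_def)
    have hA: "h i \<notin> A j" if "i \<in> L" "j \<in> J" "j \<noteq> q" for i j
      using h(2)[OF that(1)] dA that q by (auto simp: disjoint_family_on_def)
    have "disjoint_family_on C' {..<M}"
      unfolding disjoint_family_on_def
    proof (intro ballI impI)
      fix m n assume mn: "m \<in> {..<M}" "n \<in> {..<M}" "m \<noteq> n"
      have "C m \<inter> C n = {}" using C(1) mn by (auto simp: disjoint_family_on_def)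
      moreover have "h m \<noteq> h n" if "m \<in> L" "n \<in> L" using h(1) mn that by (auto dest: inj_onD)
      moreover have "h m \<notin> C n" if "m \<in> L" using h(2)[OF that] Cq mn by blast
      moreover have "h n \<notin> C m" if "n \<in> L" using h(2)[OF that] Cq mn by blast
      ultimately show "C' m \<inter> C' n = {}" by (auto simp: C'_def)
    qed
    moreover have "C' i \<subseteq> (\<Union>j\<in>insert q P. A j) \<and> indep adj (C' i) \<and> (\<forall>j\<in>J. card (C' i \<inter> A j) \<le> 1) \<and>
         ((\<exists>j\<in>J. C' i \<inter> A j = {} \<and> bad (C' i) j) \<or>
          ((\<forall>j\<in>insert q P. C' i \<inter> A j \<noteq> {}) \<and> (\<forall>j\<in>J-insert q P. \<not> bad (C' i) j)))" if i: "i < M" for i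
    proof (cases "i \<in> L")
      case True
      have "C' i \<subseteq> (\<Union>j\<in>insert q P. A j)" using C(2)[OF i] h(2)[OF True] True by (auto simp: C'_def)
      moreover have "indep adj (C' i)"
        using C(3)[OF i] h(3)[OF True] sym irr True by (auto simp: C'_def indep_def nbhd_def)
      moreover have "card (C' i \<inter> A j) \<le> 1" if j: "j \<in> J" for j
      proof (cases "j = q")
        case True' : True
        have "C' i \<inter> A q = {h i}" using Cq[OF i] h(2)[OF True] True by (auto simp: C'_def)
        thus ?thesis using True' by simp
      next
        case False
        hence "C' i \<inter> A j = C i \<inter> A j" using hA[OF True j] True by (auto simp: C'_def)
        thus ?thesis using C(4)[OF i j] by simp
      qed
      moreover have "\<forall>j\<in>insert q P. C' i \<inter> A j \<noteq> {}"
        using True h(2)[OF True] by (auto simp: C'_def L_def)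
      moreover have "C' i \<inter> A j = {}" if "j \<in> J - insert q P" for j
      proof -
        have "A l \<inter> A j = {}" if "l \<in> insert q P" for l
          by (rule disjoint_family_onD[OF dA]) (use q PJ that \<open>j \<in> J - insert q P\<close> in auto)
        thus ?thesis using \<open>C' i \<subseteq> _\<close> by blast
      qed
      ultimately show ?thesis by blast
    next
      case False
      hence "\<exists>j\<in>J. C i \<inter> A j = {} \<and> bad (C i) j" using C(5)[OF i] i by (auto simp: L_def)
      thus ?thesis using C(2-4)[OF i] False by (auto simp: C'_def)
    qed
    ultimately show ?case by blast
  qed
  obtain C where C: "disjoint_family_on C {..<M}"
      "\<And>i. i < M \<Longrightarrow> C i \<subseteq> (\<Union>j\<in>J. A j)" "\<And>i. i < M \<Longrightarrow> indep adj (C i)"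
      "\<And>i j. i < M \<Longrightarrow> j \<in> J \<Longrightarrow> card (C i \<inter> A j) \<le> 1"
      "\<And>i. i < M \<Longrightarrow> (\<exists>j\<in>J. C i \<inter> A j = {} \<and> bad (C i) j) \<or> (\<forall>j\<in>J. C i \<inter> A j \<noteq> {})"
    using key[OF order_refl] by auto
  have cardC: "card (C i) \<le> r" if "i < M" for i
    using card_le_card_indices[OF J(1) C(2)[OF that] C(4)[OF that]] J(2) by simp
  \<comment> \<open>A dead track misses the set that it dominates, so it is disjoint from it and
    \<open>spread\<close> counts it. At most \<open>r * (t - 1)\<close> tracks die, fewer than
    \<open>M\<close>.\<close>
  have "card {i \<in> {..<M}. \<exists>j\<in>J. C i \<inter> A j = {} \<and> bad (C i) j} \<le> r * (t - 1)"
  proof (rule card_Collect_bex_le[OF J])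
    fix j assume j: "j \<in> J"
    have "card {i \<in> {i \<in> {..<M}. C i \<inter> A j = {}}. real (card (A j - nbhd adj (C i))) < c * real (card (A j))} < t"
    proof (rule spread_few_bad[OF sp A(1)[OF j] A(2)[OF j]])
      show "disjoint_family_on C {i \<in> {..<M}. C i \<inter> A j = {}}"
        using C(1) by (auto simp: disjoint_family_on_def)
      show "C i \<subseteq> V" if "i \<in> {i \<in> {..<M}. C i \<inter> A j = {}}" for i using C(2)[of i] that A(1) by blast
    qed (use cardC in auto)
    moreover have "{i \<in> {i \<in> {..<M}. C i \<inter> A j = {}}. real (card (A j - nbhd adj (C i))) < c * real (card (A j))}
        = {i \<in> {..<M}. C i \<inter> A j = {} \<and> bad (C i) j}" by (auto simp: bad_def)
    ultimately show "card {i \<in> {..<M}. C i \<inter> A j = {} \<and> bad (C i) j} < t" by simp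
  qed simp
  also have "\<dots> < card {..<M}" by (simp add: M_def le_imp_less_Suc)
  finally have "{i \<in> {..<M}. \<exists>j\<in>J. C i \<inter> A j = {} \<and> bad (C i) j} \<noteq> {..<M}" by (metis less_irrefl)
  then obtain i where i: "i < M" "\<not> (\<exists>j\<in>J. C i \<inter> A j = {} \<and> bad (C i) j)"
    by blast
  have "card (C i \<inter> A j) = 1" if j: "j \<in> J" for j
  proof -
    have "finite (C i \<inter> A j)" using finA[OF j] by blast
    hence "card (C i \<inter> A j) \<noteq> 0" using C(5)[OF i(1)] i(2) j by auto
    thus ?thesis using C(4)[OF i(1) j] by linarith
  qed
  thus ?thesis using C(2,3)[OF i(1)] by blast
qed

section \<open>Colouring the parts one after the other\<close>

text \<open>\<open>k\<close> is both the number of classes and the size of the parts;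
  \<open>r\<close> is the number of parts and so bounds the size of a class. Only \<open>x\<close>
  may have degree above \<open>k - 4 * s\<close>. By \<open>cs\<close>, a fraction \<open>c\<close>
  of \<open>s\<close> vertices can serve \<open>r * t + 1\<close> tracks; by \<open>ck\<close>, a
  class with only \<open>c\<^sup>2 * real k\<close> undominated vertices in a part still has
  \<open>3 * s\<close> of them, enough for \<open>extend\<close>.\<close>

locale column_system =
  fixes adj :: "'v \<Rightarrow> 'v \<Rightarrow> bool" and V :: "'v set" and Vp :: "nat \<Rightarrow> 'v set"
    and r k s t :: nat and c :: real and x :: 'v
  assumes finV: "finite V"
    and sym: "\<And>u v. adj u v \<Longrightarrow> adj v u" and irr: "\<And>u. \<not> adj u u"
    and VpV: "\<And>j. j < r \<Longrightarrow> Vp j \<subseteq> V" and cardVp: "\<And>j. j < r \<Longrightarrow> card (Vp j) = k"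
    and cov: "V \<subseteq> (\<Union>j<r. Vp j)" and dVp: "disjoint_family_on Vp {..<r}"
    and sp: "spread adj V r s t c" and c: "0 < c" "c \<le> 1/2"
    and cs: "real (r * t + 1) \<le> c * real s" and ck: "3 * real s \<le> c\<^sup>2 * real k"
    and degx: "card {v \<in> V. adj x v} < k"
    and deg: "\<And>u. u \<in> V \<Longrightarrow> u \<noteq> x \<Longrightarrow> card {v \<in> V. adj u v} + 4 * s \<le> k"
begin

text \<open>\<open>D\<close> is weak if it dominates almost all of some part; only weak classes and the class of \<open>x\<close> are
  completed early (\<open>fin\<close>). The other classes meet exactly the parts \<open>j < i\<close> and leave at least \<open>\<beta>\<close>
  vertices of every later part undominated (\<open>pend\<close>).\<close>

definition classes :: "(nat \<Rightarrow> 'v set) \<Rightarrow> bool" where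
  "classes C \<longleftrightarrow> disjoint_family_on C {..<k} \<and>
     (\<forall>i<k. C i \<subseteq> V \<and> indep adj (C i) \<and> (\<forall>j<r. card (C i \<inter> Vp j) \<le> 1))"

text \<open>\<open>Vp j\<close> is removed from \<open>D\<close> because \<open>spread\<close>
  requires disjointness: completed classes meet every part and must still be counted.\<close>

definition weak :: "'v set \<Rightarrow> bool" where
  "weak D \<longleftrightarrow> (\<exists>j<r. real (card (Vp j - nbhd adj (D - Vp j))) < c * real k)"

definition fin :: "'v set \<Rightarrow> bool" where
  "fin D \<longleftrightarrow> (\<forall>j<r. D \<inter> Vp j \<noteq> {}) \<and> (weak D \<or> x \<in> D)"

definition pend :: "real \<Rightarrow> nat \<Rightarrow> 'v set \<Rightarrow> bool" where
  "pend \<beta> i D \<longleftrightarrow> (\<forall>j<i. D \<inter> Vp j \<noteq> {}) \<and>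
     (\<forall>j. i \<le> j \<and> j < r \<longrightarrow> D \<inter> Vp j = {} \<and> \<beta> \<le> real (card (Vp j - nbhd adj D)))"

text \<open>Vertices that would harm an unfinished class, namely \<open>x\<close> and those weak on
  their own, are kept covered from the start.\<close>

definition covered :: "(nat \<Rightarrow> 'v set) \<Rightarrow> 'v \<Rightarrow> bool" where
  "covered C u \<longleftrightarrow> (\<exists>i<k. fin (C i) \<and> u \<in> C i)"

text \<open>The budget of \<open>step\<close>: at most \<open>r * t + 1\<close> is lost to finished
  classes and at most \<open>r * t\<close> to forbidden pairs. Both losses together fit into one
  \<open>s\<close>.\<close>

lemma s_bound: "r * t + r * t + 2 \<le> s"
proof -
  have "c * real s \<le> 1/2 * real s" using c by (intro mult_right_mono) auto
  hence "real (r * t + r * t + 2) \<le> real s" using cs by simp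
  thus ?thesis by (simp only: of_nat_le_iff)
qed

lemma c2k_le: "2 * (c\<^sup>2 * real k) \<le> c * real k"
proof -
  have "c * (c * real k) \<le> 1/2 * (c * real k)" using c by (intro mult_right_mono) auto
  thus ?thesis by (simp add: power2_eq_square)
qed

lemma ck_bound: "6 * real s \<le> c * real k" using ck c2k_le by linarith

lemma k_bound: "12 * s \<le> k"
proof -
  have "c * real k \<le> 1/2 * real k" using c by (intro mult_right_mono) auto
  hence "12 * real s \<le> real k" using ck_bound by linarith
  thus ?thesis by linarith
qed

lemma finVp: "j < r \<Longrightarrow> finite (Vp j)"
  using VpV finV finite_subset by blast

lemma Vp_disj: "i < r \<Longrightarrow> j < r \<Longrightarrow> i \<noteq> j \<Longrightarrow> Vp i \<inter> Vp j = {}"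
  using dVp by (auto simp: disjoint_family_on_def)

lemma card_class: "classes C \<Longrightarrow> i < k \<Longrightarrow> card (C i) \<le> r"
  using card_le_card_indices[of "{..<r}" "C i" Vp] cov unfolding classes_def by fastforce

lemma classes_finite: "classes C \<Longrightarrow> i < k \<Longrightarrow> finite (C i)"
  unfolding classes_def using finV finite_subset by blast

lemma weak_mono:
  assumes "weak D" "D \<subseteq> E" shows "weak E"
proof -
  obtain j where j: "j < r" "real (card (Vp j - nbhd adj (D - Vp j))) < c * real k"
    using assms(1) by (auto simp: weak_def)
  have "nbhd adj (D - Vp j) \<subseteq> nbhd adj (E - Vp j)" by (rule nbhd_mono) (use assms(2) in auto)
  hence "card (Vp j - nbhd adj (E - Vp j)) \<le> card (Vp j - nbhd adj (D - Vp j))"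
    using finVp[OF j(1)] by (intro card_mono) auto
  thus ?thesis using j unfolding weak_def by (intro exI[of _ j]) linarith
qed

text \<open>Disjointness allows at most one class containing \<open>x\<close>, hence the
  \<open>+ 1\<close>; weak classes number fewer than \<open>t\<close> per part. Only
  \<open>classes\<close> is assumed, so the bound stays valid however often classes are
  completed.\<close>

lemma card_fin:
  assumes C: "classes C" shows "card {i \<in> {..<k}. fin (C i)} \<le> r * t + 1"
proof -
  let ?X = "{i \<in> {..<k}. x \<in> C i}"
  let ?W = "{i \<in> {..<k}. \<exists>j\<in>{..<r}. real (card (Vp j - nbhd adj (C i - Vp j))) < c * real k}"
  have "a = b" if "a \<in> ?X" "b \<in> ?X" for a b
    using disjoint_family_onD[of C "{..<k}" a b] C that by (auto simp: classes_def)
  hence "card ?X \<le> 1" by (subst One_nat_def, subst card_le_Suc0_iff_eq) auto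
  moreover have "card ?W \<le> r * (t - 1)"
  proof (rule card_Collect_bex_le)
    fix j assume "j \<in> {..<r}"
    hence j: "j < r" by simp
    show "card {i \<in> {..<k}. real (card (Vp j - nbhd adj (C i - Vp j))) < c * real k} < t"
    proof (rule spread_few_bad[OF sp VpV[OF j]])
      show "s \<le> card (Vp j)" using k_bound cardVp[OF j] by linarith
      show "card (C i - Vp j) \<le> r" if "i \<in> {..<k}" for i
      proof -
        have "card (C i - Vp j) \<le> card (C i)"
          by (rule card_mono) (use classes_finite[OF C] that in auto)
        thus ?thesis using card_class[OF C, of i] that by simp
      qed
      show "disjoint_family_on (\<lambda>i. C i - Vp j) {..<k}"
        using C by (auto simp: classes_def disjoint_family_on_def)
      show "C i - Vp j \<subseteq> V" if "i \<in> {..<k}" for i using C that by (auto simp: classes_def)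
    qed (use cardVp[OF j] in auto)
  qed auto
  moreover have "r * (t - 1) \<le> r * t" by simp
  moreover have "card {i \<in> {..<k}. fin (C i)} \<le> card (?X \<union> ?W)"
    by (rule card_mono) (auto simp: fin_def weak_def)
  moreover have "card (?X \<union> ?W) \<le> card ?X + card ?W" by (rule card_Un_le)
  ultimately show ?thesis by linarith
qed

text \<open>A class has at most one vertex in a part, and the assumption leaves only finished
  classes there. It is applied to parts not yet processed, which pending classes miss.\<close>

lemma card_used:
  assumes C: "classes C" and j: "j < r" and f: "\<And>i. i < k \<Longrightarrow> fin (C i) \<or> C i \<inter> Vp j = {}"
  shows "card (Vp j \<inter> (\<Union>i<k. C i)) \<le> card {i \<in> {..<k}. fin (C i)}"
proof -
  let ?F = "{i \<in> {..<k}. fin (C i)}"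
  have "Vp j \<inter> (\<Union>i<k. C i) = (\<Union>i\<in>?F. C i \<inter> Vp j)" using f by auto
  also have "card \<dots> \<le> (\<Sum>i\<in>?F. card (C i \<inter> Vp j))" by (rule card_UN_le) simp
  also have "\<dots> \<le> (\<Sum>i\<in>?F. 1)" using C j by (intro sum_mono) (auto simp: classes_def)
  finally show ?thesis by simp
qed

text \<open>Completion in one stroke: \<open>independent_transversal\<close> is applied to the
  missed parts, with the neighbours of the class and all used vertices removed.\<close>

lemma extend:
  assumes C: "classes C" and i: "i < k"
    and av: "\<And>j. j < r \<Longrightarrow> C i \<inter> Vp j = {} \<Longrightarrow> s \<le> card (Vp j - nbhd adj (C i) - (\<Union>m<k. C m))"
  shows "\<exists>D. C i \<subseteq> D \<and> classes (C(i := D)) \<and> (\<forall>j<r. D \<inter> Vp j \<noteq> {})"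
proof -
  define J where "J = {j \<in> {..<r}. C i \<inter> Vp j = {}}"
  define A where "A j = Vp j - nbhd adj (C i) - (\<Union>m<k. C m)" for j
  have J: "j < r" "C i \<inter> Vp j = {}" if "j \<in> J" for j using that by (auto simp: J_def)
  have "\<exists>T. T \<subseteq> (\<Union>j\<in>J. A j) \<and> indep adj T \<and> (\<forall>j\<in>J. card (T \<inter> A j) = 1)"
  proof (rule independent_transversal[OF sp finV])
    show "adj u v \<Longrightarrow> adj v u" "\<not> adj u u" for u v by (fact sym, fact irr)
    show "finite J" by (simp add: J_def)
    have "card J \<le> card {..<r}" by (rule card_mono) (auto simp: J_def)
    thus "card J \<le> r" by simp
    show "A j \<subseteq> V" "s \<le> card (A j)" if "j \<in> J" for j
      using J[OF that] VpV av by (auto simp: A_def)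
    show "disjoint_family_on A J"
      unfolding disjoint_family_on_def
    proof (intro ballI impI)
      fix m n assume "m \<in> J" "n \<in> J" "m \<noteq> n"
      thus "A m \<inter> A n = {}" using Vp_disj[of m n] J by (auto simp: A_def)
    qed
  qed (use c cs in auto)
  then obtain T where T: "T \<subseteq> (\<Union>j\<in>J. A j)" "indep adj T" "\<And>j. j \<in> J \<Longrightarrow> card (T \<inter> A j) = 1"
    by blast
  let ?D = "C i \<union> T"
  have Tn: "T \<inter> nbhd adj (C i) = {}" and Td: "T \<inter> (\<Union>m<k. C m) = {}"
    using T(1) by (auto simp: A_def)
  have "A j \<subseteq> V" if "j \<in> J" for j using J(1)[OF that] VpV by (auto simp: A_def)
  hence TV: "T \<subseteq> V" using T(1) by blast
  have C': "disjoint_family_on C {..<k}" "C i \<subseteq> V" "indep adj (C i)" using C i by (auto simp: classes_def)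
  \<comment> \<open>The parts are disjoint, so \<open>T\<close> has in a missed part only its vertex
    from \<open>A j\<close>, and none in the other parts; thus \<open>?D\<close> meets every part
    exactly once.\<close>
  have Tj: "T \<inter> Vp j = (if j \<in> J then T \<inter> A j else {})" if "j < r" for j
  proof -
    have "A l \<inter> Vp j = {}" if "l \<in> J" "l \<noteq> j" for l
      using Vp_disj[of l j] J(1)[OF that(1)] that(2) \<open>j < r\<close> by (auto simp: A_def)
    hence 1: "l = j" if "y \<in> A l" "l \<in> J" "y \<in> Vp j" for y l using that by blast
    have 2: "A j \<subseteq> Vp j" by (auto simp: A_def)
    show ?thesis
    proof (cases "j \<in> J")
      case True
      have "y \<in> A j" if "y \<in> T" "y \<in> Vp j" for y using T(1) 1 that by blast
      thus ?thesis using True 2 by auto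
    next
      case False
      have "y \<notin> Vp j" if "y \<in> T" for y using T(1) 1 that False by blast
      thus ?thesis using False by auto
    qed
  qed
  have "indep adj ?D"
    using C'(3) T(2) Tn sym unfolding indep_def nbhd_def by blast
  moreover have cD: "card (?D \<inter> Vp j) \<le> 1 \<and> ?D \<inter> Vp j \<noteq> {}" if j: "j < r" for j
  proof (cases "j \<in> J")
    case True
    hence "?D \<inter> Vp j = T \<inter> A j" using Tj[OF j] J[OF True] by auto
    thus ?thesis using T(3)[OF True] by (metis card.empty le_refl zero_neq_one)
  next
    case False
    hence "?D \<inter> Vp j = C i \<inter> Vp j" using Tj[OF j] by auto
    thus ?thesis using C i j False by (auto simp: classes_def J_def)
  qed
  moreover have "disjoint_family_on (C(i := ?D)) {..<k}"
    unfolding disjoint_family_on_def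
  proof (intro ballI impI)
    fix m n assume mn: "m \<in> {..<k}" "n \<in> {..<k}" "m \<noteq> n"
    hence "C m \<inter> C n = {}" using C' by (auto simp: disjoint_family_on_def)
    thus "(C(i := ?D)) m \<inter> (C(i := ?D)) n = {}" using Td mn by auto
  qed
  ultimately have "classes (C(i := ?D))"
    using C TV by (auto simp: classes_def)
  thus ?thesis using cD by blast
qed

lemma card_nbhd_le: "u \<in> V \<Longrightarrow> u \<noteq> x \<Longrightarrow> card (V \<inter> nbhd adj {u}) + 4 * s \<le> k"
proof -
  assume u: "u \<in> V" "u \<noteq> x"
  have "V \<inter> nbhd adj {u} = {v \<in> V. adj u v}" by (auto simp: nbhd_def)
  thus ?thesis using deg[OF u] by simp
qed

lemma card_Diff_ge: "finite A \<Longrightarrow> card A - card (A \<inter> B) \<le> card (A - B)"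
  by (simp add: card_Diff_subset_Int)

lemma card_Vp_nbhd_le: "u \<in> V \<Longrightarrow> u \<noteq> x \<Longrightarrow> j < r \<Longrightarrow> card (Vp j \<inter> nbhd adj {u}) + 4 * s \<le> k"
proof -
  assume u: "u \<in> V" "u \<noteq> x" and j: "j < r"
  have "card (Vp j \<inter> nbhd adj {u}) \<le> card (V \<inter> nbhd adj {u})"
    using VpV[OF j] finV by (intro card_mono) auto
  thus ?thesis using card_nbhd_le[OF u] by linarith
qed

lemma classes_single:
  assumes "D \<subseteq> V" "indep adj D" "\<And>j. j < r \<Longrightarrow> card (D \<inter> Vp j) \<le> 1"
  shows "classes ((\<lambda>_. {})(i := D))"
  using assms by (auto simp: classes_def disjoint_family_on_def indep_def)

text \<open>If \<open>x\<close> dominates nearly all of a part \<open>j1\<close>, its vertex \<open>w\<close> there is forced, but then \<open>x\<close> has fewer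
  than \<open>s\<close> neighbours elsewhere, and \<open>w \<noteq> x\<close> leaves \<open>4s\<close> vertices of every other part free.\<close>

lemma init_x:
  "\<exists>C. classes C \<and> (\<forall>i<k. fin (C i) \<or> C i = {}) \<and> (x \<in> V \<longrightarrow> covered C x)"
proof (cases "x \<in> V")
  case False
  have "classes (\<lambda>_. {})" by (auto simp: classes_def disjoint_family_on_def indep_def)
  thus ?thesis using False by blast
next
  case xV: True
  have k0: "0 < k" using degx by linarith
  have degx': "card (V \<inter> nbhd adj {x}) < k"
  proof -
    have "V \<inter> nbhd adj {x} = {v \<in> V. adj x v}" by (auto simp: nbhd_def)
    thus ?thesis using degx by simp
  qed
  have ex: "\<exists>D0. x \<in> D0 \<and> D0 \<subseteq> V \<and> indep adj D0 \<and> (\<forall>j<r. card (D0 \<inter> Vp j) \<le> 1) \<and>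
      (\<forall>j<r. D0 \<inter> Vp j = {} \<longrightarrow> s \<le> card (Vp j - nbhd adj D0))"
  proof (cases "\<forall>j<r. x \<notin> Vp j \<longrightarrow> s \<le> card (Vp j - nbhd adj {x})")
    case True
    have "card ({x} \<inter> Vp j) \<le> 1" for j
      using card_mono[of "{x}" "{x} \<inter> Vp j"] by auto
    thus ?thesis using True xV irr by (intro exI[of _ "{x}"]) (auto simp: indep_def)
  next
    case False
    then obtain j1 where j1: "j1 < r" "x \<notin> Vp j1" "card (Vp j1 - nbhd adj {x}) < s" by force
    \<comment> \<open>\<open>x\<close> has fewer than \<open>k\<close> neighbours, so it cannot
      dominate all \<open>k\<close> vertices of the part, and \<open>w\<close> exists.\<close>
    have "card (Vp j1 \<inter> nbhd adj {x}) \<le> card (V \<inter> nbhd adj {x})"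
      using VpV[OF j1(1)] finV by (intro card_mono) auto
    hence "card (Vp j1 - nbhd adj {x}) > 0"
      using degx' card_Diff_ge[OF finVp[OF j1(1)], of "nbhd adj {x}"] cardVp[OF j1(1)] by linarith
    then obtain w where w: "w \<in> Vp j1" "w \<notin> nbhd adj {x}" by (metis DiffE card_gt_0_iff ex_in_conv)
    have wV: "w \<in> V" "w \<noteq> x" using w j1 VpV by auto
    have "card ({x,w} \<inter> Vp j) \<le> 1" if j: "j < r" for j
    proof (cases "j = j1")
      case True
      hence "{x,w} \<inter> Vp j \<subseteq> {w}" using j1 by auto
      thus ?thesis using card_mono[of "{w}"] by fastforce
    next
      case False
      hence "w \<notin> Vp j" using Vp_disj[OF j j1(1)] w by auto
      hence "{x,w} \<inter> Vp j \<subseteq> {x}" by auto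
      thus ?thesis using card_mono[of "{x}"] by fastforce
    qed
    moreover have "indep adj {x,w}" using w(2) irr sym by (auto simp: indep_def nbhd_def)
    moreover have "s \<le> card (Vp j - nbhd adj {x,w})" if j: "j < r" and e: "{x,w} \<inter> Vp j = {}" for j
    proof -
      have ne: "j \<noteq> j1" using e w by auto
      have "card (Vp j \<inter> nbhd adj {x}) + card (Vp j1 \<inter> nbhd adj {x})
          = card ((Vp j \<inter> nbhd adj {x}) \<union> (Vp j1 \<inter> nbhd adj {x}))"
        using Vp_disj[OF j j1(1) ne] finVp j j1(1) by (subst card_Un_disjoint) auto
      also have "\<dots> \<le> card (V \<inter> nbhd adj {x})"
        using VpV[OF j] VpV[OF j1(1)] finV by (intro card_mono) auto
      finally have 1: "card (Vp j \<inter> nbhd adj {x}) + card (Vp j1 \<inter> nbhd adj {x}) < k" using degx' by linarith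
      have 2: "k - card (Vp j1 \<inter> nbhd adj {x}) < s"
        using card_Diff_ge[OF finVp[OF j1(1)], of "nbhd adj {x}"] cardVp[OF j1(1)] j1(3) by linarith
      have 3: "card (Vp j \<inter> nbhd adj {w}) + 4 * s \<le> k" by (rule card_Vp_nbhd_le[OF wV j])
      have "card (Vp j \<inter> nbhd adj {x,w}) \<le> card (Vp j \<inter> nbhd adj {x} \<union> Vp j \<inter> nbhd adj {w})"
        using finVp[OF j] by (intro card_mono) (auto simp: nbhd_def)
      also have "\<dots> \<le> card (Vp j \<inter> nbhd adj {x}) + card (Vp j \<inter> nbhd adj {w})" by (rule card_Un_le)
      finally show ?thesis
        using 1 2 3 card_Diff_ge[OF finVp[OF j], of "nbhd adj {x,w}"] cardVp[OF j] by linarith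
    qed
    ultimately show ?thesis using xV wV by (intro exI[of _ "{x,w}"]) auto
  qed
  then obtain D0 where D0: "x \<in> D0" "D0 \<subseteq> V" "indep adj D0" "\<And>j. j < r \<Longrightarrow> card (D0 \<inter> Vp j) \<le> 1"
    "\<And>j. j < r \<Longrightarrow> D0 \<inter> Vp j = {} \<Longrightarrow> s \<le> card (Vp j - nbhd adj D0)" by blast
  let ?C = "(\<lambda>_. {})(0 :: nat := D0)"
  have cl: "classes ?C" using D0(2-4) by (rule classes_single)
  have "\<exists>D. ?C 0 \<subseteq> D \<and> classes (?C(0 := D)) \<and> (\<forall>j<r. D \<inter> Vp j \<noteq> {})"
  proof (rule extend[OF cl k0])
    fix j assume j: "j < r" and e: "?C 0 \<inter> Vp j = {}"
    have "Vp j - nbhd adj (?C 0) - (\<Union>m<k. ?C m) = Vp j - nbhd adj D0"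
      using e by (auto split: if_splits)
    thus "s \<le> card (Vp j - nbhd adj (?C 0) - (\<Union>m<k. ?C m))" using D0(5) j e by simp
  qed
  then obtain D where D: "D0 \<subseteq> D" "classes (?C(0 := D))" "\<And>j. j < r \<Longrightarrow> D \<inter> Vp j \<noteq> {}" by auto
  have "fin D" using D D0(1) by (auto simp: fin_def)
  moreover have "?C(0 := D) = (\<lambda>_. {})(0 := D)" by auto
  ultimately show ?thesis using D(2) D0(1) D(1) k0
    by (intro exI[of _ "(\<lambda>_. {})(0 := D)"]) (auto simp: covered_def)
qed

text \<open>A vertex that is weak alone makes every class containing it weak, and the bound
  \<open>forb_w\<close> in \<open>step\<close> would not apply to it. All such vertices are
  therefore put into completed classes before any part is processed; the remaining classes stay
  empty.\<close>

lemma init: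
  assumes "finite U" "\<And>u. u \<in> U \<Longrightarrow> u \<in> V \<and> weak {u}"
  shows "\<exists>C. classes C \<and> (\<forall>i<k. fin (C i) \<or> C i = {}) \<and> (x \<in> V \<longrightarrow> covered C x) \<and> (\<forall>u\<in>U. covered C u)"
  using assms
proof (induction U rule: finite_induct)
  case empty
  thus ?case using init_x by auto
next
  case (insert u U)
  then obtain C where C: "classes C" "\<And>i. i < k \<Longrightarrow> fin (C i) \<or> C i = {}"
    "x \<in> V \<Longrightarrow> covered C x" "\<And>v. v \<in> U \<Longrightarrow> covered C v" by auto
  have u: "u \<in> V" "weak {u}" using insert.prems by auto
  show ?case
  proof (cases "\<exists>i<k. u \<in> C i")
    case True
    then obtain i where "i < k" "u \<in> C i" by blast
    hence "covered C u" using C(2)[of i] by (auto simp: covered_def)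
    thus ?thesis using C by blast
  next
    case False
    hence ux: "u \<noteq> x" using C(3) u(1) by (auto simp: covered_def)
    \<comment> \<open>At most \<open>r * t + 1 < k\<close> classes are finished and the others are
      empty, so an empty class is available for \<open>u\<close>, however large \<open>U\<close>
      is.\<close>
    have "card {i \<in> {..<k}. fin (C i)} < card {..<k}"
      using card_fin[OF C(1)] s_bound k_bound degx by auto
    hence "{i \<in> {..<k}. fin (C i)} \<noteq> {..<k}" by (metis less_irrefl)
    then obtain i where i: "i < k" "C i = {}" using C(2) by blast
    let ?C = "C(i := {u})"
    have "card ({u} \<inter> Vp j) \<le> 1" for j using card_mono[of "{u}" "{u} \<inter> Vp j"] by auto
    hence cl: "classes ?C"
      using C(1) False u(1) irr i unfolding classes_def disjoint_family_on_def
      by (auto simp: indep_def)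
    have "\<exists>D. ?C i \<subseteq> D \<and> classes (?C(i := D)) \<and> (\<forall>j<r. D \<inter> Vp j \<noteq> {})"
    proof (rule extend[OF cl i(1)])
      fix j assume j: "j < r" and e: "?C i \<inter> Vp j = {}"
      have "card (Vp j \<inter> (\<Union>m<k. C m)) \<le> r * t + 1"
        using card_used[OF C(1) j] C(2) card_fin[OF C(1)] by fastforce
      moreover have "card (Vp j \<inter> nbhd adj {u}) + 4 * s \<le> k" by (rule card_Vp_nbhd_le[OF u(1) ux j])
      moreover have "Vp j - nbhd adj (?C i) - (\<Union>m<k. ?C m) = (Vp j - nbhd adj {u}) - (\<Union>m<k. C m)"
        using e i by auto
      moreover have "card (Vp j - nbhd adj {u}) - card ((Vp j - nbhd adj {u}) \<inter> (\<Union>m<k. C m))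
          \<le> card ((Vp j - nbhd adj {u}) - (\<Union>m<k. C m))"
        by (rule card_Diff_ge) (use finVp[OF j] in auto)
      moreover have "card ((Vp j - nbhd adj {u}) \<inter> (\<Union>m<k. C m)) \<le> card (Vp j \<inter> (\<Union>m<k. C m))"
        using finVp[OF j] by (intro card_mono) auto
      moreover have "k - card (Vp j \<inter> nbhd adj {u}) \<le> card (Vp j - nbhd adj {u})"
        using card_Diff_ge[OF finVp[OF j], of "nbhd adj {u}"] cardVp[OF j] by simp
      ultimately show "s \<le> card (Vp j - nbhd adj (?C i) - (\<Union>m<k. ?C m))"
        using s_bound by simp
    qed
    then obtain D where D: "u \<in> D" "classes (C(i := D))" "\<And>j. j < r \<Longrightarrow> D \<inter> Vp j \<noteq> {}" by auto
    have fD: "fin D" using D u(2) weak_mono[of "{u}" D] by (auto simp: fin_def)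
    have keep: "covered (C(i := D)) v" if "covered C v" for v
      using that i by (auto simp: covered_def)
    have "covered (C(i := D)) u" using fD D(1) i by (auto simp: covered_def)
    moreover have "fin ((C(i := D)) m) \<or> (C(i := D)) m = {}" if "m < k" for m
      using fD C(2)[OF that] by simp
    ultimately show ?thesis using D(2) C(3,4) keep by blast
  qed
qed

text \<open>\<beta> alternates between \<open>c * real k\<close>, which lets \<open>spread\<close>
  act on the undominated rest of a later part, and \<open>c\<^sup>2 * real k\<close>, what remains
  after one more vertex; \<open>settle\<close> leads from the second back to the first.\<close>

definition state :: "real \<Rightarrow> nat \<Rightarrow> (nat \<Rightarrow> 'v set) \<Rightarrow> bool" where
  "state \<beta> i C \<longleftrightarrow> classes C \<and> (\<forall>m<k. fin (C m) \<or> pend \<beta> i (C m)) \<and>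
     (\<forall>u\<in>V. u = x \<or> weak {u} \<longrightarrow> covered C u)"

lemma state_0: "\<exists>C. state (c * real k) 0 C"
proof -
  have "finite {u \<in> V. weak {u}}" using finV by simp
  then obtain C where C: "classes C" "\<And>i. i < k \<Longrightarrow> fin (C i) \<or> C i = {}"
    "x \<in> V \<Longrightarrow> covered C x" "\<And>v. v \<in> {u \<in> V. weak {u}} \<Longrightarrow> covered C v"
    using init[of "{u \<in> V. weak {u}}"] by blast
  have "c * real k \<le> real k" using c mult_right_mono[of c 1 "real k"] by simp
  hence "pend (c * real k) 0 {}" using cardVp by (auto simp: pend_def nbhd_def)
  hence "fin (C m) \<or> pend (c * real k) 0 (C m)" if "m < k" for m
    using C(2)[OF that] by (cases "C m = {}") simp_all
  hence "state (c * real k) 0 C" unfolding state_def using C(1,3,4) by blast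
  thus ?thesis by blast
qed

text \<open>A pending class below \<open>c * real k\<close> in a part ahead is weak, and
  \<open>ck\<close> leaves it \<open>3 * s\<close> vertices there, minus at most
  \<open>r * t + 1\<close> used ones, for its completion. Each round finishes one such class, so the
  number of offenders drops.\<close>

lemma settle:
  assumes "state (c\<^sup>2 * real k) i C"
  shows "\<exists>C'. state (c * real k) i C'"
  using assms
proof (induction "card {m \<in> {..<k}. \<not> fin (C m) \<and> \<not> pend (c * real k) i (C m)}" arbitrary: C rule: less_induct)
  case less
  let ?E = "\<lambda>C. {m \<in> {..<k}. \<not> fin (C m) \<and> \<not> pend (c * real k) i (C m)}"
  have C: "classes C" "\<And>m. m < k \<Longrightarrow> fin (C m) \<or> pend (c\<^sup>2 * real k) i (C m)"
    "\<And>u. u \<in> V \<Longrightarrow> u = x \<or> weak {u} \<Longrightarrow> covered C u" using less.prems by (auto simp: state_def)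
  show ?case
  proof (cases "?E C = {}")
    case True
    hence "state (c * real k) i C" using C by (auto simp: state_def)
    thus ?thesis by blast
  next
    case False
    then obtain m where m: "m < k" "\<not> fin (C m)" "\<not> pend (c * real k) i (C m)" by auto
    have pm: "pend (c\<^sup>2 * real k) i (C m)" using C(2) m by blast
    then obtain j0 where j0: "j0 < r" "C m \<inter> Vp j0 = {}" "real (card (Vp j0 - nbhd adj (C m))) < c * real k"
      using m(3) by (force simp: pend_def)
    have "weak (C m)"
    proof -
      have "C m - Vp j0 = C m" using j0(2) by blast
      thus ?thesis using j0 by (auto simp: weak_def)
    qed
    have "\<exists>D. C m \<subseteq> D \<and> classes (C(m := D)) \<and> (\<forall>j<r. D \<inter> Vp j \<noteq> {})"
    proof (rule extend[OF C(1) m(1)])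
      fix j assume j: "j < r" and e: "C m \<inter> Vp j = {}"
      have ij: "i \<le> j" using pm e by (meson not_le pend_def)
      have "fin (C l) \<or> C l \<inter> Vp j = {}" if "l < k" for l
        using C(2)[OF that] ij j by (auto simp: pend_def)
      hence 1: "card (Vp j \<inter> (\<Union>l<k. C l)) \<le> r * t + 1"
        using card_used[OF C(1) j] card_fin[OF C(1)] by (meson le_trans)
      have "c\<^sup>2 * real k \<le> real (card (Vp j - nbhd adj (C m)))" using pm ij j by (auto simp: pend_def)
      hence 2: "3 * s \<le> card (Vp j - nbhd adj (C m))" using ck by linarith
      have 3: "card (Vp j - nbhd adj (C m)) - card ((Vp j - nbhd adj (C m)) \<inter> (\<Union>l<k. C l))
          \<le> card (Vp j - nbhd adj (C m) - (\<Union>l<k. C l))"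
        by (rule card_Diff_ge) (use finVp[OF j] in auto)
      have "card ((Vp j - nbhd adj (C m)) \<inter> (\<Union>l<k. C l)) \<le> card (Vp j \<inter> (\<Union>m<k. C m))"
        using finVp[OF j] by (intro card_mono) auto
      thus "s \<le> card (Vp j - nbhd adj (C m) - (\<Union>l<k. C l))"
        using 1 2 3 s_bound by linarith
    qed
    then obtain D where D: "C m \<subseteq> D" "classes (C(m := D))" "\<And>j. j < r \<Longrightarrow> D \<inter> Vp j \<noteq> {}" by auto
    have fD: "fin D" using D weak_mono[OF \<open>weak (C m)\<close> D(1)] by (auto simp: fin_def)
    have keep: "covered (C(m := D)) v" if "covered C v" for v
      using that m fD by (auto simp: covered_def)
    have "state (c\<^sup>2 * real k) i (C(m := D))"
      using D(2) C fD keep by (auto simp: state_def)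
    moreover have "card (?E (C(m := D))) < card (?E C)"
      using m fD by (intro psubset_card_mono) auto
    ultimately show ?thesis using less.hyps by blast
  qed
qed

lemma step:
  assumes st: "state (c * real k) i C" and ir: "i < r"
  shows "\<exists>C'. state (c * real k) (Suc i) C'"
proof -
  have C: "classes C" "\<And>m. m < k \<Longrightarrow> fin (C m) \<or> pend (c * real k) i (C m)"
    "\<And>u. u \<in> V \<Longrightarrow> u = x \<or> weak {u} \<Longrightarrow> covered C u" using st by (auto simp: state_def)
  define R where "R = {m \<in> {..<k}. \<not> fin (C m)}"
  define X where "X = Vp i - (\<Union>m<k. C m)"
  \<comment> \<open>Pairs whose union would fall below the lower threshold in some later
    part.\<close>
  define forb where "forb m w \<longleftrightarrow>
     (\<exists>j\<in>{Suc i..<r}. real (card (Vp j - nbhd adj (C m) - nbhd adj {w})) < c\<^sup>2 * real k)" for m w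
  define N where "N m = {w \<in> X. w \<notin> nbhd adj (C m) \<and> \<not> forb m w}" for m
  have R: "m < k" "pend (c * real k) i (C m)" "\<not> fin (C m)" if "m \<in> R" for m
    using that C(2) by (auto simp: R_def)
  have finR: "finite R" and finX: "finite X" using finVp[OF ir] by (auto simp: R_def X_def)
  have XV: "X \<subseteq> V" "X \<subseteq> Vp i" using VpV[OF ir] by (auto simp: X_def)
  have XF: "u \<noteq> x" "\<not> weak {u}" if "u \<in> X" for u
    using C(3)[of u] that XV unfolding covered_def X_def by blast+
  have t_le: "t \<le> r * t" using ir by (cases r) auto
  have cardF: "card {m \<in> {..<k}. fin (C m)} \<le> r * t + 1" by (rule card_fin[OF C(1)])
  have cardR: "card R + card {m \<in> {..<k}. fin (C m)} = k"
  proof -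
    have "card R + card {m \<in> {..<k}. fin (C m)} = card (R \<union> {m \<in> {..<k}. fin (C m)})"
      by (subst card_Un_disjoint) (auto simp: R_def)
    also have "R \<union> {m \<in> {..<k}. fin (C m)} = {..<k}" by (auto simp: R_def)
    finally show ?thesis by simp
  qed
  have "fin (C m) \<or> C m \<inter> Vp i = {}" if "m < k" for m
    using C(2)[OF that] ir by (auto simp: pend_def)
  hence used: "card (Vp i \<inter> (\<Union>m<k. C m)) \<le> card {m \<in> {..<k}. fin (C m)}"
    by (rule card_used[OF C(1) ir])
  \<comment> \<open>Finished classes hold at most one vertex of part \<open>i\<close> each and no
    other class has reached it, so there are enough free vertices.\<close>
  have cardX: "card R \<le> card X"
    using used cardR card_Diff_ge[OF finVp[OF ir], of "\<Union>m<k. C m"] cardVp[OF ir] unfolding X_def by linarith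
  have Rj: "C m \<inter> Vp j = {}" "c * real k \<le> real (card (Vp j - nbhd adj (C m)))"
    if "m \<in> R" "i \<le> j" "j < r" for m j
    using R(2)[OF that(1)] that by (auto simp: pend_def)
  have CmV: "C m \<subseteq> V" "card (C m) \<le> r" if "m \<in> R" for m
    using C(1) R(1)[OF that] card_class[OF C(1)] by (auto simp: classes_def)
  have Cdisj: "disjoint_family_on C R"
    using C(1) by (auto simp: classes_def disjoint_family_on_def R_def)
  have c2: "c\<^sup>2 * real k = c * (c * real k)" by (simp add: power2_eq_square)
  \<comment> \<open>Here the disjoint sets given to \<open>spread\<close> are the singletons of
    \<open>X\<close>: fewer than \<open>t\<close> of them reduce the undominated rest of a later
    part, of size at least \<open>c * real k\<close>, below its fraction \<open>c\<close>.\<close>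
  have forb_m: "card {w \<in> X. forb m w} \<le> r * t" if m: "m \<in> R" for m
  proof -
    have "card {w \<in> X. \<exists>j\<in>{Suc i..<r}. real (card (Vp j - nbhd adj (C m) - nbhd adj {w})) < c\<^sup>2 * real k} \<le> r * (t - 1)"
    proof (rule card_Collect_bex_le)
      fix j assume "j \<in> {Suc i..<r}"
      hence j: "i \<le> j" "j < r" "i \<noteq> j" by auto
      have ca: "c * real k \<le> real (card (Vp j - nbhd adj (C m)))" by (rule Rj(2)[OF m j(1,2)])
      show "card {w \<in> X. real (card (Vp j - nbhd adj (C m) - nbhd adj {w})) < c\<^sup>2 * real k} < t"
      proof (rule spread_few_bad[OF sp])
        show "Vp j - nbhd adj (C m) \<subseteq> V" using VpV[OF j(2)] by blast
        show "s \<le> card (Vp j - nbhd adj (C m))" using ca ck_bound by linarith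
        show "{w} \<inter> (Vp j - nbhd adj (C m)) = {}" if "w \<in> X" for w
          using that XV Vp_disj[OF ir j(2,3)] by auto
        show "disjoint_family_on (\<lambda>w. {w}) X" by (auto simp: disjoint_family_on_def)
        show "c\<^sup>2 * real k \<le> c * real (card (Vp j - nbhd adj (C m)))"
          unfolding c2 using ca c by (intro mult_left_mono) auto
        show "card {w} \<le> r" for w :: 'v using ir by simp
        show "{w} \<subseteq> V" if "w \<in> X" for w using that XV by auto
      qed (use finX in auto)
    qed (use finX in auto)
    also have "\<dots> \<le> r * t" by simp
    finally show ?thesis by (simp add: forb_def)
  qed
  \<comment> \<open>The roles are swapped: \<open>w\<close> is not weak, so it leaves at least
    \<open>c * real k\<close> vertices of each later part, and the disjoint sets are the
    classes.\<close>
  have forb_w: "card {m \<in> R. forb m w} \<le> r * t" if w: "w \<in> X" for w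
  proof -
    have "card {m \<in> R. \<exists>j\<in>{Suc i..<r}. real (card (Vp j - nbhd adj {w} - nbhd adj (C m))) < c\<^sup>2 * real k} \<le> r * (t - 1)"
    proof (rule card_Collect_bex_le)
      fix j assume "j \<in> {Suc i..<r}"
      hence j: "i \<le> j" "j < r" "i \<noteq> j" by auto
      have "w \<notin> Vp j" using w XV Vp_disj[OF ir j(2,3)] by auto
      hence "{w} - Vp j = {w}" by auto
      hence ca: "c * real k \<le> real (card (Vp j - nbhd adj {w}))"
        using XF(2)[OF w] j(2) by (force simp: weak_def)
      show "card {m \<in> R. real (card (Vp j - nbhd adj {w} - nbhd adj (C m))) < c\<^sup>2 * real k} < t"
      proof (rule spread_few_bad[OF sp])
        show "Vp j - nbhd adj {w} \<subseteq> V" using VpV[OF j(2)] by blast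
        show "s \<le> card (Vp j - nbhd adj {w})" using ca ck_bound by linarith
        show "C m \<inter> (Vp j - nbhd adj {w}) = {}" if "m \<in> R" for m
          using Rj(1)[OF that j(1,2)] by auto
        show "c\<^sup>2 * real k \<le> c * real (card (Vp j - nbhd adj {w}))"
          unfolding c2 using ca c by (intro mult_left_mono) auto
      qed (use finR Cdisj CmV in auto)
    qed (use finR in auto)
    also have "\<dots> \<le> r * t" by simp
    finally show ?thesis
      by (simp add: forb_def Diff_eq Int_commute Int_left_commute Int_assoc)
  qed
  have N_large: "t \<le> card (N m)" if m: "m \<in> R" for m
  proof -
    have "Vp i - nbhd adj (C m) \<subseteq> N m \<union> (Vp i \<inter> (\<Union>m<k. C m)) \<union> {w \<in> X. forb m w}"
      by (auto simp: N_def X_def)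
    hence "card (Vp i - nbhd adj (C m)) \<le> card (N m \<union> (Vp i \<inter> (\<Union>m<k. C m)) \<union> {w \<in> X. forb m w})"
      using finX finVp[OF ir] by (intro card_mono) (auto simp: N_def)
    also have "\<dots> \<le> card (N m) + card (Vp i \<inter> (\<Union>m<k. C m)) + card {w \<in> X. forb m w}"
      by (meson add_le_mono1 card_Un_le le_trans)
    finally have "card (Vp i - nbhd adj (C m)) \<le> card (N m) + (r * t + 1) + r * t"
      using used cardF forb_m[OF m] by linarith
    moreover have "6 * s \<le> card (Vp i - nbhd adj (C m))"
      using Rj(2)[OF m order_refl ir] ck_bound by linarith
    ultimately show ?thesis using s_bound t_le by linarith
  qed
  have av_large: "s \<le> card {m \<in> R. w \<in> N m}" if w: "w \<in> X" for w
  proof -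
    \<comment> \<open>Disjoint classes containing a neighbour of \<open>w\<close> inject into the
      neighbours of \<open>w\<close>, of which there are at most \<open>k - 4 * s\<close>.\<close>
    have "card {m \<in> R. w \<in> nbhd adj (C m)} \<le> card (V \<inter> nbhd adj {w})"
    proof -
      have "\<exists>g. \<forall>m\<in>{m \<in> R. w \<in> nbhd adj (C m)}. g m \<in> C m \<and> adj (g m) w"
        by (rule bchoice) (auto simp: nbhd_def)
      then obtain g where g: "\<And>m. m \<in> {m \<in> R. w \<in> nbhd adj (C m)} \<Longrightarrow> g m \<in> C m \<and> adj (g m) w"
        by blast
      show ?thesis
      proof (rule card_inj_on_le[of g])
        show "inj_on g {m \<in> R. w \<in> nbhd adj (C m)}"
        proof (rule inj_onI)
          fix a b assume "a \<in> {m \<in> R. w \<in> nbhd adj (C m)}" "b \<in> {m \<in> R. w \<in> nbhd adj (C m)}" "g a = g b"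
          thus "a = b" using g[of a] g[of b] Cdisj by (auto simp: disjoint_family_on_def)
        qed
        show "g ` {m \<in> R. w \<in> nbhd adj (C m)} \<subseteq> V \<inter> nbhd adj {w}"
        proof
          fix y assume "y \<in> g ` {m \<in> R. w \<in> nbhd adj (C m)}"
          then obtain m where m: "m \<in> {m \<in> R. w \<in> nbhd adj (C m)}" "y = g m" by blast
          hence "m \<in> R" "g m \<in> C m" "adj (g m) w" using g by blast+
          thus "y \<in> V \<inter> nbhd adj {w}" using CmV(1)[of m] sym m(2) by (auto simp: nbhd_def)
        qed
      qed (use finV in auto)
    qed
    moreover have "card (V \<inter> nbhd adj {w}) + 4 * s \<le> k"
      using card_nbhd_le XF(1)[OF w] w XV by auto
    moreover have "card R \<le> card ({m \<in> R. w \<in> N m} \<union> {m \<in> R. w \<in> nbhd adj (C m)} \<union> {m \<in> R. forb m w})"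
      using finR w by (intro card_mono) (auto simp: N_def)
    moreover have "card ({m \<in> R. w \<in> N m} \<union> {m \<in> R. w \<in> nbhd adj (C m)} \<union> {m \<in> R. forb m w})
        \<le> card {m \<in> R. w \<in> N m} + card {m \<in> R. w \<in> nbhd adj (C m)} + card {m \<in> R. forb m w}"
      by (meson add_le_mono1 card_Un_le le_trans)
    ultimately show ?thesis using forb_w[OF w] cardF cardR s_bound by linarith
  qed
  have "\<exists>h. inj_on h R \<and> (\<forall>m\<in>R. h m \<in> N m)"
  proof (rule hall_marriage[OF finR])
    show "finite (N m)" for m using finX by (simp add: N_def)
    fix T assume T: "T \<subseteq> R"
    have finT: "finite T" using T finR finite_subset by blast
    show "card T \<le> card (\<Union>(N ` T))"
    proof (rule ccontr)
      assume lt: "\<not> ?thesis"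
      then obtain m0 where m0: "m0 \<in> T" by fastforce
      have NX: "\<Union>(N ` T) \<subseteq> X" by (auto simp: N_def)
      have fN: "finite (\<Union>(N ` T))" using NX finX finite_subset by blast
      have "t \<le> card (N m0)" using N_large m0 T by blast
      also have "\<dots> \<le> card (\<Union>(N ` T))" using m0 fN by (intro card_mono) auto
      finally have tT: "t \<le> card T" using lt by linarith
      \<comment> \<open>A violating \<open>T\<close> leaves more than \<open>card R - card T\<close>
        vertices in \<open>S\<close>, all inadmissible for every class of \<open>T\<close>. The
        admissible classes of one of them lie outside \<open>T\<close>, so \<open>S\<close> has at
        least \<open>s\<close> vertices, while \<open>T\<close> has at least \<open>t\<close>
        classes. By \<open>spread\<close> some class of \<open>T\<close> fails to dominate
        \<open>c * real s\<close> vertices of \<open>S\<close>; only \<open>forb\<close> can exclude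
        these, and it excludes too few.\<close>
      define S where "S = X - \<Union>(N ` T)"
      have cS: "card S + card (\<Union>(N ` T)) = card X"
        unfolding S_def using NX fN finX by (simp add: card_Diff_subset card_mono)
      have TR: "card T \<le> card R" using T finR by (rule card_mono[rotated])
      have "card S \<noteq> 0" using cS lt TR cardX by linarith
      then obtain w where w: "w \<in> S" by fastforce
      have "card ({m \<in> R. w \<in> N m} \<union> T) \<le> card R" using T finR by (intro card_mono) auto
      moreover have "card ({m \<in> R. w \<in> N m} \<union> T) = card {m \<in> R. w \<in> N m} + card T"
        using finR finT w by (intro card_Un_disjoint) (auto simp: S_def)
      moreover have "s \<le> card {m \<in> R. w \<in> N m}" using av_large w by (auto simp: S_def)
      ultimately have sS: "s \<le> card S" using cS lt cardX by linarith
      have "card {m \<in> T. real (card (S - nbhd adj (C m))) < c * real (card S)} < t"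
      proof (rule spread_few_bad[OF sp _ sS finT])
        show "S \<subseteq> V" using XV by (auto simp: S_def)
        show "C m \<inter> S = {}" if "m \<in> T" for m
          using that T R(1) by (auto simp: S_def X_def)
        show "disjoint_family_on C T" using Cdisj T by (auto simp: disjoint_family_on_def)
      qed (use CmV T in auto)
      hence "{m \<in> T. real (card (S - nbhd adj (C m))) < c * real (card S)} \<noteq> T" using tT by force
      then obtain m where m: "m \<in> T" "c * real (card S) \<le> real (card (S - nbhd adj (C m)))" by force
      have "S - nbhd adj (C m) \<subseteq> {w \<in> X. forb m w}" using m(1) by (auto simp: S_def N_def)
      hence "card (S - nbhd adj (C m)) \<le> card {w \<in> X. forb m w}" using finX by (intro card_mono) auto
      moreover have "card {w \<in> X. forb m w} \<le> r * t" using forb_m m(1) T by blast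
      moreover have "c * real s \<le> c * real (card S)" using sS c by simp
      ultimately show False using m(2) cs by linarith
    qed
  qed
  then obtain h where h: "inj_on h R" "\<And>m. m \<in> R \<Longrightarrow> h m \<in> N m" by blast
  have hX: "h m \<in> X" "h m \<notin> nbhd adj (C m)" "\<not> forb m (h m)" if "m \<in> R" for m
    using h(2)[OF that] by (auto simp: N_def)
  define C' where "C' m = (if m \<in> R then insert (h m) (C m) else C m)" for m
  have hVp: "h m \<in> Vp i" "h m \<notin> C n" if "m \<in> R" "n < k" for m n
    using hX(1)[OF that(1)] that by (auto simp: X_def)
  have hVj: "h m \<notin> Vp j" if "m \<in> R" "j < r" "j \<noteq> i" for m j
    using hX(1)[OF that(1)] XV Vp_disj[OF ir that(2)] that(3) by auto
  have "classes C'"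
    unfolding classes_def
  proof (intro conjI allI impI)
    show "disjoint_family_on C' {..<k}"
      unfolding disjoint_family_on_def
    proof (intro ballI impI)
      fix m n assume mn: "m \<in> {..<k}" "n \<in> {..<k}" "m \<noteq> n"
      have "C m \<inter> C n = {}" using C(1) mn by (auto simp: classes_def disjoint_family_on_def)
      moreover have "h m \<noteq> h n" if "m \<in> R" "n \<in> R" using h(1) mn that by (auto dest: inj_onD)
      ultimately show "C' m \<inter> C' n = {}" using hVp(2) mn by (auto simp: C'_def)
    qed
    fix m assume m: "m < k"
    show "C' m \<subseteq> V" using C(1) m hX(1) XV by (auto simp: C'_def classes_def)
    have "indep adj (C m)" using C(1) m by (auto simp: classes_def)
    thus "indep adj (C' m)" using hX(2)[of m] sym irr by (auto simp: C'_def indep_def nbhd_def)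
    fix j assume j: "j < r"
    have cm: "card (C m \<inter> Vp j) \<le> 1" using C(1) m j by (auto simp: classes_def)
    show "card (C' m \<inter> Vp j) \<le> 1"
    proof (cases "m \<in> R")
      case True
      show ?thesis
      proof (cases "j = i")
        case eq: True
        have "C' m \<inter> Vp j = {h m}" using Rj(1)[OF True order_refl ir] True hVp(1)[OF True m] eq by (auto simp: C'_def)
        thus ?thesis by simp
      next
        case False
        have "C' m \<inter> Vp j = C m \<inter> Vp j" using hVj[OF True j False] by (auto simp: C'_def)
        thus ?thesis using cm by simp
      qed
    qed (use cm in \<open>auto simp: C'_def\<close>)
  qed
  moreover have "fin (C' m) \<or> pend (c\<^sup>2 * real k) (Suc i) (C' m)" if m: "m < k" for m
  proof (cases "m \<in> R")
    case True
    have "C' m \<inter> Vp j \<noteq> {}" if "j < Suc i" for j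
    proof (cases "j = i")
      case False
      thus ?thesis using R(2)[OF True] that by (auto simp: pend_def C'_def)
    qed (use hVp(1)[OF True m] True in \<open>auto simp: C'_def\<close>)
    moreover have "C' m \<inter> Vp j = {} \<and> c\<^sup>2 * real k \<le> real (card (Vp j - nbhd adj (C' m)))"
      if "Suc i \<le> j" "j < r" for j
    proof -
      have "C' m \<inter> Vp j = {}" using Rj(1)[OF True, of j] hVj[OF True that(2)] that True by (auto simp: C'_def)
      moreover have "Vp j - nbhd adj (C' m) = Vp j - nbhd adj (C m) - nbhd adj {h m}"
        using True nbhd_insert[of adj "h m" "C m"] by (auto simp: C'_def)
      ultimately show ?thesis using hX(3)[OF True] that by (force simp: forb_def)
    qed
    ultimately show ?thesis by (auto simp: pend_def)
  next
    case False
    thus ?thesis using m by (auto simp: C'_def R_def)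
  qed
  moreover have "covered C' u" if "covered C u" for u
    using that by (auto simp: covered_def C'_def R_def)
  ultimately have "state (c\<^sup>2 * real k) (Suc i) C'" using C(3) by (auto simp: state_def)
  thus ?thesis by (rule settle)
qed

lemma state_reachable: "i \<le> r \<Longrightarrow> \<exists>C. state (c * real k) i C"
proof (induction i)
  case 0
  show ?case by (rule state_0)
next
  case (Suc i)
  thus ?case using step[of i] by auto
qed

theorem transversal_partition:
  "\<exists>C. disjoint_family_on C {..<k} \<and> (\<forall>i<k. indep adj (C i)) \<and> (\<forall>i<k. \<forall>j<r. C i \<inter> Vp j \<noteq> {})"
proof -
  obtain C where C: "state (c * real k) r C" using state_reachable by blast
  have "C i \<inter> Vp j \<noteq> {}" if "i < k" "j < r" for i j
    using C that by (auto simp: state_def fin_def pend_def)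
  thus ?thesis using C by (intro exI[of _ C]) (auto simp: state_def classes_def)
qed

end

section \<open>Strong colourings of graphs\<close>

definition gadj :: "'a graph \<Rightarrow> 'a \<Rightarrow> 'a \<Rightarrow> bool" where
  "gadj G u v \<longleftrightarrow> {u, v} \<in> edges G"

definition simple_graph :: "'a graph \<Rightarrow> bool" where
  "simple_graph G \<longleftrightarrow> finite (verts G) \<and> (\<forall>e\<in>edges G. e \<subseteq> verts G \<and> card e = 2)"

lemma gadj_sym: "gadj G u v \<Longrightarrow> gadj G v u"
  by (simp add: gadj_def insert_commute)

lemma gadj_irrefl: "simple_graph G \<Longrightarrow> \<not> gadj G u u"
  by (force simp: gadj_def simple_graph_def)

lemma gadj_verts: "simple_graph G \<Longrightarrow> gadj G u v \<Longrightarrow> u \<in> verts G \<and> v \<in> verts G"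
  by (force simp: gadj_def simple_graph_def)

lemma degree_eq:
  assumes G: "simple_graph G"
  shows "degree G v = card {u \<in> verts G. gadj G v u}"
  unfolding degree_def
proof (rule bij_betw_same_card[symmetric])
  show "bij_betw (\<lambda>u. {v, u}) {u \<in> verts G. gadj G v u} {e \<in> edges G. v \<in> e}"
    unfolding bij_betw_def
  proof
    show "inj_on (\<lambda>u. {v, u}) {u \<in> verts G. gadj G v u}"
      by (auto simp: inj_on_def doubleton_eq_iff)
    show "(\<lambda>u. {v, u}) ` {u \<in> verts G. gadj G v u} = {e \<in> edges G. v \<in> e}"
    proof (intro equalityI subsetI)
      fix e assume e: "e \<in> {e \<in> edges G. v \<in> e}"
      hence "card e = 2" "e \<subseteq> verts G" using G by (auto simp: simple_graph_def)
      then obtain a b where ab: "e = {a, b}" by (auto simp: card_2_iff)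
      then obtain u where "e = {v, u}" using e by auto
      thus "e \<in> (\<lambda>u. {v, u}) ` {u \<in> verts G. gadj G v u}"
        using e \<open>e \<subseteq> verts G\<close> by (auto simp: gadj_def)
    qed (auto simp: gadj_def)
  qed
qed

lemma spread_mono:
  assumes sp: "spread adj V r s t c" and "r' \<le> r" "s \<le> s'" "c' \<le> c"
  shows "spread adj V r' s' t c'"
  unfolding spread_def
proof (intro allI impI)
  fix A and C :: "nat \<Rightarrow> 'a set"
  assume h: "A \<subseteq> V \<and> s' \<le> card A \<and> disjoint_family_on C {..<t} \<and>
        (\<forall>i<t. C i \<subseteq> V \<and> card (C i) \<le> r' \<and> C i \<inter> A = {})"
  hence "A \<subseteq> V \<and> s \<le> card A \<and> disjoint_family_on C {..<t} \<and>
        (\<forall>i<t. C i \<subseteq> V \<and> card (C i) \<le> r \<and> C i \<inter> A = {})" using assms by force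
  hence "\<exists>i<t. c * real (card A) \<le> real (card (A - nbhd adj (C i)))"
    using sp unfolding spread_def by blast
  moreover have "c' * real (card A) \<le> c * real (card A)"
    using assms(4) by (intro mult_right_mono) auto
  ultimately show "\<exists>i<t. c' * real (card A) \<le> real (card (A - nbhd adj (C i)))"
    by (meson order_trans)
qed

text \<open>\<open>r\<close> bounds the number of parts, by \<open>n\<close>, and a class has at
  most one vertex per part; so \<open>spread\<close> for sets of size \<open>r\<close> covers every
  class. The colour of a vertex is the index of its class.\<close>

lemma strongly_colorable_dvd_if_spread:
  fixes G :: "'a graph"
  assumes G: "simple_graph G" and k: "0 < k" and n: "card (verts G) \<le> r * k"
    and sp: "spread (gadj G) (verts G) r s t c" and c: "0 < c" "c \<le> 1/2"
    and cs: "real (r * t + 1) \<le> c * real s" and ck: "3 * real s \<le> c\<^sup>2 * real k"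
    and degx: "degree G x < k"
    and deg: "\<And>u. u \<in> verts G \<Longrightarrow> u \<noteq> x \<Longrightarrow> degree G u + 4 * s \<le> k"
  shows "strongly_colorable_dvd G k"
  unfolding strongly_colorable_dvd_def
proof (intro allI impI)
  fix P assume P: "partition_on (verts G) P \<and> (\<forall>B\<in>P. card B = k)"
  have finV: "finite (verts G)" using G by (simp add: simple_graph_def)
  have finP: "finite P" using P finV finite_elements by blast
  have PD: "\<Union>P = verts G" "\<And>A B. A \<in> P \<Longrightarrow> B \<in> P \<Longrightarrow> A \<noteq> B \<Longrightarrow> A \<inter> B = {}"
    using P by (auto simp: partition_on_def disjoint_def)
  define q where "q = card P"
  have "card (verts G) = (\<Sum>B\<in>P. card B)"
    using PD finP finV by (metis card_Union_disjoint disjointI finite_subset Union_upper)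
  also have "\<dots> = q * k" using P by (simp add: q_def)
  finally have "q * k \<le> r * k" using n by simp
  hence qr: "q \<le> r" using k by simp
  obtain Vp where Vp: "bij_betw Vp {..<q} P"
    using ex_bij_betw_nat_finite[OF finP] by (auto simp: q_def atLeast0LessThan)
  have VpP: "Vp j \<in> P" if "j < q" for j using bij_betwE[OF Vp] that by blast
  have Pim: "P = Vp ` {..<q}" using Vp by (auto simp: bij_betw_def)
  interpret column_system "gadj G" "verts G" Vp q k s t c x
  proof
    show "verts G \<subseteq> \<Union> (Vp ` {..<q})" using PD(1) Pim by blast
    show "disjoint_family_on Vp {..<q}"
      unfolding disjoint_family_on_def
    proof (intro ballI impI)
      fix m n assume "m \<in> {..<q}" "n \<in> {..<q}" "m \<noteq> n"
      hence "Vp m \<noteq> Vp n" "Vp m \<in> P" "Vp n \<in> P"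
        using bij_betw_imp_inj_on[OF Vp] VpP by (auto dest: inj_onD)
      thus "Vp m \<inter> Vp n = {}" using PD(2) by blast
    qed
    show "spread (gadj G) (verts G) q s t c" using sp by (rule spread_mono) (use qr in auto)
    have "real (q * t + 1) \<le> real (r * t + 1)" using qr by (simp add: mult_right_mono)
    thus "real (q * t + 1) \<le> c * real s" using cs by linarith
    show "gadj G v u" if "gadj G u v" for u v using that by (rule gadj_sym)
  qed (use finV gadj_irrefl[OF G] VpP PD(1) P c ck degx deg degree_eq[OF G] in auto)
  obtain C where C: "disjoint_family_on C {..<k}" "\<And>i. i < k \<Longrightarrow> indep (gadj G) (C i)"
    "\<And>i j. i < k \<Longrightarrow> j < q \<Longrightarrow> C i \<inter> Vp j \<noteq> {}" using transversal_partition by blast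
  have uniq: "i = i'" if "v \<in> C i" "v \<in> C i'" "i < k" "i' < k" for v i i'
    using C(1) that by (auto simp: disjoint_family_on_def)
  define g where "g i j = (SOME v. v \<in> C i \<inter> Vp j)" for i j
  have g: "g i j \<in> C i" "g i j \<in> Vp j" if "i < k" "j < q" for i j
    using someI_ex[of "\<lambda>v. v \<in> C i \<inter> Vp j"] C(3)[OF that] unfolding g_def by blast+
  \<comment> \<open>\<open>k\<close> disjoint classes meeting a part of size \<open>k\<close>
    exhaust it, so every vertex gets a colour and every colour occurs once.\<close>
  have gim: "(\<lambda>i. g i j) ` {..<k} = Vp j" if j: "j < q" for j
  proof (rule card_subset_eq)
    show "finite (Vp j)" using finVp[OF j] .
    show "(\<lambda>i. g i j) ` {..<k} \<subseteq> Vp j" using g j by auto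
    have "inj_on (\<lambda>i. g i j) {..<k}"
      using g(1) j uniq by (auto intro!: inj_onI) metis
    thus "card ((\<lambda>i. g i j) ` {..<k}) = card (Vp j)"
      using cardVp[OF j] by (simp add: card_image)
  qed
  define col where "col v = (THE i. i < k \<and> v \<in> C i)" for v
  have col: "col v = i" if "v \<in> C i" "i < k" for v i
    unfolding col_def using that uniq by blast
  have ex: "\<exists>i<k. v = g i j" if "v \<in> Vp j" "j < q" for v j
    using gim[OF that(2)] that(1) by auto
  have colg: "col (g i j) = i" if "i < k" "j < q" for i j using col g that by blast
  have in_col: "col v < k \<and> v \<in> C (col v)" if v: "v \<in> verts G" for v
  proof -
    obtain j where "j < q" "v \<in> Vp j" using v PD(1) Pim by auto
    then obtain i where "i < k" "v = g i j" "j < q" using ex by blast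
    thus ?thesis using colg g by simp
  qed
  have "proper_coloring G k col"
    unfolding proper_coloring_def
  proof (intro conjI ballI allI impI)
    fix u v assume e: "{u, v} \<in> edges G"
    hence uv: "gadj G u v" by (simp add: gadj_def)
    hence "u \<in> verts G" "v \<in> verts G" using gadj_verts[OF G] by blast+
    thus "col u \<noteq> col v" using in_col C(2) uv by (metis indep_def)
  qed (use in_col in blast)
  moreover have "\<exists>!v. v \<in> B \<and> col v = i" if B: "B \<in> P" and i: "i < k" for B i
  proof -
    obtain j where j: "j < q" "B = Vp j" using B Pim by auto
    show ?thesis
    proof (rule ex1I[of _ "g i j"])
      show "g i j \<in> B \<and> col (g i j) = i" using g colg i j by simp
      fix v assume "v \<in> B \<and> col v = i"
      thus "v = g i j" using ex[of v j] j colg by auto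
    qed
  qed
  ultimately show "\<exists>c. proper_coloring G k c \<and> (\<forall>B\<in>P. \<forall>i<k. \<exists>!v. v \<in> B \<and> c v = i)" by blast
qed

section \<open>Padding with isolated vertices\<close>

lemma verts_add_isolated: "verts (add_isolated m G) = verts G <+> {..<m}"
  and edges_add_isolated: "edges (add_isolated m G) = (`) Inl ` edges G"
  by (simp_all add: add_isolated_def)

lemma simple_add_isolated: "simple_graph G \<Longrightarrow> simple_graph (add_isolated m G)"
  by (auto simp: simple_graph_def verts_add_isolated edges_add_isolated card_image)

lemma gadj_add_isolated:
  "gadj (add_isolated m G) a b \<longleftrightarrow> (\<exists>u v. a = Inl u \<and> b = Inl v \<and> gadj G u v)"
proof
  assume "gadj (add_isolated m G) a b"
  then obtain e where e: "e \<in> edges G" "{a, b} = Inl ` e" by (auto simp: gadj_def edges_add_isolated)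
  then obtain u v where uv: "a = Inl u" "b = Inl v" by blast
  have "Inl ` e = Inl ` {u, v}" using e(2) uv by auto
  hence "e = {u, v}" by (simp only: inj_image_eq_iff[OF inj_Inl])
  thus "\<exists>u v. a = Inl u \<and> b = Inl v \<and> gadj G u v" using e uv by (auto simp: gadj_def)
next
  assume "\<exists>u v. a = Inl u \<and> b = Inl v \<and> gadj G u v"
  then obtain u v where "a = Inl u" "b = Inl v" "{u, v} \<in> edges G" by (auto simp: gadj_def)
  thus "gadj (add_isolated m G) a b"
    by (auto simp: gadj_def edges_add_isolated intro!: image_eqI[of _ _ "{u, v}"])
qed

lemma card_verts_add_isolated:
  "finite (verts G) \<Longrightarrow> card (verts (add_isolated m G)) = card (verts G) + m"
  by (simp add: verts_add_isolated card_Plus)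

lemma degree_add_isolated:
  assumes "simple_graph G"
  shows "degree (add_isolated m G) (Inl u) = degree G u" "degree (add_isolated m G) (Inr i) = 0"
proof -
  have "{v \<in> verts (add_isolated m G). gadj (add_isolated m G) (Inl u) v} = Inl ` {v \<in> verts G. gadj G u v}"
    by (auto simp: gadj_add_isolated verts_add_isolated)
  thus "degree (add_isolated m G) (Inl u) = degree G u"
    by (simp add: degree_eq[OF assms] degree_eq[OF simple_add_isolated[OF assms]] card_image)
  show "degree (add_isolated m G) (Inr i) = 0"
    by (simp add: degree_eq[OF simple_add_isolated[OF assms]] gadj_add_isolated)
qed

text \<open>Isolated vertices are dominated by nothing. If they make up at least half of
  \<open>A\<close>, that half survives any set; otherwise the old vertices of \<open>A\<close>
  inherit the property from \<open>G\<close>. This doubles \<open>s\<close> and halves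
  \<open>c\<close>.\<close>

lemma spread_add_isolated:
  fixes G :: "'a graph"
  assumes G: "simple_graph G" and sp: "spread (gadj G) (verts G) r s t c"
    and t: "0 < t" and c: "0 \<le> c" "c \<le> 1"
  shows "spread (gadj (add_isolated m G)) (verts (add_isolated m G)) r (2 * s) t (c / 2)"
  unfolding spread_def
proof (intro allI impI)
  let ?H = "add_isolated m G"
  fix A and C :: "nat \<Rightarrow> ('a + nat) set"
  assume "A \<subseteq> verts ?H \<and> 2 * s \<le> card A \<and> disjoint_family_on C {..<t} \<and>
        (\<forall>i<t. C i \<subseteq> verts ?H \<and> card (C i) \<le> r \<and> C i \<inter> A = {})"
  hence A: "A \<subseteq> verts ?H" "2 * s \<le> card A" and d: "disjoint_family_on C {..<t}"
    and C: "\<And>i. i < t \<Longrightarrow> C i \<subseteq> verts ?H" "\<And>i. i < t \<Longrightarrow> card (C i) \<le> r"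
      "\<And>i. i < t \<Longrightarrow> C i \<inter> A = {}" by auto
  define A1 where "A1 = Inl -` A"
  define A2 where "A2 = A - range Inl"
  define C1 where "C1 i = Inl -` C i" for i
  have finH: "finite (verts ?H)" using simple_add_isolated[OF G] by (auto simp: simple_graph_def)
  have finA: "finite A" using A finH finite_subset by blast
  have A12: "A = Inl ` A1 \<union> A2" by (auto simp: A1_def A2_def)
  have finA12: "finite A1" "finite A2"
    using finA by (auto simp: A1_def A2_def intro: finite_vimageI)
  have cardA: "card A = card A1 + card A2"
    unfolding A12 using finA12 by (subst card_Un_disjoint) (auto simp: A2_def card_image)
  have nb: "A - nbhd (gadj ?H) (C i) \<supseteq> Inl ` (A1 - nbhd (gadj G) (C1 i)) \<union> A2" for i
    by (auto simp: nbhd_def gadj_add_isolated A1_def A2_def C1_def)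
  have nbcard: "card (A1 - nbhd (gadj G) (C1 i)) + card A2 \<le> card (A - nbhd (gadj ?H) (C i))" for i
  proof -
    have "card (A1 - nbhd (gadj G) (C1 i)) + card A2 = card (Inl ` (A1 - nbhd (gadj G) (C1 i)) \<union> A2)"
      using finA12 by (subst card_Un_disjoint) (auto simp: A2_def card_image)
    also have "\<dots> \<le> card (A - nbhd (gadj ?H) (C i))" using nb finA by (intro card_mono) auto
    finally show ?thesis .
  qed
  show "\<exists>i<t. c / 2 * real (card A) \<le> real (card (A - nbhd (gadj ?H) (C i)))"
  proof (cases "card A \<le> 2 * card A1")
    case True
    have "\<exists>i<t. c * real (card A1) \<le> real (card (A1 - nbhd (gadj G) (C1 i)))"
    proof (rule sp[unfolded spread_def, rule_format], intro conjI allI impI)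
      show "A1 \<subseteq> verts G" using A(1) by (auto simp: A1_def verts_add_isolated)
      show "s \<le> card A1" using True A(2) by linarith
      show "disjoint_family_on C1 {..<t}" using d by (auto simp: disjoint_family_on_def C1_def)
      fix i assume i: "i < t"
      show "C1 i \<subseteq> verts G" using C(1)[OF i] by (auto simp: C1_def verts_add_isolated)
      show "C1 i \<inter> A1 = {}" using C(3)[OF i] by (auto simp: C1_def A1_def)
      have "card (C1 i) = card (Inl ` C1 i :: ('a + nat) set)" by (simp add: card_image)
      also have "\<dots> \<le> card (C i)"
        using finite_subset[OF C(1)[OF i] finH] by (intro card_mono) (auto simp: C1_def)
      finally show "card (C1 i) \<le> r" using C(2)[OF i] by linarith
    qed
    then obtain i where i: "i < t" "c * real (card A1) \<le> real (card (A1 - nbhd (gadj G) (C1 i)))" by blast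
    have "c * real (card A) \<le> c * (2 * real (card A1))"
      using True c by (intro mult_left_mono) auto
    thus ?thesis using i nbcard[of i] by (intro exI[of _ i]) auto
  next
    case False
    have "c * real (card A) \<le> 1 * real (card A)" using c by (intro mult_right_mono) auto
    moreover have "real (card A) \<le> 2 * real (card A2)" using False cardA by linarith
    ultimately show ?thesis using nbcard[of 0] t by (intro exI[of _ 0]) auto
  qed
qed

lemma le_mult_nat_ceiling: "0 < k \<Longrightarrow> n \<le> k * nat \<lceil>real n / real k\<rceil>"
proof -
  assume k: "0 < k"
  have "real n / real k \<le> real (nat \<lceil>real n / real k\<rceil>)" by (rule real_nat_ceiling_ge)
  hence "real n \<le> real (nat \<lceil>real n / real k\<rceil>) * real k"
    using k by (subst (asm) pos_divide_le_eq) auto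
  thus "n \<le> k * nat \<lceil>real n / real k\<rceil>" by (metis of_nat_le_iff of_nat_mult mult.commute)
qed

text \<open>Padding costs a factor two in \<open>s\<close> and in \<open>c\<close>, which turns the
  constants 3 and 4 of the divisible case into 24 = 3 * 2 * 4 and 8 = 4 * 2.\<close>

lemma strongly_colorable_if_spread:
  fixes G :: "'a graph"
  assumes G: "simple_graph G" and k: "0 < k" and n: "card (verts G) \<le> r * k"
    and sp: "spread (gadj G) (verts G) r s t c" and t: "0 < t" and c: "0 < c" "c \<le> 1"
    and cs: "real (r * t + 1) \<le> c * real s" and ck: "24 * real s \<le> c\<^sup>2 * real k"
    and degx: "degree G x < k"
    and deg: "\<And>u. u \<in> verts G \<Longrightarrow> u \<noteq> x \<Longrightarrow> degree G u + 8 * s \<le> k"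
  shows "strongly_colorable G k"
proof -
  let ?n = "card (verts G)"
  have cs': "real (r * t + 1) \<le> c / 2 * real (2 * s)" using cs by simp
  have ck': "3 * real (2 * s) \<le> (c / 2)\<^sup>2 * real k" using ck by (simp add: power2_eq_square)
  have finV: "finite (verts G)" using G by (simp add: simple_graph_def)
  show ?thesis
  proof (cases "k dvd ?n")
    case True
    have "strongly_colorable_dvd G k"
    proof (rule strongly_colorable_dvd_if_spread[OF G k n _ _ _ cs' ck' degx])
      show "spread (gadj G) (verts G) r (2 * s) t (c / 2)"
        using sp by (rule spread_mono) (use c in auto)
    qed (use c deg in force)+
    thus ?thesis using True by (simp add: strongly_colorable_def Let_def)
  next
    case False
    define m where "m = k * nat \<lceil>real ?n / real k\<rceil> - ?n"
    let ?H = "add_isolated m G"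
    have "real ?n \<le> real r * real k" using n by (metis of_nat_le_iff of_nat_mult)
    hence "real ?n / real k \<le> real r" using k by (simp add: field_simps)
    hence "\<lceil>real ?n / real k\<rceil> \<le> int r" by (simp add: ceiling_le_iff)
    hence a: "nat \<lceil>real ?n / real k\<rceil> \<le> r" by linarith
    have "?n \<le> k * nat \<lceil>real ?n / real k\<rceil>" by (rule le_mult_nat_ceiling[OF k])
    hence "?n + m = k * nat \<lceil>real ?n / real k\<rceil>" by (simp add: m_def)
    also have "\<dots> \<le> r * k" using a by (simp add: mult.commute)
    finally have nm: "card (verts ?H) \<le> r * k" by (simp add: card_verts_add_isolated[OF finV])
    have "strongly_colorable_dvd ?H k"
    proof (rule strongly_colorable_dvd_if_spread[OF simple_add_isolated[OF G] k nm
          spread_add_isolated[OF G sp t] _ _ cs' ck', of "Inl x"])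
      show "degree ?H (Inl x) < k" using degx degree_add_isolated[OF G] by simp
      fix u assume u: "u \<in> verts ?H" "u \<noteq> Inl x"
      have "8 * s \<le> k"
      proof -
        have "c\<^sup>2 * real k \<le> 1 * real k" using c by (intro mult_right_mono power_le_one) auto
        thus ?thesis using ck by linarith
      qed
      thus "degree ?H u + 4 * (2 * s) \<le> k"
        using u deg degree_add_isolated[OF G] by (cases u) (auto simp: verts_add_isolated)
    qed (use c in auto)
    thus ?thesis using False by (simp add: strongly_colorable_def Let_def m_def)
  qed
qed

section \<open>The lower bound\<close>

lemma equal_partition_exists:
  assumes "finite S" "card S = q * k" "0 < k"
  shows "\<exists>P. partition_on S P \<and> (\<forall>B\<in>P. card B = k)"
  using assms
proof (induction q arbitrary: S)
  case 0
  hence "S = {}" by simp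
  thus ?case by (intro exI[of _ "{}"]) (simp add: partition_on_def)
next
  case (Suc q)
  then obtain B where B: "B \<subseteq> S" "card B = k" by (metis obtain_subset_with_card_n le_add1 mult_Suc)
  have "finite B" using B Suc.prems finite_subset by blast
  have "card (S - B) = q * k" using B Suc.prems by (simp add: card_Diff_subset \<open>finite B\<close>)
  moreover have "finite (S - B)" using Suc.prems by simp
  ultimately obtain P where P: "partition_on (S - B) P" "\<forall>B\<in>P. card B = k"
    using Suc.IH Suc.prems(3) by blast
  have "partition_on (B \<union> (S - B)) (insert B P)"
    using P(1) B Suc.prems(3) unfolding partition_on_def disjoint_def by auto
  moreover have "B \<union> (S - B) = S" using B by blast
  ultimately show ?case using P(2) B(2) by (intro exI[of _ "insert B P"]) auto
qed

lemma degree_less_if_strongly_colorable_dvd: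
  assumes G: "simple_graph G" and k: "0 < k" and d: "k dvd card (verts G)"
    and sc: "strongly_colorable_dvd G k" and v: "v \<in> verts G"
  shows "degree G v < k"
proof (rule ccontr)
  assume "\<not> ?thesis"
  hence "k \<le> card {u \<in> verts G. gadj G v u}" by (simp add: degree_eq[OF G])
  then obtain B where B: "B \<subseteq> {u \<in> verts G. gadj G v u}" "card B = k" "finite B"
    by (rule obtain_subset_with_card_n)
  have finV: "finite (verts G)" using G by (simp add: simple_graph_def)
  obtain q where q: "card (verts G) = k * q" using d by blast
  have "card (verts G - B) = card (verts G) - k" using B by (subst card_Diff_subset) auto
  also have "\<dots> = (q - 1) * k" using q by (metis diff_mult_distrib mult.commute mult_1)
  finally have "card (verts G - B) = (q - 1) * k" .
  then obtain P where P: "partition_on (verts G - B) P" "\<forall>B\<in>P. card B = k"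
    using equal_partition_exists finV k by blast
  have "partition_on (B \<union> (verts G - B)) (insert B P)"
    using P(1) B k unfolding partition_on_def disjoint_def by auto
  moreover have "B \<union> (verts G - B) = verts G" using B by blast
  ultimately have "partition_on (verts G) (insert B P) \<and> (\<forall>C\<in>insert B P. card C = k)"
    using P(2) B(2) by auto
  then obtain c where c: "proper_coloring G k c" "\<And>i. i < k \<Longrightarrow> \<exists>!v. v \<in> B \<and> c v = i"
    using sc unfolding strongly_colorable_dvd_def by (metis insertI1)
  \<comment> \<open>Every colour occurs in \<open>B\<close>, so the colour of \<open>v\<close>
    recurs at a neighbour of \<open>v\<close>.\<close>
  have "c v < k" using c(1) v by (auto simp: proper_coloring_def)
  then obtain u where "u \<in> B" "c u = c v" using c(2) by blast
  moreover have "{v, u} \<in> edges G" using \<open>u \<in> B\<close> B by (auto simp: gadj_def)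
  ultimately show False using c(1) unfolding proper_coloring_def by metis
qed

lemma degree_less_if_strongly_colorable:
  assumes G: "simple_graph G" and k: "0 < k" and sc: "strongly_colorable G k" and v: "v \<in> verts G"
  shows "degree G v < k"
proof (cases "k dvd card (verts G)")
  case True
  thus ?thesis using degree_less_if_strongly_colorable_dvd[OF G k True _ v] sc
    by (simp add: strongly_colorable_def Let_def)
next
  case False
  let ?n = "card (verts G)"
  define m where "m = k * nat \<lceil>real ?n / real k\<rceil> - ?n"
  have finV: "finite (verts G)" using G by (simp add: simple_graph_def)
  have "?n \<le> k * nat \<lceil>real ?n / real k\<rceil>" by (rule le_mult_nat_ceiling[OF k])
  hence "card (verts (add_isolated m G)) = k * nat \<lceil>real ?n / real k\<rceil>"
    by (simp add: m_def card_verts_add_isolated[OF finV])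
  hence "degree (add_isolated m G) (Inl v) < k"
    using sc False v
    by (intro degree_less_if_strongly_colorable_dvd[OF simple_add_isolated[OF G] k])
      (auto simp: strongly_colorable_def Let_def m_def verts_add_isolated)
  thus ?thesis using degree_add_isolated[OF G] by simp
qed

lemma max_degree_less_if_strongly_colorable:
  assumes G: "simple_graph G" and ne: "verts G \<noteq> {}" and k: "0 < k" and sc: "strongly_colorable G k"
  shows "max_degree G < k"
proof -
  have "finite (verts G)" using G by (simp add: simple_graph_def)
  thus ?thesis using degree_less_if_strongly_colorable[OF G k sc] ne
    by (simp add: max_degree_def)
qed

text \<open>The lower bound needs a witness \<open>k\<close> too: \<open>LEAST\<close> is
  informative only if some admissible number exists.\<close>

lemma strong_chromatic_number_bounds:
  assumes G: "simple_graph G" and ne: "verts G \<noteq> {}" and k: "0 < k" and sc: "strongly_colorable G k"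
  shows "max_degree G < strong_chromatic_number G" "strong_chromatic_number G \<le> k"
proof -
  have "0 < strong_chromatic_number G \<and> strongly_colorable G (strong_chromatic_number G)"
    unfolding strong_chromatic_number_def by (rule LeastI[of _ k]) (use k sc in simp)
  thus "max_degree G < strong_chromatic_number G"
    using max_degree_less_if_strongly_colorable[OF G ne] by blast
  show "strong_chromatic_number G \<le> k"
    unfolding strong_chromatic_number_def by (rule Least_le) (use k sc in simp)
qed

section \<open>Independent edges\<close>

abbreviation Pr :: "'a pmf \<Rightarrow> 'a set \<Rightarrow> real" where
  "Pr M \<equiv> measure_pmf.prob M"

abbreviation expect :: "'a pmf \<Rightarrow> ('a \<Rightarrow> real) \<Rightarrow> real" where
  "expect M \<equiv> measure_pmf.expectation M"

definition bits :: "'a set \<Rightarrow> real \<Rightarrow> ('a \<Rightarrow> bool) pmf" where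
  "bits E p = Pi_pmf E False (\<lambda>_. bernoulli_pmf p)"

definition depends_on :: "(('a \<Rightarrow> bool) \<Rightarrow> 'b) \<Rightarrow> 'a set \<Rightarrow> bool" where
  "depends_on F S \<longleftrightarrow> (\<forall>f g. (\<forall>e\<in>S. f e = g e) \<longrightarrow> F f = F g)"

lemma depends_onD: "depends_on F S \<Longrightarrow> (\<And>e. e \<in> S \<Longrightarrow> f e = g e) \<Longrightarrow> F f = F g"
  by (auto simp: depends_on_def)

lemma finite_set_pmf_bits: "finite E \<Longrightarrow> finite (set_pmf (bits E p))"
  unfolding bits_def
  by (rule finite_subset[OF set_Pi_pmf_subset']) (auto intro: finite_PiE_dflt)

lemma integrable_bits: "finite E \<Longrightarrow> integrable (measure_pmf (bits E p)) (f :: _ \<Rightarrow> real)"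
  by (intro integrable_measure_pmf_finite finite_set_pmf_bits)

lemma expectation_pair_pmf_mult:
  fixes F G :: "_ \<Rightarrow> real"
  assumes "finite (set_pmf A)" "finite (set_pmf B)"
  shows "expect (pair_pmf A B) (\<lambda>(x, y). F x * G y) =
    expect A F * expect B G"
proof -
  have "expect (pair_pmf A B) (\<lambda>(x, y). F x * G y) =
      (\<Sum>(x, y)\<in>set_pmf A \<times> set_pmf B. pmf A x * F x * (pmf B y * G y))"
    using assms by (subst integral_measure_pmf_real[of "set_pmf A \<times> set_pmf B"])
      (auto simp: pmf_pair intro!: sum.cong)
  also have "\<dots> = (\<Sum>x\<in>set_pmf A. pmf A x * F x) * (\<Sum>y\<in>set_pmf B. pmf B y * G y)"
    by (simp add: sum_product sum.cartesian_product)
  also have "(\<Sum>x\<in>set_pmf A. pmf A x * F x) = expect A F"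
    using assms by (subst integral_measure_pmf_real[of "set_pmf A"]) (auto simp: mult.commute)
  also have "(\<Sum>y\<in>set_pmf B. pmf B y * G y) = expect B G"
    using assms by (subst integral_measure_pmf_real[of "set_pmf B"]) (auto simp: mult.commute)
  finally show ?thesis .
qed

text \<open>\<open>bits E p\<close> is the product of its restrictions to
  \<open>E \<inter> S\<close> and \<open>E - S\<close>, and each factor of the integrand sees only
  one of them.\<close>

lemma expectation_bits_mult:
  fixes F G :: "_ \<Rightarrow> real"
  assumes E: "finite E" and S: "S \<inter> T = {}" and F: "depends_on F S" and G: "depends_on G T"
  shows "expect (bits E p) (\<lambda>f. F f * G f) =
    expect (bits E p) F * expect (bits E p) G"
proof -
  let ?A = "E \<inter> S" and ?B = "E - S"
  let ?m = "\<lambda>(f :: _ \<Rightarrow> bool, g). \<lambda>x. if x \<in> ?A then f x else g x"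
  have fin: "finite (set_pmf (bits ?A p))" "finite (set_pmf (bits ?B p))"
    using E by (auto intro: finite_set_pmf_bits)
  have "E = ?A \<union> ?B" by blast
  hence "bits E p = map_pmf ?m (pair_pmf (bits ?A p) (bits ?B p))"
    unfolding bits_def using E
    by (subst Pi_pmf_union[symmetric]) (auto simp: Int_Un_distrib2 Int_commute Un_Diff_Int sup_commute)
  moreover have out: "f e = False" if "f \<in> set_pmf (bits ?A p)" "e \<notin> ?A" for f e
    using that E set_Pi_pmf_subset[of ?A False] unfolding bits_def by blast
  moreover have outB: "f e = False" if "f \<in> set_pmf (bits ?B p)" "e \<notin> ?B" for f e
    using that E set_Pi_pmf_subset[of ?B False] unfolding bits_def by blast
  ultimately have eq: "expect (bits E p) (\<lambda>f. F' f * G' f) =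
    expect (bits ?A p) F' * expect (bits ?B p) G'"
    if F': "depends_on F' S" and G': "depends_on G' T" for F' G' :: "_ \<Rightarrow> real"
  proof -
    have "expect (bits E p) (\<lambda>f. F' f * G' f) =
        expect (pair_pmf (bits ?A p) (bits ?B p)) (\<lambda>fg. F' (?m fg) * G' (?m fg))"
      using \<open>bits E p = _\<close> by simp
    also have "\<dots> = expect (pair_pmf (bits ?A p) (bits ?B p)) (\<lambda>(f, g). F' f * G' g)"
    proof (rule integral_cong_AE; (intro AE_pmfI)?)
      fix fg assume fg: "fg \<in> set_pmf (pair_pmf (bits ?A p) (bits ?B p))"
      obtain f g where [simp]: "fg = (f, g)" by force
      have f: "f \<in> set_pmf (bits ?A p)" and g: "g \<in> set_pmf (bits ?B p)" using fg by auto
      \<comment> \<open>At points of \<open>S\<close> outside \<open>E\<close> both functions have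
        the default value \<open>False\<close>.\<close>
      have "F' (?m fg) = F' f"
        by (rule depends_onD[OF F']) (use out[OF f] outB[OF g] in auto)
      moreover have "G' (?m fg) = G' g"
        by (rule depends_onD[OF G']) (use S in auto)
      ultimately show "F' (?m fg) * G' (?m fg) = (case fg of (f, g) \<Rightarrow> F' f * G' g)" by simp
    qed auto
    also have "\<dots> = expect (bits ?A p) F' * expect (bits ?B p) G'"
      by (rule expectation_pair_pmf_mult[OF fin])
    finally show ?thesis .
  qed
  \<comment> \<open>With the other factor constantly 1, \<open>eq\<close> identifies the
    expectations over the two restrictions with those over \<open>bits E p\<close>.\<close>
  have one: "depends_on (\<lambda>_. 1 :: real) S" "depends_on (\<lambda>_. 1 :: real) T" by (auto simp: depends_on_def)
  have "expect (bits E p) F = expect (bits ?A p) F"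
    using eq[OF F one(2)] by simp
  moreover have "expect (bits E p) G = expect (bits ?B p) G"
    using eq[OF one(1) G] by simp
  ultimately show ?thesis using eq[OF F G] by simp
qed

lemma expectation_bits_prod:
  fixes F :: "'i \<Rightarrow> ('e \<Rightarrow> bool) \<Rightarrow> real"
  assumes E: "finite E" and I: "finite I" and d: "disjoint_family_on S I"
    and F: "\<And>i. i \<in> I \<Longrightarrow> depends_on (F i) (S i)"
  shows "expect (bits E p) (\<lambda>f. \<Prod>i\<in>I. F i f) =
    (\<Prod>i\<in>I. expect (bits E p) (F i))"
  using I d F
proof (induction I rule: finite_induct)
  case (insert a I)
  have "depends_on (\<lambda>f. \<Prod>i\<in>I. F i f) (\<Union>i\<in>I. S i)"
    unfolding depends_on_def
  proof (intro allI impI prod.cong refl)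
    fix f g :: "'e \<Rightarrow> bool" and i assume fg: "\<forall>e\<in>\<Union>(S ` I). f e = g e" and i: "i \<in> I"
    show "F i f = F i g" by (rule depends_onD[OF insert.prems(2)]) (use fg i in auto)
  qed
  moreover have "S a \<inter> (\<Union>i\<in>I. S i) = {}" 
    using insert.prems(1) insert.hyps(2) by (auto simp: disjoint_family_on_def)
  ultimately have "expect (bits E p) (\<lambda>f. F a f * (\<Prod>i\<in>I. F i f)) =
     expect (bits E p) (F a) * expect (bits E p) (\<lambda>f. \<Prod>i\<in>I. F i f)"
    using insert.prems(2) by (intro expectation_bits_mult[OF E]) auto
  also have "expect (bits E p) (\<lambda>f. \<Prod>i\<in>I. F i f) = (\<Prod>i\<in>I. expect (bits E p) (F i))"
    using insert.prems by (intro insert.IH) (auto simp: disjoint_family_on_def)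
  finally show ?case using insert.hyps by simp
qed simp

lemma prob_bits_indep:
  assumes E: "finite E" and S: "S \<inter> T = {}" and P: "depends_on P S" and Q: "depends_on Q T"
  shows "Pr (bits E p) {f. P f \<and> Q f} =
    Pr (bits E p) {f. P f} * Pr (bits E p) {f. Q f}"
proof -
  have "depends_on (\<lambda>f. indicat_real {f. P f} f) S" "depends_on (\<lambda>f. indicat_real {f. Q f} f) T"
    using P Q by (auto simp: depends_on_def indicator_def)
  from expectation_bits_mult[OF E S this, of p]
  have "expect (bits E p) (\<lambda>f. indicat_real {f. P f} f * indicat_real {f. Q f} f) =
    Pr (bits E p) {f. P f} * Pr (bits E p) {f. Q f}"
    by simp
  also have "(\<lambda>f. indicat_real {f. P f} f * indicat_real {f. Q f} f) = indicat_real {f. P f \<and> Q f}"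
    by (auto simp: indicator_def)
  finally show ?thesis by simp
qed

lemma bits_subset:
  assumes "finite E" "F \<subseteq> E"
  shows "bits F p = map_pmf (\<lambda>f x. if x \<in> F then f x else False) (bits E p)"
  unfolding bits_def using assms by (rule Pi_pmf_subset)

section \<open>Binomial edge counts and their tails\<close>

lemma map_card_bits:
  assumes E: "finite E" "F \<subseteq> E" and p: "0 \<le> p" "p \<le> 1"
  shows "map_pmf (\<lambda>f. card {e \<in> F. f e}) (bits E p) = binomial_pmf (card F) p"
proof -
  have "finite F" using E finite_subset by blast
  hence "binomial_pmf (card F) p = map_pmf (\<lambda>f. card {e \<in> F. f e}) (bits F p)"
    unfolding bits_def using p by (intro binomial_pmf_altdef') auto
  also have "\<dots> = map_pmf (\<lambda>f. card {e \<in> F. f e}) (bits E p)"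
    unfolding bits_subset[OF E] by (simp add: map_pmf_comp cong: conj_cong)
  finally show ?thesis ..
qed

lemma prob_card_bits:
  assumes "finite E" "F \<subseteq> E" "0 \<le> p" "p \<le> 1"
  shows "Pr (bits E p) {f. P (card {e \<in> F. f e})} = Pr (binomial_pmf (card F) p) {i. P i}"
  unfolding map_card_bits[OF assms, symmetric] by (simp add: vimage_def)

lemma expectation_power_binomial:
  assumes p: "0 \<le> p" "p \<le> 1" and z: "0 \<le> (z :: real)"
  shows "expect (binomial_pmf n p) (\<lambda>i. z ^ i) = (1 - p + p * z) ^ n"
proof -
  let ?D = "bits {..<n} p"
  have "expect (binomial_pmf n p) (\<lambda>i. z ^ i)
      = expect ?D (\<lambda>f. z ^ card {e \<in> {..<n}. f e})"
    using arg_cong[OF map_card_bits[of "{..<n}" "{..<n}" p], of "\<lambda>M. expect M (\<lambda>i. z ^ i)"] p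
    by simp
  also have "(\<lambda>f. z ^ card {e \<in> {..<n}. f e}) = (\<lambda>f. \<Prod>e<n. if f e then z else 1)"
  proof
    fix f show "z ^ card {e \<in> {..<n}. f e} = (\<Prod>e<n. if f e then z else 1)"
      by (simp add: prod.If_cases) (simp add: Int_def)
  qed
  also have "expect ?D (\<lambda>f. \<Prod>e<n. if f e then z else 1) =
      (\<Prod>e<n. expect (bernoulli_pmf p) (\<lambda>b. if b then z else 1))"
    unfolding bits_def using z
    by (intro expectation_prod_Pi_pmf[of "{..<n}" _ "\<lambda>_ b. if b then z else 1"])
      (auto intro!: integrable_measure_pmf_finite)
  also have "expect (bernoulli_pmf p) (\<lambda>b. if b then z else 1) = 1 - p + p * z"
    using p by (simp add: integral_bernoulli_pmf)
  finally show ?thesis by simp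
qed

text \<open>Chernoff's method, with exp l <= 1 + l + l^2 on the unit interval. \<open>l\<close>
  stays free: the gap estimate takes \<open>1 / R\<close>.\<close>

lemma binomial_upper_tail:
  assumes p: "0 \<le> p" "p \<le> 1" and l: "0 \<le> l" "l \<le> 1"
  shows "Pr (binomial_pmf n p) {d..} \<le> exp (real n * p * (l + l\<^sup>2) - l * real d)"
proof -
  have "Pr (binomial_pmf n p) {d..} = expect (binomial_pmf n p) (indicat_real {d..})"
    by simp
  also have "\<dots> \<le> expect (binomial_pmf n p) (\<lambda>i. exp (- l * real d) * exp l ^ i)"
  proof (rule integral_mono)
    have "finite (set_pmf (binomial_pmf n p))" using set_pmf_binomial_eq[of p n] p by (auto split: if_splits)
    thus "integrable (binomial_pmf n p) (indicat_real {d..})" "integrable (binomial_pmf n p) (\<lambda>i. exp (- l * real d) * exp l ^ i)"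
      by (auto intro!: integrable_measure_pmf_finite)
    fix i :: nat
    have "1 \<le> exp (- l * real d) * exp l ^ i" if "d \<le> i"
      using that l by (simp add: exp_of_nat_mult[symmetric] exp_add[symmetric] mult_left_mono mult.commute)
    thus "indicat_real {d..} i \<le> exp (- l * real d) * exp l ^ i"
      by (auto simp: indicator_def)
  qed
  also have "\<dots> = exp (- l * real d) * (1 - p + p * exp l) ^ n"
    by (simp add: expectation_power_binomial[OF p])
  also have "(1 - p + p * exp l) ^ n \<le> exp (p * (l + l\<^sup>2)) ^ n"
  proof (rule power_mono)
    have "exp l \<le> 1 + l + l\<^sup>2" using exp_bound[OF l] .
    hence "p * (exp l - 1) \<le> p * (l + l\<^sup>2)" using p by (intro mult_left_mono) auto
    hence "1 - p + p * exp l \<le> 1 + p * (l + l\<^sup>2)" by (simp add: algebra_simps)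
    also have "\<dots> \<le> exp (p * (l + l\<^sup>2))" by (rule exp_ge_add_one_self)
    finally show "1 - p + p * exp l \<le> exp (p * (l + l\<^sup>2))" .
    show "0 \<le> 1 - p + p * exp l" using p by (simp add: add_nonneg_nonneg)
  qed
  also have "exp (- l * real d) * exp (p * (l + l\<^sup>2)) ^ n = exp (real n * p * (l + l\<^sup>2) - l * real d)"
    by (simp add: exp_of_nat_mult[symmetric] exp_add[symmetric] algebra_simps)
  finally show ?thesis by simp
qed

text \<open>Chernoff's method with the fixed exponent -1; 3/5 is a lower bound for 1 -
  exp(-1).\<close>

lemma binomial_lower_tail:
  assumes p: "0 \<le> p" "p \<le> 1"
  shows "Pr (binomial_pmf n p) {i. real i \<le> a} \<le> exp (a - 3/5 * (real n * p))"
proof -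
  have "Pr (binomial_pmf n p) {i. real i \<le> a} = expect (binomial_pmf n p) (indicat_real {i. real i \<le> a})"
    by simp
  also have "\<dots> \<le> expect (binomial_pmf n p) (\<lambda>i. exp a * exp (-1) ^ i)"
  proof (rule integral_mono)
    have "finite (set_pmf (binomial_pmf n p))" using set_pmf_binomial_eq[of p n] p by (auto split: if_splits)
    thus "integrable (binomial_pmf n p) (indicat_real {i. real i \<le> a})" "integrable (binomial_pmf n p) (\<lambda>i. exp a * exp (-1) ^ i)"
      by (auto intro!: integrable_measure_pmf_finite)
    fix i :: nat
    have "1 \<le> exp a * exp (-1) ^ i" if "real i \<le> a"
      using that by (simp add: exp_of_nat_mult[symmetric] exp_add[symmetric])
    thus "indicat_real {i. real i \<le> a} i \<le> exp a * exp (-1) ^ i"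
      by (auto simp: indicator_def)
  qed
  also have "\<dots> = exp a * (1 - p + p * exp (-1)) ^ n"
    by (simp add: expectation_power_binomial[OF p])
  also have "(1 - p + p * exp (-1)) ^ n \<le> exp (- (3/5 * p)) ^ n"
  proof (rule power_mono)
    have "5/2 \<le> exp (1::real)" using exp_lower_Taylor_quadratic[of 1] by simp
    hence "exp (-1 :: real) \<le> 2/5" by (simp add: exp_minus field_simps)
    hence "p * exp (-1) \<le> p * (2/5 :: real)" using p by (intro mult_left_mono) auto
    hence "1 - p + p * exp (-1) \<le> 1 + (- (3/5 * p))" by (simp add: algebra_simps)
    also have "\<dots> \<le> exp (- (3/5 * p))" by (rule exp_ge_add_one_self)
    finally show "1 - p + p * exp (-1) \<le> exp (- (3/5 * p))" .
    show "0 \<le> 1 - p + p * exp (-1)" using p by (simp add: add_nonneg_nonneg)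
  qed
  also have "exp a * exp (- (3/5 * p)) ^ n = exp (a - 3/5 * (real n * p))"
    by (simp add: exp_of_nat_mult[symmetric] exp_add[symmetric] algebra_simps)
  finally show ?thesis by simp
qed

section \<open>The random graph is spread\<close>

definition bits_graph :: "nat \<Rightarrow> (nat set \<Rightarrow> bool) \<Rightarrow> nat graph" where
  "bits_graph n f = ({..<n}, {e \<in> all_edges n. f e})"

lemma Gnp_conv: "Gnp n p = map_pmf (bits_graph n) (bits (all_edges n) p)"
  unfolding Gnp_def bits_def bits_graph_def ..

lemma prob_Gnp:
  "Pr (Gnp n p) {G. Q G} = Pr (bits (all_edges n) p) {f. Q (bits_graph n f)}"
  by (simp add: Gnp_conv vimage_def)

lemma finite_all_edges [simp]: "finite (all_edges n)"
  unfolding all_edges_def by (rule finite_subset[of _ "Pow {..<n}"]) auto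

lemma simple_bits_graph: "simple_graph (bits_graph n f)"
  by (auto simp: simple_graph_def bits_graph_def all_edges_def)

lemma verts_bits_graph [simp]: "verts (bits_graph n f) = {..<n}"
  by (simp add: bits_graph_def)

lemma gadj_bits_graph: "gadj (bits_graph n f) u v \<longleftrightarrow> u < n \<and> v < n \<and> u \<noteq> v \<and> f {u, v}"
  by (auto simp: gadj_def bits_graph_def all_edges_def card_2_iff doubleton_eq_iff)

lemma edge_in_all_edges: "u < n \<Longrightarrow> v < n \<Longrightarrow> u \<noteq> v \<Longrightarrow> {u, v} \<in> all_edges n"
  by (auto simp: all_edges_def)

text \<open>The events that \<open>v\<close> has no neighbour in \<open>C i\<close>, over all pairs
  (v, i), are independent and have probability at least \<open>c0\<close>. If all \<open>t\<close>
  sets fail, the number of events that occur is at most a quarter of the lower bound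
  \<open>c0 * card A * t\<close> for its mean, and Chernoff's method applies.\<close>

lemma spread_fail_single:
  assumes A: "A \<subseteq> {..<n}" and C: "\<And>i. i < t \<Longrightarrow> C i \<subseteq> {..<n}" "\<And>i. i < t \<Longrightarrow> card (C i) \<le> r"
      "\<And>i. i < t \<Longrightarrow> C i \<inter> A = {}" and d: "disjoint_family_on C {..<t}"
    and p: "0 \<le> p" "p \<le> 1" and c0: "0 < c0" "c0 \<le> (1 - p) ^ r"
  shows "Pr (bits (all_edges n) p)
      {f. \<forall>i<t. real (card (A - nbhd (gadj (bits_graph n f)) (C i))) < c0 / 4 * real (card A)}
    \<le> exp (- (c0 / 4 * (real (card A) * real t)))"
proof -
  let ?D = "bits (all_edges n) p"
  define I where "I = A \<times> {..<t}"
  define S where "S = (\<lambda>(v, i). (\<lambda>u. {u, v}) ` C i)"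
  \<comment> \<open>\<open>Y vi\<close> is exp(-1) to the indicator of the event, so the product of
    all \<open>Y\<close> is exp(-1) to the number of undominated pairs.\<close>
  define Y :: "nat \<times> nat \<Rightarrow> (nat set \<Rightarrow> bool) \<Rightarrow> real"
    where "Y vi f = (if \<forall>e\<in>S vi. \<not> f e then exp (-1) else 1)" for vi f
  have finA: "finite A" using A finite_subset by blast
  have finI: "finite I" using finA by (simp add: I_def)
  have lt: "u < n \<and> v < n \<and> u \<noteq> v" if "v \<in> A" "i < t" "u \<in> C i" for u v i
    using A C(1,3)[OF that(2)] that by auto
  have S_sub: "S vi \<subseteq> all_edges n" if "vi \<in> I" for vi
    using that lt by (auto simp: S_def I_def intro: edge_in_all_edges)
  have S_disj: "disjoint_family_on S I"
    unfolding disjoint_family_on_def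
  proof (intro ballI impI)
    fix a b assume ab: "a \<in> I" "b \<in> I" "a \<noteq> b"
    obtain v i w j where [simp]: "a = (v, i)" "b = (w, j)" by force
    have h: "v \<in> A" "w \<in> A" "i < t" "j < t" using ab by (auto simp: I_def)
    show "S a \<inter> S b = {}"
    proof (rule ccontr)
      assume "S a \<inter> S b \<noteq> {}"
      then obtain u u' where u: "u \<in> C i" "u' \<in> C j" "{u, v} = {u', w}" by (auto simp: S_def)
      have "v \<noteq> u'" using C(3)[OF h(4)] u h by auto
      hence "v = w" "u = u'" using u(3) by (auto simp: doubleton_eq_iff)
      moreover have "i = j" using d u \<open>u = u'\<close> h by (auto simp: disjoint_family_on_def)
      ultimately show False using ab by simp
    qed
  qed
  have EY: "expect ?D (Y vi) \<le> exp (- (c0 / 2))" "0 \<le> expect ?D (Y vi)"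
    if vi: "vi \<in> I" for vi
  proof -
    let ?P = "Pr ?D {f. card {e \<in> S vi. f e} = 0}"
    have finS: "finite (S vi)" using S_sub[OF vi] finite_subset finite_all_edges by blast
    have ev: "card {e \<in> S vi. f e} = 0 \<longleftrightarrow> (\<forall>e\<in>S vi. \<not> f e)" for f
      using finS by auto
    have "?P = Pr (binomial_pmf (card (S vi)) p) {i. i = 0}"
      by (rule prob_card_bits) (use S_sub[OF vi] p in auto)
    also have "\<dots> = (1 - p) ^ card (S vi)"
      using p by (simp add: measure_pmf_single)
    finally have P: "?P = (1 - p) ^ card (S vi)" .
    have "card (S vi) \<le> r"
    proof -
      obtain v i where [simp]: "vi = (v, i)" by force
      have i: "i < t" using vi by (auto simp: I_def)
      have "card (S vi) \<le> card (C i)"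
        unfolding S_def using finite_subset[OF C(1)[OF i]] by (auto intro: card_image_le)
      thus ?thesis using C(2)[OF i] by linarith
    qed
    hence "(1 - p) ^ r \<le> (1 - p) ^ card (S vi)" using p by (intro power_decreasing) auto
    hence cP: "c0 \<le> ?P" using c0 P by linarith
    have Yeq: "Y vi = (\<lambda>f. 1 - (1 - exp (-1)) * indicat_real {f. card {e \<in> S vi. f e} = 0} f)"
      unfolding ev by (auto simp: Y_def indicator_def)
    have "expect ?D (Y vi) = 1 - (1 - exp (-1)) * ?P"
      unfolding Yeq by (subst Bochner_Integration.integral_diff) (auto intro!: integrable_bits)
    also have "\<dots> \<le> 1 - (1/2) * c0"
    proof -
      have "2 \<le> exp (1::real)" using exp_ge_add_one_self[of "1::real"] by simp
      hence "exp (-1 :: real) \<le> 1/2" by (simp add: exp_minus field_simps)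
      hence "(1/2) * c0 \<le> (1 - exp (-1)) * ?P" using cP c0 by (intro mult_mono) auto
      thus ?thesis by simp
    qed
    also have "\<dots> \<le> exp (- (c0 / 2))" using exp_ge_add_one_self[of "- (c0 / 2)"] by simp
    finally show "expect ?D (Y vi) \<le> exp (- (c0 / 2))" .
    show "0 \<le> expect ?D (Y vi)"
      by (rule Bochner_Integration.integral_nonneg) (simp add: Y_def)
  qed
  define B where "B = {f. \<forall>i<t. real (card (A - nbhd (gadj (bits_graph n f)) (C i))) < c0 / 4 * real (card A)}"
  define K where "K = c0 / 4 * (real (card A) * real t)"
  have pos: "0 \<le> (\<Prod>vi\<in>I. Y vi f)" for f by (rule prod_nonneg) (simp add: Y_def)
  have "Pr ?D B = expect ?D (indicat_real B)" by simp
  also have "\<dots> \<le> expect ?D (\<lambda>f. exp K * (\<Prod>vi\<in>I. Y vi f))"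
  proof (rule integral_mono)
    fix f :: "nat set \<Rightarrow> bool"
    let ?U = "{vi \<in> I. \<forall>e\<in>S vi. \<not> f e}"
    show "indicat_real B f \<le> exp K * (\<Prod>vi\<in>I. Y vi f)"
    proof (cases "f \<in> B")
      case True
      have "(\<forall>e\<in>S (v, i). \<not> f e) \<longleftrightarrow> v \<notin> nbhd (gadj (bits_graph n f)) (C i)" if "v \<in> A" "i < t" for v i
        using lt[OF that] by (auto simp: S_def nbhd_def gadj_bits_graph)
      hence "?U = (\<Union>i\<in>{..<t}. (\<lambda>v. (v, i)) ` (A - nbhd (gadj (bits_graph n f)) (C i)))"
        by (auto simp: I_def)
      hence "card ?U = card (\<Union>i\<in>{..<t}. (\<lambda>v. (v, i)) ` (A - nbhd (gadj (bits_graph n f)) (C i)))"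
        by (rule arg_cong)
      also have "\<dots> \<le> (\<Sum>i<t. card ((\<lambda>v. (v, i)) ` (A - nbhd (gadj (bits_graph n f)) (C i))))"
        by (rule card_UN_le) simp
      also have "\<dots> = (\<Sum>i<t. card (A - nbhd (gadj (bits_graph n f)) (C i)))"
        by (intro sum.cong refl card_image) (auto simp: inj_on_def)
      finally have "real (card ?U) \<le> (\<Sum>i<t. real (card (A - nbhd (gadj (bits_graph n f)) (C i))))"
        by (simp only: of_nat_le_iff of_nat_sum[symmetric])
      also have "\<dots> \<le> (\<Sum>i<t. c0 / 4 * real (card A))"
        using True by (intro sum_mono) (auto simp: B_def intro: less_imp_le)
      also have "\<dots> = K" by (simp add: K_def)
      finally have U: "real (card ?U) \<le> K" .
      have "(\<Prod>vi\<in>I. Y vi f) = exp (-1) ^ card ?U"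
        unfolding Y_def using finI by (simp add: prod.If_cases Int_def)
      also have "\<dots> = exp (- real (card ?U))" by (simp add: exp_of_nat_mult[symmetric])
      also have "\<dots> \<ge> exp (- K)" using U by simp
      finally have "exp K * exp (- K) \<le> exp K * (\<Prod>vi\<in>I. Y vi f)" by (intro mult_left_mono) auto
      thus ?thesis using True by (simp add: exp_minus)
    qed (simp add: pos)
  qed (auto intro!: integrable_bits)
  also have "\<dots> = exp K * (\<Prod>vi\<in>I. expect ?D (Y vi))"
  proof -
    have "depends_on (Y vi) (S vi)" for vi
      by (auto simp: depends_on_def Y_def)
    thus ?thesis using expectation_bits_prod[OF finite_all_edges finI S_disj] by simp
  qed
  \<comment> \<open>Each factor is at most exp(-c0/2), so the product is at most exp(-2K), against
    the factor exp K from the deviation.\<close>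
  also have "\<dots> \<le> exp K * (\<Prod>vi\<in>I. exp (- (c0 / 2)))"
    using EY by (intro mult_left_mono prod_mono) auto
  also have "\<dots> = exp K * exp (- (2 * K))"
    by (simp add: K_def I_def card_cartesian_product exp_of_nat_mult[symmetric] algebra_simps)
  also have "\<dots> = exp (- K)" by (simp add: exp_add[symmetric])
  finally show ?thesis unfolding B_def K_def .
qed

text \<open>A set of at most \<open>r\<close> elements is listed in length \<open>r\<close>, padded
  with the dummy entry \<open>n\<close>.\<close>

lemma card_small_subsets: "finite {S. S \<subseteq> {..<n} \<and> card S \<le> r}"
    "card {S. S \<subseteq> {..<n::nat} \<and> card S \<le> r} \<le> (n + 1) ^ r"
proof -
  let ?L = "{xs. set xs \<subseteq> {..n} \<and> length xs = r}"
  have "{S. S \<subseteq> {..<n} \<and> card S \<le> r} \<subseteq> (\<lambda>xs. set xs \<inter> {..<n}) ` ?L"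
  proof
    fix S assume "S \<in> {S. S \<subseteq> {..<n} \<and> card S \<le> r}"
    hence S: "S \<subseteq> {..<n}" "card S \<le> r" by auto
    define xs where "xs = sorted_list_of_set S @ replicate (r - card S) n"
    have finS: "finite S" using S finite_subset by blast
    have "xs \<in> ?L" using S finS by (auto simp: xs_def)
    moreover have "set xs \<inter> {..<n} = S" using S finS by (auto simp: xs_def)
    ultimately show "S \<in> (\<lambda>xs. set xs \<inter> {..<n}) ` ?L" by blast
  qed
  moreover have fin: "finite ?L" by (rule finite_lists_length_eq) simp
  ultimately show "finite {S. S \<subseteq> {..<n} \<and> card S \<le> r}" by (meson finite_imageI finite_subset)
  have "card {S. S \<subseteq> {..<n} \<and> card S \<le> r} \<le> card ((\<lambda>xs. set xs \<inter> {..<n}) ` ?L)"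
    by (rule card_mono) (use fin \<open>_ \<subseteq> _\<close> in auto)
  also have "\<dots> \<le> card ?L" by (rule card_image_le[OF fin])
  also have "\<dots> = (n + 1) ^ r" by (simp add: card_lists_length_eq)
  finally show "card {S. S \<subseteq> {..<n} \<and> card S \<le> r} \<le> (n + 1) ^ r" .
qed

text \<open>Union bound over the sizes \<open>a\<close> of \<open>A\<close>, at most (n+1)^a sets
  and (n+1)^(rt) families. The 16 in \<open>t\<close> bounds the logarithm of the first number by c0
  a t / 16, the 16 in \<open>s\<close> that of the second. From c0 a t / 4 this leaves c0 a t / 8,
  at least 2 ln (n+1); one of the two logarithms pays for the sum over \<open>a\<close>.\<close>

lemma prob_not_spread:
  assumes p: "0 \<le> p" "p \<le> 1" and c0: "0 < c0" "c0 \<le> (1 - p) ^ r"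
    and t: "16 * ln (real (n + 1)) \<le> c0 * real t" and s: "16 * real r * ln (real (n + 1)) \<le> c0 * real s"
    and pos: "0 < r" "0 < t" "0 < s"
  shows "Pr (bits (all_edges n) p)
      {f. \<not> spread (gadj (bits_graph n f)) {..<n} r s t (c0 / 4)} \<le> 1 / real (n + 1)"
proof -
  let ?D = "bits (all_edges n) p"
  let ?N = "real (n + 1)"
  define Bad where "Bad A C = {f. \<forall>i<t. real (card (A - nbhd (gadj (bits_graph n f)) (C i))) < c0 / 4 * real (card A)}"
    for A and C :: "nat \<Rightarrow> nat set"
  define Small where "Small r = {S. S \<subseteq> {..<n} \<and> card S \<le> r}" for r
  define As where "As a = {A. A \<subseteq> {..<n} \<and> card A = a}" for a
  define Cs where "Cs A = {C \<in> PiE {..<t} (\<lambda>_. Small r). disjoint_family_on C {..<t} \<and> (\<forall>i<t. C i \<inter> A = {})}" for A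
  have finSmall: "finite (Small r)" for r using card_small_subsets(1) by (simp add: Small_def)
  have cardSmall: "card (Small r) \<le> (n + 1) ^ r" for r using card_small_subsets(2) by (simp add: Small_def)
  have finAs: "finite (As a)" for a by (rule finite_subset[OF _ finSmall[of a]]) (auto simp: As_def Small_def)
  have cardAs: "card (As a) \<le> (n + 1) ^ a" for a
    by (rule order_trans[OF card_mono[OF finSmall] cardSmall]) (auto simp: As_def Small_def)
  have finCs: "finite (Cs A)" for A
    by (rule finite_subset[of _ "PiE {..<t} (\<lambda>_. Small r)"])
      (use finSmall in \<open>auto simp: Cs_def intro!: finite_PiE\<close>)
  have cardCs: "card (Cs A) \<le> (n + 1) ^ (r * t)" for A
  proof -
    have "card (Cs A) \<le> card (PiE {..<t} (\<lambda>_. Small r))"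
      unfolding Cs_def using finSmall by (intro card_mono) (auto intro!: finite_PiE)
    also have "\<dots> = card (Small r) ^ t" by (simp add: card_PiE)
    also have "\<dots> \<le> ((n + 1) ^ r) ^ t" using cardSmall by (rule power_mono) simp
    finally show ?thesis by (simp add: power_mult)
  qed
  have sub: "{f. \<not> spread (gadj (bits_graph n f)) {..<n} r s t (c0 / 4)} \<subseteq> (\<Union>a\<in>{s..n}. \<Union>A\<in>As a. \<Union>C\<in>Cs A. Bad A C)"
  proof
    fix f assume "f \<in> {f. \<not> spread (gadj (bits_graph n f)) {..<n} r s t (c0 / 4)}"
    then obtain A C where A: "A \<subseteq> {..<n}" "s \<le> card A" and C: "disjoint_family_on C {..<t}"
      "\<And>i. i < t \<Longrightarrow> C i \<subseteq> {..<n} \<and> card (C i) \<le> r \<and> C i \<inter> A = {}"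
      and bad: "\<And>i. i < t \<Longrightarrow> \<not> c0 / 4 * real (card A) \<le> real (card (A - nbhd (gadj (bits_graph n f)) (C i)))"
      unfolding spread_def by auto
    \<comment> \<open>Cut down to \<open>{..<t}\<close> so that the family lies in the finite set
      \<open>PiE\<close>.\<close>
    let ?C = "restrict C {..<t}"
    have "card A \<le> card {..<n}" using A by (intro card_mono) auto
    hence "card A \<in> {s..n}" using A by simp
    moreover have "A \<in> As (card A)" using A by (simp add: As_def)
    moreover have "?C \<in> Cs A" using C by (auto simp: Cs_def Small_def disjoint_family_on_def)
    moreover have "f \<in> Bad A ?C" using bad by (auto simp: Bad_def not_le)
    ultimately show "f \<in> (\<Union>a\<in>{s..n}. \<Union>A\<in>As a. \<Union>C\<in>Cs A. Bad A C)" by blast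
  qed
  have single: "Pr ?D (Bad A C) \<le> exp (- (c0 / 4 * (real a * real t)))"
    if "A \<in> As a" "C \<in> Cs A" for a A C
  proof -
    have "A \<subseteq> {..<n}" "card A = a" using that by (auto simp: As_def)
    moreover have "C i \<subseteq> {..<n} \<and> card (C i) \<le> r \<and> C i \<inter> A = {}" if "i < t" for i
      using \<open>C \<in> Cs A\<close> that by (auto simp: Cs_def Small_def PiE_iff)
    moreover have "disjoint_family_on C {..<t}" using that by (simp add: Cs_def)
    ultimately show ?thesis
      using spread_fail_single[of A n t C r p c0] p c0 unfolding Bad_def by auto
  qed
  have lev: "Pr ?D (\<Union>A\<in>As a. \<Union>C\<in>Cs A. Bad A C) \<le> 1 / ?N ^ 2" if a: "a \<in> {s..n}" for a
  proof -
    let ?e = "exp (- (c0 / 4 * (real a * real t)))"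
    have "Pr ?D (\<Union>A\<in>As a. \<Union>C\<in>Cs A. Bad A C) \<le> (\<Sum>A\<in>As a. Pr ?D (\<Union>C\<in>Cs A. Bad A C))"
      by (rule measure_pmf.finite_measure_subadditive_finite) (use finAs in auto)
    also have "\<dots> \<le> (\<Sum>A\<in>As a. real (n + 1) ^ (r * t) * ?e)"
    proof (rule sum_mono)
      fix A assume A: "A \<in> As a"
      have "Pr ?D (\<Union>C\<in>Cs A. Bad A C) \<le> (\<Sum>C\<in>Cs A. Pr ?D (Bad A C))"
        by (rule measure_pmf.finite_measure_subadditive_finite) (use finCs in auto)
      also have "\<dots> \<le> (\<Sum>C\<in>Cs A. ?e)" using single A by (intro sum_mono)
      also have "\<dots> = real (card (Cs A)) * ?e" by simp
      also have "\<dots> \<le> real ((n + 1) ^ (r * t)) * ?e"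
        using cardCs[of A] by (intro mult_right_mono) (simp_all only: of_nat_le_iff exp_ge_zero)
      finally show "Pr ?D (\<Union>C\<in>Cs A. Bad A C) \<le> real (n + 1) ^ (r * t) * ?e" by simp
    qed
    also have "\<dots> = real (card (As a)) * (real (n + 1) ^ (r * t) * ?e)" by simp
    also have "\<dots> \<le> real ((n + 1) ^ a) * (real (n + 1) ^ (r * t) * ?e)"
      using cardAs[of a] by (intro mult_right_mono) (simp_all only: of_nat_le_iff exp_ge_zero zero_le_power mult_nonneg_nonneg of_nat_0_le_iff)
    also have "\<dots> = exp (real a * ln ?N + (real (r * t) * ln ?N - c0 / 4 * (real a * real t)))"
    proof -
      have N: "real ((n + 1) ^ m) = exp (real m * ln ?N)" "?N ^ m = exp (real m * ln ?N)" for m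
        by (simp_all add: exp_of_nat_mult)
      show ?thesis unfolding N by (simp only: exp_add diff_conv_add_uminus)
    qed
    also have "\<dots> \<le> exp (- (2 * ln ?N))"
    proof -
      have l: "0 \<le> ln ?N" by simp
      have "real a * (16 * ln ?N) \<le> real a * (c0 * real t)" using t by (intro mult_left_mono) auto
      moreover have "real t * (16 * real r * ln ?N) \<le> real t * (c0 * real s)" using s by (intro mult_left_mono) auto
      moreover have "real t * (c0 * real s) \<le> real t * (c0 * real a)" using a c0 by (intro mult_left_mono) auto
      ultimately have "16 * (real a * ln ?N) + 16 * (real (r * t) * ln ?N) \<le> 2 * (c0 * (real a * real t))"
        by (simp add: algebra_simps)
      moreover have "1 * ln ?N \<le> real a * ln ?N" using a pos l by (intro mult_right_mono) auto
      moreover have "0 < r * t" using pos by simp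
      hence "1 \<le> real (r * t)" by linarith
      hence "1 * ln ?N \<le> real (r * t) * ln ?N" using l by (rule mult_right_mono)
      ultimately show ?thesis by simp
    qed
    also have "\<dots> = 1 / ?N ^ 2"
      by (simp only: exp_minus mult_2 exp_add power2_eq_square inverse_eq_divide) simp
    finally show ?thesis .
  qed
  have "Pr ?D {f. \<not> spread (gadj (bits_graph n f)) {..<n} r s t (c0 / 4)}
      \<le> Pr ?D (\<Union>a\<in>{s..n}. \<Union>A\<in>As a. \<Union>C\<in>Cs A. Bad A C)"
    using sub by (intro measure_pmf.finite_measure_mono) auto
  also have "\<dots> \<le> (\<Sum>a\<in>{s..n}. Pr ?D (\<Union>A\<in>As a. \<Union>C\<in>Cs A. Bad A C))"
    by (rule measure_pmf.finite_measure_subadditive_finite) auto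
  also have "\<dots> \<le> (\<Sum>a\<in>{s..n}. 1 / ?N ^ 2)" using lev by (intro sum_mono)
  also have "\<dots> = real (Suc n - s) / ?N ^ 2" by simp
  also have "\<dots> \<le> ?N / ?N ^ 2" by (intro divide_right_mono) auto
  also have "\<dots> = 1 / ?N" by (simp add: power2_eq_square)
  finally show ?thesis .
qed

lemma card_edges_at:
  assumes "v < n" shows "card {e \<in> all_edges n. v \<in> e} = n - 1"
proof -
  have "{e \<in> all_edges n. v \<in> e} = (\<lambda>u. {v, u}) ` ({..<n} - {v})"
  proof (intro equalityI subsetI)
    fix e assume e: "e \<in> {e \<in> all_edges n. v \<in> e}"
    then obtain a b where "e = {a, b}" "a \<noteq> b" "a < n" "b < n" "v \<in> e" by (auto simp: all_edges_def card_2_iff)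
    thus "e \<in> (\<lambda>u. {v, u}) ` ({..<n} - {v})" by auto
  qed (use assms in \<open>auto simp: all_edges_def\<close>)
  moreover have "inj_on (\<lambda>u. {v, u}) ({..<n} - {v})" by (auto simp: inj_on_def doubleton_eq_iff)
  ultimately show ?thesis using assms by (simp add: card_image)
qed

lemma degree_bits_graph: "degree (bits_graph n f) v = card {e \<in> {e \<in> all_edges n. v \<in> e}. f e}"
  unfolding degree_def bits_graph_def by (rule arg_cong[of _ _ card]) auto

lemma prob_degree:
  assumes "v < n" "0 \<le> p" "p \<le> 1"
  shows "Pr (bits (all_edges n) p) {f. P (degree (bits_graph n f) v)} =
    Pr (binomial_pmf (n - 1) p) {i. P i}"
  unfolding degree_bits_graph using prob_card_bits[of "all_edges n" "{e \<in> all_edges n. v \<in> e}" p P] assms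
  by (simp add: card_edges_at)

section \<open>The gap below the maximum degree\<close>

definition binom_tail :: "nat \<Rightarrow> real \<Rightarrow> nat \<Rightarrow> real" where
  "binom_tail N p d = Pr (binomial_pmf N p) {d..}"

lemma binom_tail_0: "binom_tail N p 0 = 1"
  by (simp add: binom_tail_def measure_pmf.prob_space[simplified])

lemma binom_tail_nonneg: "0 \<le> binom_tail N p d"
  by (simp add: binom_tail_def)

lemma binom_tail_antimono: "d \<le> e \<Longrightarrow> binom_tail N p e \<le> binom_tail N p d"
  unfolding binom_tail_def by (rule measure_pmf.finite_measure_mono) auto

lemma binom_tail_Suc: "binom_tail N p d = pmf (binomial_pmf N p) d + binom_tail N p (Suc d)"
proof -
  have "{d..} = {d} \<union> {Suc d..}" by auto
  hence "binom_tail N p d = Pr (binomial_pmf N p) {d} + binom_tail N p (Suc d)"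
    unfolding binom_tail_def by (simp only:) (subst measure_pmf.finite_measure_Union, auto)
  thus ?thesis by (simp add: measure_pmf_single)
qed

text \<open>Without the edge \<open>{u, v}\<close> the degrees of \<open>u\<close> and \<open>v\<close> are independent.\<close>

definition degree_without :: "nat \<Rightarrow> nat \<Rightarrow> nat \<Rightarrow> (nat set \<Rightarrow> bool) \<Rightarrow> nat" where
  "degree_without n v u f = card {e \<in> {e \<in> all_edges n. u \<in> e} - {{u, v}}. f e}"

lemma degree_without:
  assumes "u < n" "v < n" "u \<noteq> v"
  shows "degree (bits_graph n f) u = degree_without n v u f + of_bool (f {u, v})"
proof -
  let ?S = "{e \<in> {e \<in> all_edges n. u \<in> e} - {{u, v}}. f e}"
  have fin: "finite ?S" by (rule finite_subset[OF _ finite_all_edges[of n]]) auto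
  have "{e \<in> {e \<in> all_edges n. u \<in> e}. f e} = (if f {u, v} then insert {u, v} ?S else ?S)"
    using edge_in_all_edges[OF assms] by auto
  thus ?thesis using fin by (simp add: degree_bits_graph degree_without_def)
qed

lemma depends_on_degree_without:
  "depends_on (\<lambda>f. P (degree_without n v u f)) ({e \<in> all_edges n. u \<in> e} - {{u, v}})"
  unfolding depends_on_def degree_without_def
  by (intro allI impI arg_cong[of _ _ P] arg_cong[of _ _ card]) auto

lemma prob_degree_without:
  assumes "u < n" "v < n" "u \<noteq> v" "0 \<le> p" "p \<le> 1"
  shows "Pr (bits (all_edges n) p) {f. P (degree_without n v u f)} =
    Pr (binomial_pmf (n - 2) p) {i. P i}"
proof -
  have "card ({e \<in> all_edges n. u \<in> e} - {{u, v}}) = n - 2"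
    using card_edges_at[OF assms(1)] edge_in_all_edges[OF assms(1-3)]
    by (subst card_Diff_singleton) auto
  thus ?thesis unfolding degree_without_def
    using prob_card_bits[of "all_edges n" "{e \<in> all_edges n. u \<in> e} - {{u, v}}" p P] assms by auto
qed

lemma prob_degrees_without:
  assumes uv: "u < n" "v < n" "u \<noteq> v" and p: "0 \<le> p" "p \<le> 1"
  shows "Pr (bits (all_edges n) p) {f. P (degree_without n v u f) \<and> Q (degree_without n u v f)} =
    Pr (binomial_pmf (n - 2) p) {i. P i} * Pr (binomial_pmf (n - 2) p) {i. Q i}"
proof -
  have "({e \<in> all_edges n. u \<in> e} - {{u, v}}) \<inter> ({e \<in> all_edges n. v \<in> e} - {{v, u}}) = {}"
    using uv by (auto simp: all_edges_def card_2_iff)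
  note prob_bits_indep[OF finite_all_edges this depends_on_degree_without[where P = P]
      depends_on_degree_without[where P = Q], where p = p]
  thus ?thesis using prob_degree_without uv p by simp
qed

text \<open>The edge between \<open>u\<close> and \<open>v\<close> adds at most one to each degree,
  hence \<open>d - 1\<close>.\<close>

lemma prob_degrees_ge:
  assumes uv: "u < n" "v < n" "u \<noteq> v" and p: "0 \<le> p" "p \<le> 1"
  shows "Pr (bits (all_edges n) p) {f. d \<le> degree (bits_graph n f) u \<and> d \<le> degree (bits_graph n f) v}
    \<le> (binom_tail (n - 2) p (d - 1))\<^sup>2"
proof -
  have "Pr (bits (all_edges n) p) {f. d \<le> degree (bits_graph n f) u \<and> d \<le> degree (bits_graph n f) v}
    \<le> Pr (bits (all_edges n) p) {f. d - 1 \<le> degree_without n v u f \<and> d - 1 \<le> degree_without n u v f}"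
    using degree_without[OF uv] degree_without[OF uv(2,1)] uv(3)
    by (intro measure_pmf.finite_measure_mono) (auto split: if_splits)
  also have "\<dots> = (binom_tail (n - 2) p (d - 1))\<^sup>2"
    unfolding prob_degrees_without[OF assms] by (simp add: binom_tail_def power2_eq_square atLeast_def)
  finally show ?thesis .
qed

text \<open>The edge between \<open>u\<close> and \<open>v\<close> contributes equally to both
  degrees, so closeness passes to the independent degrees without it. Given the value
  \<open>x\<close> of the first, the second lies in a window of at most 2g + 1 values, each of
  probability at most \<open>B\<close>.\<close>

lemma prob_degrees_close:
  assumes uv: "u < n" "v < n" "u \<noteq> v" and p: "0 \<le> p" "p \<le> 1"
    and B: "\<And>y. a - 1 \<le> y \<Longrightarrow> pmf (binomial_pmf (n - 2) p) y \<le> B"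
  shows "Pr (bits (all_edges n) p)
      {f. a \<le> degree (bits_graph n f) u \<and> a \<le> degree (bits_graph n f) v \<and>
          degree (bits_graph n f) u \<le> degree (bits_graph n f) v + g \<and>
          degree (bits_graph n f) v \<le> degree (bits_graph n f) u + g}
    \<le> binom_tail (n - 2) p (a - 1) * (real (2 * g + 1) * B)"
    (is "Pr _ ?T \<le> _")
proof -
  let ?D = "bits (all_edges n) p" and ?M = "binomial_pmf (n - 2) p"
  let ?X = "degree_without n v u" and ?Y = "degree_without n u v"
  let ?c = "a - 1"
  let ?E = "\<lambda>x. {f. ?X f = x \<and> ?Y f \<in> {y. ?c \<le> y \<and> x - g \<le> y \<and> y \<le> x + g}}"
  have B0: "0 \<le> B" using B[of ?c] pmf_nonneg[of ?M ?c] by linarith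
  have bound: "?X f \<le> n" for f
  proof -
    have "?X f \<le> card {e \<in> all_edges n. u \<in> e}"
      unfolding degree_without_def by (rule card_mono) auto
    thus ?thesis using card_edges_at[OF uv(1)] by linarith
  qed
  have "Pr ?D
      ?T
    \<le> Pr ?D (\<Union>x\<in>{?c..n}. ?E x)"
  proof (rule measure_pmf.finite_measure_mono)
    have "{v, u} = {u, v}" by auto
    thus "?T \<subseteq> (\<Union>x\<in>{?c..n}. ?E x)"
      using degree_without[OF uv] degree_without[OF uv(2,1)] uv(3) bound by auto
  qed auto
  also have "\<dots> \<le> (\<Sum>x\<in>{?c..n}. Pr ?D (?E x))"
    by (rule measure_pmf.finite_measure_subadditive_finite) auto
  also have "\<dots> \<le> (\<Sum>x\<in>{?c..n}. pmf ?M x * (real (2 * g + 1) * B))"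
  proof (rule sum_mono)
    fix x
    let ?S = "{y. ?c \<le> y \<and> x - g \<le> y \<and> y \<le> x + g}"
    have "?S \<subseteq> {x - g..x + g}" by auto
    hence S: "finite ?S" "card ?S \<le> 2 * g + 1"
      using card_mono[of "{x - g..x + g}" ?S] finite_subset by auto
    have "Pr ?D (?E x) = Pr ?M {i. i = x} * Pr ?M ?S"
      using prob_degrees_without[OF uv p, of "\<lambda>i. i = x" "\<lambda>i. i \<in> ?S"] by simp
    moreover have "Pr ?M {i. i = x} = pmf ?M x" by (simp add: measure_pmf_single)
    moreover have "Pr ?M ?S \<le> real (2 * g + 1) * B"
    proof -
      have "Pr ?M ?S = (\<Sum>y\<in>?S. pmf ?M y)" using S by (simp add: measure_measure_pmf_finite)
      also have "\<dots> \<le> real (card ?S) * B" using B by (intro sum_bounded_above) auto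
      also have "\<dots> \<le> real (2 * g + 1) * B"
      proof (rule mult_right_mono)
        show "real (card ?S) \<le> real (2 * g + 1)" using S(2) by (simp only: of_nat_le_iff)
      qed (rule B0)
      finally show ?thesis .
    qed
    ultimately show "Pr ?D (?E x) \<le> pmf ?M x * (real (2 * g + 1) * B)"
      by (simp only: mult_left_mono[OF _ pmf_nonneg])
  qed
  also have "\<dots> = Pr ?M {?c..n} * (real (2 * g + 1) * B)"
    by (simp add: sum_distrib_right[symmetric] measure_measure_pmf_finite)
  also have "Pr ?M {?c..n} \<le> binom_tail (n - 2) p ?c"
    unfolding binom_tail_def by (rule measure_pmf.finite_measure_mono) auto
  finally show ?thesis using B0 by (simp add: mult_right_mono)
qed

text \<open>Second moment method for the number \<open>Z\<close> of vertices of degree at least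
  \<open>d\<close>. A pair contributes at most the squared tail at \<open>d - 1\<close>, so the
  variance is small relative to the squared mean if the mean is large and the tail hardly changes
  from \<open>d - 1\<close> to \<open>d\<close>.\<close>

lemma prob_no_large_degree:
  assumes n: "2 \<le> n" and p: "0 \<le> p" "p \<le> 1" and pos: "0 < binom_tail (n - 2) p d"
  shows "Pr (bits (all_edges n) p) {f. \<forall>v<n. \<not> d \<le> degree (bits_graph n f) v}
    \<le> 1 / (real n * binom_tail (n - 2) p d) + ((binom_tail (n - 2) p (d - 1) / binom_tail (n - 2) p d)\<^sup>2 - 1)"
proof -
  let ?D = "bits (all_edges n) p" and ?\<tau> = "binom_tail (n - 2) p"
  let ?A = "\<lambda>v. {f. d \<le> degree (bits_graph n f) v}"
  let ?Z = "{f. \<forall>v<n. \<not> d \<le> degree (bits_graph n f) v}"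
  define T where "T = Pr (binomial_pmf (n - 1) p) {d..}"
  have T: "Pr ?D (?A v) = T" if "v < n" for v
    using prob_degree[OF that p] by (simp add: T_def atLeast_def)
  have "?\<tau> d = Pr ?D {f. d \<le> degree_without n 1 0 f}"
    using n p by (subst prob_degree_without) (auto simp: binom_tail_def atLeast_def)
  also have "\<dots> \<le> Pr ?D (?A 0)"
    using n by (intro measure_pmf.finite_measure_mono) (auto simp: degree_without[of 0 n 1])
  finally have \<tau>T: "?\<tau> d \<le> T" using T[of 0] n by simp
  define \<mu> where "\<mu> = real n * T"
  have n\<tau>: "real n * ?\<tau> d \<le> \<mu>" using \<tau>T by (simp add: \<mu>_def mult_left_mono)
  have n\<tau>0: "0 < real n * ?\<tau> d" using n pos by simp
  have \<mu>0: "0 < \<mu>" using n\<tau> n\<tau>0 by linarith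
  define Z where "Z f = (\<Sum>v<n. indicat_real (?A v) f)" for f
  note int = integrable_bits[OF finite_all_edges[of n], of p]
  have EZ: "expect ?D Z = \<mu>"
    unfolding Z_def using T by (subst Bochner_Integration.integral_sum) (auto intro: int simp: \<mu>_def)
  have EZ2: "expect ?D (\<lambda>f. (Z f)\<^sup>2) \<le> \<mu> + (real n * ?\<tau> (d - 1))\<^sup>2"
  proof -
    have "(\<lambda>f. (Z f)\<^sup>2) = (\<lambda>f. \<Sum>u<n. \<Sum>v<n. indicat_real (?A u \<inter> ?A v) f)"
      by (simp add: Z_def power2_eq_square sum_product indicator_inter_arith)
    hence "expect ?D (\<lambda>f. (Z f)\<^sup>2) = (\<Sum>u<n. \<Sum>v<n. Pr ?D (?A u \<inter> ?A v))"
      by (simp add: Bochner_Integration.integral_sum int)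
    also have "\<dots> \<le> (\<Sum>u<n. \<Sum>v<n. (if v = u then T else 0) + (?\<tau> (d - 1))\<^sup>2)"
    proof (intro sum_mono)
      fix u v assume "u \<in> {..<n}" "v \<in> {..<n}"
      thus "Pr ?D (?A u \<inter> ?A v) \<le> (if v = u then T else 0) + (?\<tau> (d - 1))\<^sup>2"
        using T[of u] prob_degrees_ge[of u n v p d] p by (auto simp: Collect_conj_eq)
    qed
    also have "\<dots> = (\<Sum>u<n. T + real n * (?\<tau> (d - 1))\<^sup>2)"
      by (intro sum.cong refl) (simp add: sum.distrib)
    also have "\<dots> = \<mu> + (real n * ?\<tau> (d - 1))\<^sup>2"
      by (simp add: \<mu>_def power2_eq_square algebra_simps)
    finally show ?thesis .
  qed
  \<comment> \<open>Chebyshev's inequality written out: where \<open>Z\<close> vanishes, (Z -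
    \<mu>)^2 equals \<mu>^2.\<close>
  have "\<mu>\<^sup>2 * Pr ?D ?Z = expect ?D (\<lambda>f. \<mu>\<^sup>2 * indicat_real ?Z f)" by simp
  also have "\<dots> \<le> expect ?D (\<lambda>f. (Z f)\<^sup>2 - 2 * \<mu> * Z f + \<mu>\<^sup>2)"
  proof (rule integral_mono[OF int int])
    fix f :: "nat set \<Rightarrow> bool"
    have "Z f = 0" if "f \<in> ?Z" using that by (simp add: Z_def)
    moreover have "0 \<le> (Z f - \<mu>)\<^sup>2" by simp
    hence "0 \<le> (Z f)\<^sup>2 - 2 * \<mu> * Z f + \<mu>\<^sup>2" by (simp add: power2_diff algebra_simps)
    ultimately show "\<mu>\<^sup>2 * indicat_real ?Z f \<le> (Z f)\<^sup>2 - 2 * \<mu> * Z f + \<mu>\<^sup>2"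
      by (cases "f \<in> ?Z") auto
  qed
  also have "\<dots> = expect ?D (\<lambda>f. (Z f)\<^sup>2) - 2 * \<mu> * \<mu> + \<mu>\<^sup>2"
    by (simp add: int EZ)
  also have "\<dots> \<le> \<mu> + (real n * ?\<tau> (d - 1))\<^sup>2 - \<mu>\<^sup>2"
    using EZ2 by (simp add: power2_eq_square)
  finally have "Pr ?D ?Z \<le> (\<mu> + (real n * ?\<tau> (d - 1))\<^sup>2 - \<mu>\<^sup>2) / \<mu>\<^sup>2"
    using \<mu>0 by (subst pos_le_divide_eq) (auto simp: mult.commute)
  also have "\<dots> = 1 / \<mu> + ((real n * ?\<tau> (d - 1) / \<mu>)\<^sup>2 - 1)"
    using \<mu>0 by (simp add: diff_divide_distrib add_divide_distrib power_divide) (simp add: power2_eq_square)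
  also have "1 / \<mu> \<le> 1 / (real n * ?\<tau> d)" using n\<tau> n\<tau>0 by (intro divide_left_mono) auto
  also have "(real n * ?\<tau> (d - 1) / \<mu>)\<^sup>2 \<le> (real n * ?\<tau> (d - 1) / (real n * ?\<tau> d))\<^sup>2"
    using n\<tau> n\<tau>0 binom_tail_nonneg[of "n - 2" p "d - 1"]
    by (intro power_mono divide_left_mono divide_nonneg_nonneg) auto
  also have "real n * ?\<tau> (d - 1) / (real n * ?\<tau> d) = ?\<tau> (d - 1) / ?\<tau> d" using n by simp
  finally show ?thesis by simp
qed

abbreviation has_gap :: "nat \<Rightarrow> nat \<Rightarrow> (nat set \<Rightarrow> bool) \<Rightarrow> bool" where
  "has_gap n g f \<equiv> \<exists>x<n. \<forall>u<n. u \<noteq> x \<longrightarrow> degree (bits_graph n f) u + g < degree (bits_graph n f) x"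

text \<open>\<open>d0\<close> is the largest degree such that the expected number of vertices of degree at least \<open>d0\<close> is about
  \<open>\<omega>\<close>. Some vertex reaches \<open>d0\<close> by the second moment method, and few pairs of vertices have close degrees
  above \<open>d0 - g\<close>, as the local probabilities there are a factor \<open>\<delta>\<close> smaller than the tail.\<close>

lemma prob_no_gap:
  assumes n: "2 \<le> n" and p: "0 \<le> p" "p \<le> 1"
    and \<delta>: "0 < \<delta>" "real (g + 1) * \<delta> \<le> 1/4" "1 / real n \<le> \<delta>"
    and \<beta>: "\<And>d. d \<le> D \<Longrightarrow> pmf (binomial_pmf (n - 2) p) d \<le> \<delta> * binom_tail (n - 2) p d"
    and D: "binom_tail (n - 2) p D \<le> 1 / (real n)\<^sup>2" and \<omega>: "1 \<le> \<omega>" "\<omega> \<le> real n"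
  shows "Pr (bits (all_edges n) p)
      {f. \<not> has_gap n g f}
    \<le> 1 / \<omega> + 4 * \<delta> + 16 * \<omega>\<^sup>2 * real (2 * g + 1) * \<delta>"
proof -
  let ?D = "bits (all_edges n) p" and ?\<tau> = "binom_tail (n - 2) p"
  let ?deg = "\<lambda>f. degree (bits_graph n f)"
  have n0: "0 < real n" using n by simp
  have "1 * \<delta> \<le> real (g + 1) * \<delta>" using \<delta> by (intro mult_right_mono) auto
  hence \<delta>4: "\<delta> \<le> 1/4" using \<delta> by linarith
  \<comment> \<open>From \<open>D\<close> on, n times the tail is below 1 <= \<omega>; this bounds
    the set whose greatest element is \<open>d0\<close>.\<close>
  have above_D: "\<not> \<omega> \<le> real n * ?\<tau> d" if "D \<le> d" for d
  proof -
    have "real n * ?\<tau> d \<le> real n * (1 / (real n)\<^sup>2)"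
      using binom_tail_antimono[OF that, of "n - 2" p] D by (intro mult_left_mono) auto
    also have "\<dots> = 1 / real n" using n0 by (simp add: power2_eq_square)
    also have "\<dots> < 1" using n by simp
    finally show ?thesis using \<omega> by linarith
  qed
  define d0 where "d0 = (GREATEST d. \<omega> \<le> real n * ?\<tau> d)"
  have ex: "\<omega> \<le> real n * ?\<tau> 0" using \<omega> by (simp add: binom_tail_0)
  have bd: "\<forall>d. \<omega> \<le> real n * ?\<tau> d \<longrightarrow> d \<le> D" using above_D nat_le_linear by blast
  have d0: "\<omega> \<le> real n * ?\<tau> d0"
    unfolding d0_def by (rule GreatestI_nat[where P = "\<lambda>d. \<omega> \<le> real n * ?\<tau> d" and b = D]) (use ex bd in auto)
  have d0Suc: "real n * ?\<tau> (Suc d0) < \<omega>"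
  proof (rule ccontr)
    assume "\<not> ?thesis"
    hence "Suc d0 \<le> d0"
      unfolding d0_def by (intro Greatest_le_nat[where b = D]) (use bd in auto)
    thus False by simp
  qed
  have d0D: "Suc d0 \<le> D" using above_D[of d0] d0 by (meson not_less_eq_eq)
  \<comment> \<open>From \<open>d - 1\<close> to \<open>d\<close> the tail loses the point
    probability at \<open>d - 1\<close>, at most its fraction \<delta>.\<close>
  have step: "?\<tau> (d - 1) * (1 - \<delta>) \<le> ?\<tau> d" if "d \<le> D" for d
  proof (cases d)
    case 0
    thus ?thesis using \<delta> by (simp add: binom_tail_0)
  next
    case (Suc e)
    have "pmf (binomial_pmf (n - 2) p) e \<le> \<delta> * ?\<tau> e" using \<beta>[of e] Suc that by simp
    thus ?thesis using Suc binom_tail_Suc[of "n - 2" p e] by (simp add: algebra_simps)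
  qed
  have chain: "?\<tau> (d0 - j) * (1 - \<delta>) ^ j \<le> ?\<tau> d0" for j
  proof (induction j)
    case (Suc j)
    have "?\<tau> (d0 - Suc j) * (1 - \<delta>) \<le> ?\<tau> (d0 - j)"
      using step[of "d0 - j"] d0D by simp
    hence "?\<tau> (d0 - Suc j) * (1 - \<delta>) * (1 - \<delta>) ^ j \<le> ?\<tau> (d0 - j) * (1 - \<delta>) ^ j"
      using \<delta>4 by (intro mult_right_mono) auto
    thus ?case using Suc by (simp add: mult.assoc)
  qed simp
  have "?\<tau> d0 * (3/4) \<le> ?\<tau> d0 * (1 - \<delta>)" using \<delta>4 binom_tail_nonneg by (intro mult_left_mono) auto
  also have "\<dots> \<le> ?\<tau> (Suc d0)" using step[OF d0D] by simp
  finally have "real n * (?\<tau> d0 * (3/4)) \<le> real n * ?\<tau> (Suc d0)" by (intro mult_left_mono) auto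
  hence "real n * (?\<tau> d0 * (3/4)) \<le> \<omega>" using d0Suc by linarith
  hence 1: "real n * ?\<tau> d0 * (3/4) \<le> \<omega>" by simp
  define a where "a = d0 - g"
  \<comment> \<open>By Bernoulli's inequality, going down \<open>g + 1\<close> steps raises the tail
    by a factor of at most 4/3; the step beyond \<open>g\<close> pays for the edge between the two
    vertices.\<close>
  have "3/4 \<le> 1 + real (g + 1) * (- \<delta>)" using \<delta> by simp
  also have "\<dots> \<le> (1 + (- \<delta>)) ^ (g + 1)" by (rule Bernoulli_inequality) (use \<delta>4 in auto)
  finally have "?\<tau> (d0 - (g + 1)) * (3/4) \<le> ?\<tau> (d0 - (g + 1)) * (1 - \<delta>) ^ (g + 1)"
    using binom_tail_nonneg by (intro mult_left_mono) auto
  also have "\<dots> \<le> ?\<tau> d0" by (rule chain)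
  finally have "?\<tau> (a - 1) * (3/4) \<le> ?\<tau> d0" by (simp add: a_def)
  hence "real n * (?\<tau> (a - 1) * (3/4)) \<le> real n * ?\<tau> d0" using n0 by (intro mult_left_mono) auto
  hence "real n * ?\<tau> (a - 1) \<le> 4 * \<omega>" using 1 \<omega> by linarith
  hence \<tau>a: "?\<tau> (a - 1) \<le> 4 * \<omega> / real n" using n0 by (simp add: field_simps)
  define B where "B = 4 * \<delta> * \<omega> / real n"
  have B0: "0 \<le> B" using \<delta> \<omega> by (simp add: B_def)
  have B: "pmf (binomial_pmf (n - 2) p) y \<le> B" if y: "a - 1 \<le> y" for y
  proof (cases "y \<le> D")
    case True
    have "pmf (binomial_pmf (n - 2) p) y \<le> \<delta> * ?\<tau> y" by (rule \<beta>[OF True])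
    also have "\<dots> \<le> \<delta> * (4 * \<omega> / real n)"
      using binom_tail_antimono[OF y, of "n - 2" p] \<tau>a \<delta> by (intro mult_left_mono) auto
    finally show ?thesis by (simp add: B_def mult.assoc mult.left_commute)
  next
    case False
    have "pmf (binomial_pmf (n - 2) p) y \<le> ?\<tau> y"
      using binom_tail_Suc[of "n - 2" p y] binom_tail_nonneg[of "n - 2" p "Suc y"] by linarith
    also have "\<dots> \<le> 1 / (real n)\<^sup>2" using binom_tail_antimono[of D y "n - 2" p] False D by simp
    also have "\<dots> = (1 / real n) * (1 / real n)" by (simp add: power2_eq_square)
    also have "\<dots> \<le> \<delta> * (4 * \<omega> / real n)"
      using \<delta> \<omega> n0 by (intro mult_mono divide_right_mono) auto
    finally show ?thesis by (simp add: B_def mult.assoc mult.left_commute)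
  qed
  let ?Z = "{f. \<forall>v<n. \<not> d0 \<le> ?deg f v}"
  let ?C = "\<lambda>u v. {f. a \<le> ?deg f u \<and> a \<le> ?deg f v \<and> ?deg f u \<le> ?deg f v + g \<and> ?deg f v \<le> ?deg f u + g}"
  let ?I = "{(u, v). u < n \<and> v < n \<and> u \<noteq> v}"
  have "?I \<subseteq> {..<n} \<times> {..<n}" by auto
  hence I: "finite ?I" "card ?I \<le> n * n"
    using finite_subset card_mono[of "{..<n} \<times> {..<n}" ?I] by (blast, simp add: card_cartesian_product)
  have sub: "{f. \<not> has_gap n g f} \<subseteq> ?Z \<union> (\<Union>(u, v)\<in>?I. ?C u v)"
  proof
    fix f assume "f \<in> {f. \<not> has_gap n g f}"
    hence nog: "\<not> has_gap n g f" by simp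
    show "f \<in> ?Z \<union> (\<Union>(u, v)\<in>?I. ?C u v)"
    proof (cases "f \<in> ?Z")
      case False
      then obtain v where v: "v < n" "d0 \<le> ?deg f v" by auto
      have "0 \<in> {..<n}" using n by simp
      hence "Max (?deg f ` {..<n}) \<in> ?deg f ` {..<n}" by (intro Max_in) blast+
      then obtain x where x: "x < n" "?deg f x = Max (?deg f ` {..<n})" by auto
      have mx: "?deg f u \<le> ?deg f x" if "u < n" for u using x that by simp
      \<comment> \<open>\<open>x\<close> has maximum degree, at least \<open>d0\<close>; without a
        gap some \<open>u\<close> is within \<open>g\<close> of it, so both degrees are at least
        \<open>a\<close>.\<close>
      obtain u where u: "u < n" "u \<noteq> x" "\<not> ?deg f u + g < ?deg f x" using nog x(1) by blast
      have "d0 \<le> ?deg f x" using mx[OF v(1)] v(2) by linarith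
      hence "f \<in> ?C u x" using u(3) mx[OF u(1)] by (auto simp: a_def)
      thus ?thesis using u x by blast
    qed simp
  qed
  have "Pr ?D {f. \<not> has_gap n g f}
      \<le> Pr ?D (?Z \<union> (\<Union>(u, v)\<in>?I. ?C u v))"
    using sub by (intro measure_pmf.finite_measure_mono) auto
  also have "\<dots> \<le> Pr ?D ?Z + Pr ?D (\<Union>(u, v)\<in>?I. ?C u v)"
    by (intro measure_Un_le) auto
  also have "Pr ?D (\<Union>(u, v)\<in>?I. ?C u v) \<le> (\<Sum>(u, v)\<in>?I. Pr ?D (?C u v))"
    using measure_pmf.finite_measure_subadditive_finite[OF I(1), of "\<lambda>(u, v). ?C u v" ?D]
    by (simp add: case_prod_unfold)
  also have "\<dots> \<le> (\<Sum>(u, v)\<in>?I. ?\<tau> (a - 1) * (real (2 * g + 1) * B))"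
    by (intro sum_mono) (use prob_degrees_close[OF _ _ _ p B] in auto)
  also have "\<dots> = real (card ?I) * (?\<tau> (a - 1) * (real (2 * g + 1) * B))" by (simp add: case_prod_unfold)
  also have "\<dots> \<le> real (n * n) * ((4 * \<omega> / real n) * (real (2 * g + 1) * B))"
  proof (intro mult_mono \<tau>a mult_nonneg_nonneg)
    show "real (card ?I) \<le> real (n * n)" using I(2) by (simp only: of_nat_le_iff)
  qed (use binom_tail_nonneg \<omega> B0 in auto)
  also have "\<dots> = 16 * \<omega>\<^sup>2 * real (2 * g + 1) * \<delta>"
    using n0 by (simp add: B_def power2_eq_square)
  also have "Pr ?D ?Z \<le> 1 / \<omega> + 4 * \<delta>"
  proof -
    have pos: "0 < ?\<tau> d0" using d0 \<omega> n0 by (smt (verit) mult_nonneg_nonpos)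
    have "Pr ?D ?Z \<le> 1 / (real n * ?\<tau> d0) + ((?\<tau> (d0 - 1) / ?\<tau> d0)\<^sup>2 - 1)"
      by (rule prob_no_large_degree[OF n p pos])
    also have "1 / (real n * ?\<tau> d0) \<le> 1 / \<omega>" using d0 \<omega> by (intro divide_left_mono) auto
    also have "(?\<tau> (d0 - 1) / ?\<tau> d0)\<^sup>2 \<le> (1 / (1 - \<delta>))\<^sup>2"
    proof (rule power_mono)
      have "?\<tau> (d0 - 1) * (1 - \<delta>) \<le> ?\<tau> d0" using step d0D by simp
      thus "?\<tau> (d0 - 1) / ?\<tau> d0 \<le> 1 / (1 - \<delta>)" using pos \<delta>4 by (simp add: field_simps)
      show "0 \<le> ?\<tau> (d0 - 1) / ?\<tau> d0" using binom_tail_nonneg by simp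
    qed
    also have "(1 / (1 - \<delta>))\<^sup>2 - 1 \<le> 4 * \<delta>"
    proof -
      have "1 / (1 - \<delta>) \<le> 1 + (4/3) * \<delta>"
      proof -
        have "\<delta> * \<delta> \<le> (1/4) * \<delta>" using \<delta> \<delta>4 by (intro mult_right_mono) auto
        hence "1 \<le> (1 + (4/3) * \<delta>) * (1 - \<delta>)" by (simp add: algebra_simps)
        thus ?thesis using \<delta>4 by (subst pos_divide_le_eq) auto
      qed
      hence "(1 / (1 - \<delta>))\<^sup>2 \<le> (1 + (4/3) * \<delta>)\<^sup>2" using \<delta>4 by (intro power_mono) auto
      also have "\<dots> = 1 + (8/3) * \<delta> + (16/9) * (\<delta> * \<delta>)" by (simp add: power2_eq_square algebra_simps)
      also have "\<delta> * \<delta> \<le> (1/4) * \<delta>" using \<delta> \<delta>4 by (intro mult_right_mono) auto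
      finally show ?thesis using \<delta> by simp
    qed
    finally show ?thesis by simp
  qed
  finally show ?thesis by simp
qed

section \<open>Local estimates for binomial tails\<close>

lemma binomial_pmf_ratio:
  assumes p: "0 \<le> p" "p \<le> 1" and d: "d \<le> N"
  shows "pmf (binomial_pmf N p) (Suc d) * (real (Suc d) * (1 - p)) = pmf (binomial_pmf N p) d * ((real N - real d) * p)"
proof (cases "d = N")
  case True
  thus ?thesis using p by (simp add: binomial_eq_0)
next
  case False
  hence dN: "d < N" using d by simp
  have "Suc d * (N choose Suc d) = (N choose d) * (N - d)"
    using binomial_absorption[of d N] binomial_absorb_comp[of N d] by (simp only: mult.commute)
  hence "real (Suc d) * real (N choose Suc d) = real (N choose d) * real (N - d)" by (metis of_nat_mult)
  hence 1: "real (Suc d) * real (N choose Suc d) = real (N choose d) * (real N - real d)" using d by simp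
  have 2: "(1 - p) ^ (N - d) = (1 - p) ^ (N - Suc d) * (1 - p)"
    using dN by (metis Suc_diff_Suc power_Suc2)
  have "pmf (binomial_pmf N p) (Suc d) * (real (Suc d) * (1 - p)) =
      (real (Suc d) * real (N choose Suc d)) * p ^ d * p * ((1 - p) ^ (N - Suc d) * (1 - p))"
    using p by simp
  also have "\<dots> = pmf (binomial_pmf N p) d * ((real N - real d) * p)"
    unfolding 1 using p 2 by simp
  finally show ?thesis .
qed

text \<open>The ratio of successive point probabilities is (N - d)p / ((d + 1)(1 - p)). Up to
  \<open>y\<close> above the mean it falls short of 1 by at most (y + 1) over the variance.\<close>

lemma binomial_pmf_step:
  assumes p: "0 < p" "p < 1" and N: "0 < N" and d: "real d + 1 \<le> real N * p + y"
    and \<eta>: "\<eta> = (y + 1) / (real N * p * (1 - p))" and y: "0 \<le> y" and \<eta>1: "\<eta> \<le> 1"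
  shows "(1 - \<eta>) * pmf (binomial_pmf N p) d \<le> pmf (binomial_pmf N p) (Suc d)"
proof (cases "d \<le> N")
  case False
  thus ?thesis using p by (simp add: binomial_eq_0)
next
  case True
  let ?v = "real N * p * (1 - p)"
  have v: "0 < ?v" using p N by simp
  have "?v \<noteq> 0" using v by linarith
  hence ev: "\<eta> * ?v = y + 1" unfolding \<eta> by (rule nonzero_eq_divide_eq[THEN iffD1]) (rule refl)
  have \<eta>0: "0 \<le> \<eta>" using \<eta> y v by simp
  have "(1 - \<eta>) * (real (Suc d) * (1 - p)) \<le> (1 - \<eta>) * ((real N * p + y) * (1 - p))"
    using d p \<eta>1 by (intro mult_left_mono mult_right_mono) auto
  also have "\<dots> = ?v + y * (1 - p) - \<eta> * ?v - \<eta> * (y * (1 - p))" by (simp add: algebra_simps)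
  also have "\<dots> \<le> ?v + y * (1 - p) - \<eta> * ?v" using \<eta>0 y p by simp
  also have "\<dots> = ?v - y * p - 1" unfolding ev by (simp add: algebra_simps)
  also have "\<dots> \<le> (real N - real d) * p"
  proof -
    have "real d * p \<le> (real N * p + y - 1) * p" using d p by (intro mult_right_mono) auto
    thus ?thesis using p by (simp add: algebra_simps)
  qed
  finally have 1: "(1 - \<eta>) * (real (Suc d) * (1 - p)) \<le> (real N - real d) * p" .
  have "(1 - \<eta>) * pmf (binomial_pmf N p) d * (real (Suc d) * (1 - p))
      = pmf (binomial_pmf N p) d * ((1 - \<eta>) * (real (Suc d) * (1 - p)))" by simp
  also have "\<dots> \<le> pmf (binomial_pmf N p) d * ((real N - real d) * p)" using 1 by (intro mult_left_mono) auto
  also have "\<dots> = pmf (binomial_pmf N p) (Suc d) * (real (Suc d) * (1 - p))"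
    using binomial_pmf_ratio[of p d N] p True by simp
  finally show ?thesis using p by (subst (asm) mult_le_cancel_right_pos) auto
qed

text \<open>Each of the \<open>M\<close> point probabilities from \<open>d\<close> on is at least
  half of the first, and the tail contains them all.\<close>

lemma pmf_le_binom_tail:
  assumes p: "0 < p" "p < 1" and N: "0 < N" and d: "real d + real M \<le> real N * p + y"
    and \<eta>: "\<eta> = (y + 1) / (real N * p * (1 - p))" and y: "0 \<le> y" and M: "0 < M" "real M * \<eta> \<le> 1/2"
  shows "pmf (binomial_pmf N p) d \<le> 2 / real M * binom_tail N p d"
proof -
  let ?b = "pmf (binomial_pmf N p)"
  have \<eta>0: "0 \<le> \<eta>" using \<eta> y p N by simp
  have "1 * \<eta> \<le> real M * \<eta>" using M \<eta>0 by (intro mult_right_mono) auto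
  hence \<eta>1: "\<eta> \<le> 1" using M by linarith
  have low: "(1 - \<eta>) ^ i * ?b d \<le> ?b (d + i)" if "i < M" for i
    using that
  proof (induction i)
    case (Suc i)
    have "(1 - \<eta>) * ((1 - \<eta>) ^ i * ?b d) \<le> (1 - \<eta>) * ?b (d + i)"
      using Suc \<eta>1 by (intro mult_left_mono) auto
    also have "\<dots> \<le> ?b (Suc (d + i))"
      using Suc.prems d by (intro binomial_pmf_step[OF p N _ \<eta> y \<eta>1]) simp
    finally show ?case by (simp add: mult.assoc)
  qed simp
  have half: "?b d / 2 \<le> ?b (d + i)" if i: "i < M" for i
  proof -
    have "real i * \<eta> \<le> real M * \<eta>" using i \<eta>0 by (intro mult_right_mono) auto
    hence "1/2 \<le> 1 + real i * (- \<eta>)" using M by simp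
    also have "\<dots> \<le> (1 + (- \<eta>)) ^ i" by (rule Bernoulli_inequality) (use \<eta>1 in auto)
    finally have "(1/2) * ?b d \<le> (1 - \<eta>) ^ i * ?b d" by (intro mult_right_mono) auto
    thus ?thesis using low[OF i] by simp
  qed
  have "real M * (?b d / 2) = (\<Sum>i<M. ?b d / 2)" by simp
  also have "\<dots> \<le> (\<Sum>i<M. ?b (d + i))" using half by (intro sum_mono) auto
  also have "\<dots> = (\<Sum>j\<in>(\<lambda>i. d + i) ` {..<M}. ?b j)" by (subst sum.reindex) (auto simp: inj_on_def)
  also have "\<dots> = Pr (binomial_pmf N p) ((\<lambda>i. d + i) ` {..<M})"
    by (simp add: measure_measure_pmf_finite)
  also have "\<dots> \<le> binom_tail N p d"
    unfolding binom_tail_def by (rule measure_pmf.finite_measure_mono) auto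
  finally show ?thesis using M by (simp add: field_simps)
qed

text \<open>\<open>R\<close> is the scale of the gap; L = R ln n = (m ln n)^(1/2) is the scale of
  deviations from the mean m that matter. At D = m + 3L the upper tail bound with l = 1/R gives
  n^(-2). Up to there successive ratios are at least 1 - \<eta> with \<eta> <= 6/(\<theta>R), which
  allows M of order \<theta>R and \<delta> = 2/M.\<close>

lemma prob_no_gap_bound:
  assumes \<theta>: "0 < \<theta>" "\<theta> \<le> 1" and n: "4 \<le> n" and p: "0 < p" "p \<le> 1 - \<theta>" "p < 1"
    and R: "R = sqrt (real (n - 2) * p / ln (real n))" and ln: "1 \<le> ln (real n)"
    and R1: "24 \<le> \<theta> * R" and g: "192 * real (2 * g + 1) \<le> \<theta> * R" and \<omega>: "1 \<le> \<omega>" "\<omega> \<le> real n"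
  shows "Pr (bits (all_edges n) p)
      {f. \<not> has_gap n g f}
    \<le> 1 / \<omega> + 960 * \<omega>\<^sup>2 * real (2 * g + 1) / (\<theta> * R)"
proof -
  let ?N = "n - 2"
  define a where "a = ln (real n)"
  define m where "m = real ?N * p"
  define L where "L = R * a"
  have a1: "1 \<le> a" using ln by (simp add: a_def)
  have N: "0 < ?N" using n by simp
  have m0: "0 < m" using N p by (simp add: m_def)
  have "0 < \<theta> * R" using R1 by linarith
  hence R0: "0 < R" using \<theta> by (simp add: zero_less_mult_iff)
  have "\<theta> * R \<le> 1 * R" using \<theta> R0 by (intro mult_right_mono) auto
  hence R24: "24 \<le> R" using R1 by linarith
  have "0 \<le> m / a" using m0 a1 by simp
  hence "R * R = m / a"
    unfolding R m_def[symmetric] a_def[symmetric] by (simp only: real_sqrt_mult_self abs_of_nonneg)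
  hence RR: "R * R * a = m" using a1 by simp
  have RL: "R \<le> L" using a1 R0 by (simp add: L_def)
  have "m \<le> real n" using p n mult_mono[of "real ?N" "real n" p 1] by (simp add: m_def)
  have "R * 1 \<le> R * (R * a)" using R24 a1 R0 mult_mono[of 1 R 1 a] by (intro mult_left_mono) auto
  hence Rn: "R \<le> real n" using RR \<open>m \<le> real n\<close> by (simp add: mult.assoc)
  define M where "M = nat \<lfloor>\<theta> / 12 * R\<rfloor>"
  have Mle: "real M \<le> \<theta> / 12 * R" unfolding M_def using R0 \<theta> by (intro of_nat_floor) simp
  have "\<theta> / 12 * R - 1 \<le> real M" unfolding M_def using R0 \<theta> by linarith
  hence Mge: "\<theta> * R / 24 \<le> real M" using R1 by (simp add: field_simps)
  hence M0: "0 < M" using R1 by (auto intro!: Nat.gr0I)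
  have MR: "real M \<le> R"
  proof -
    have "\<theta> / 12 * R \<le> 1 * R" using \<theta> R0 by (intro mult_right_mono) auto
    thus ?thesis using Mle by linarith
  qed
  define D where "D = nat \<lceil>m + 3 * L\<rceil>"
  have L0: "0 < L" using R0 a1 by (simp add: L_def)
  have Dge: "m + 3 * L \<le> real D" unfolding D_def by (rule real_nat_ceiling_ge)
  have Dle: "real D \<le> m + 3 * L + 1" unfolding D_def using m0 L0 by linarith
  \<comment> \<open>The distance 5L covers \<open>D\<close> and \<open>M\<close> further points, as
    \<open>M\<close> and 1 are at most \<open>L\<close>.\<close>
  define \<eta> where "\<eta> = (5 * L + 1) / (real ?N * p * (1 - p))"
  have "\<eta> \<le> 6 * L / (m * \<theta>)"
    unfolding \<eta>_def m_def[symmetric] using p \<theta> m0 RL R24 by (intro frac_le mult_left_mono) auto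
  also have "\<dots> = 6 / (\<theta> * R)"
  proof -
    have "L * (\<theta> * R) = m * \<theta>" using RR by (simp add: L_def mult.commute mult.left_commute)
    thus ?thesis using m0 \<theta> R0 by (simp add: field_simps)
  qed
  finally have \<eta>: "\<eta> \<le> 6 / (\<theta> * R)" .
  have "real M * \<eta> \<le> (\<theta> / 12 * R) * (6 / (\<theta> * R))"
    using Mle \<eta> p m0 L0 R0 \<theta> by (intro mult_mono) (auto simp: \<eta>_def)
  also have "\<dots> = 1/2" using \<theta> R0 by simp
  finally have M\<eta>: "real M * \<eta> \<le> 1/2" .
  have \<beta>: "pmf (binomial_pmf ?N p) d \<le> 2 / real M * binom_tail ?N p d" if "d \<le> D" for d
  proof (rule pmf_le_binom_tail[OF p(1,3) N _ \<eta>_def _ M0 M\<eta>])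
    have "real d \<le> real D" using that by simp
    thus "real d + real M \<le> real ?N * p + 5 * L"
      using Dle MR RL R24 unfolding m_def[symmetric] by linarith
  qed (use L0 in simp)
  have tail: "binom_tail ?N p D \<le> 1 / (real n)\<^sup>2"
  proof -
    have "binom_tail ?N p D \<le> exp (real ?N * p * (1 / R + (1 / R)\<^sup>2) - 1 / R * real D)"
      unfolding binom_tail_def using p R24 by (intro binomial_upper_tail) auto
    also have "\<dots> \<le> exp (- (2 * a))"
    proof -
      have "1 / R * (m + 3 * L) \<le> 1 / R * real D" using Dge R0 by (intro mult_left_mono) auto
      moreover have "m * (1 / R)\<^sup>2 = a" using RR R0 by (simp add: power2_eq_square field_simps)
      moreover have "1 / R * (m + 3 * L) = m * (1 / R) + 3 * a" using R0 by (simp add: L_def field_simps)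
      ultimately have "m * (1 / R + (1 / R)\<^sup>2) - 1 / R * real D \<le> - (2 * a)"
        unfolding distrib_left by linarith
      thus ?thesis unfolding m_def[symmetric] by simp
    qed
    also have "\<dots> = 1 / (real n)\<^sup>2"
    proof -
      have "exp (2 * a) = real n * real n" using n by (simp only: a_def mult_2 exp_add) simp
      thus ?thesis by (simp only: exp_minus power2_eq_square inverse_eq_divide)
    qed
    finally show ?thesis .
  qed
  define \<delta> where "\<delta> = 2 / real M"
  have \<delta>le: "\<delta> \<le> 48 / (\<theta> * R)"
    using Mge M0 \<theta> R0 by (simp add: \<delta>_def field_simps)
  have \<delta>0: "0 < \<delta>" using M0 by (simp add: \<delta>_def)
  have "real (g + 1) * \<delta> \<le> real (2 * g + 1) * (48 / (\<theta> * R))"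
    using \<delta>le \<delta>0 by (intro mult_mono) auto
  also have "\<dots> \<le> 1/4" using g \<theta> R0 by (simp add: field_simps)
  finally have g\<delta>: "real (g + 1) * \<delta> \<le> 1/4" .
  have n\<delta>: "1 / real n \<le> \<delta>"
  proof -
    have "real M \<le> 2 * real n" using MR Rn by linarith
    thus ?thesis using M0 n by (simp add: \<delta>_def field_simps)
  qed
  have "Pr (bits (all_edges n) p)
      {f. \<not> has_gap n g f}
    \<le> 1 / \<omega> + 4 * \<delta> + 16 * \<omega>\<^sup>2 * real (2 * g + 1) * \<delta>"
    using n p \<beta> tail \<omega> \<delta>0 g\<delta> n\<delta> by (intro prob_no_gap[of n p \<delta> g D]) (auto simp: \<delta>_def)
  \<comment> \<open>4\<delta> is absorbed into the last term, since \<omega>^2 (2g + 1) >= 1; then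
    960 = 20 * 48.\<close>
  also have "\<dots> \<le> 1 / \<omega> + 20 * \<omega>\<^sup>2 * real (2 * g + 1) * \<delta>"
  proof -
    have "1 * 1 \<le> \<omega>\<^sup>2 * real (2 * g + 1)" using \<omega> by (intro mult_mono one_le_power) auto
    hence "1 * 1 * \<delta> \<le> \<omega>\<^sup>2 * real (2 * g + 1) * \<delta>" using \<delta>0 by (intro mult_right_mono) auto
    moreover have "16 * \<omega>\<^sup>2 * real (2 * g + 1) * \<delta> = 16 * (\<omega>\<^sup>2 * real (2 * g + 1) * \<delta>)"
      "20 * \<omega>\<^sup>2 * real (2 * g + 1) * \<delta> = 20 * (\<omega>\<^sup>2 * real (2 * g + 1) * \<delta>)" by (simp_all only: mult.assoc)
    ultimately show ?thesis by linarith
  qed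
  also have "\<dots> \<le> 1 / \<omega> + 20 * \<omega>\<^sup>2 * real (2 * g + 1) * (48 / (\<theta> * R))"
    using \<delta>le by (intro add_left_mono mult_left_mono) auto
  finally show ?thesis by simp
qed

section \<open>Parameters\<close>

abbreviation maxdeg :: "nat \<Rightarrow> (nat set \<Rightarrow> bool) \<Rightarrow> nat" where
  "maxdeg n f \<equiv> max_degree (bits_graph n f)"

lemma degree_le_max_degree: "v < n \<Longrightarrow> degree (bits_graph n f) v \<le> maxdeg n f"
  unfolding max_degree_def by (rule Max_ge) auto

lemma real_nat_ceiling_le: "0 \<le> x \<Longrightarrow> real (nat \<lceil>x\<rceil>) \<le> x + 1"
  by linarith

lemma exp_ratio_le: "0 < \<theta> \<Longrightarrow> p \<le> 1 - \<theta> \<Longrightarrow> 0 < p \<Longrightarrow> exp (- (p / \<theta>)) \<le> 1 - (p :: real)"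
proof -
  assume h: "0 < \<theta>" "p \<le> 1 - \<theta>" "0 < p"
  have p1: "0 < 1 - p" using h by linarith
  have "1 / (1 - p) = 1 + p / (1 - p)" using p1 by (simp add: field_simps)
  also have "\<dots> \<le> exp (p / (1 - p))" by (rule exp_ge_add_one_self)
  also have "\<dots> \<le> exp (p / \<theta>)" using h p1 by (simp add: frac_le)
  finally have "1 / exp (p / \<theta>) \<le> 1 / (1 / (1 - p))" using p1 by (intro divide_left_mono) auto
  thus ?thesis by (simp add: exp_minus inverse_eq_divide)
qed

text \<open>The parameters of \<^const>\<open>spread\<close> for the random graph: with \<open>c\<^sub>0 = exp (-3/\<theta>)\<close> a set of at most
  \<open>r = \<lfloor>3/p\<rfloor>\<close> vertices misses a given vertex with probability at least \<open>(1-p)\<^sup>r \<ge> c\<^sub>0\<close>.\<close>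

definition par_c :: "real \<Rightarrow> real" where
  "par_c \<theta> = exp (- (3 / \<theta>))"

definition par_r :: "real \<Rightarrow> nat" where
  "par_r p = nat \<lfloor>3 / p\<rfloor>"

text \<open>16 is the constant required by the union bound in
  \<open>prob_not_spread\<close>.\<close>

definition par_t :: "real \<Rightarrow> nat \<Rightarrow> nat" where
  "par_t \<theta> n = nat \<lceil>16 * ln (real (n + 1)) / par_c \<theta>\<rceil>"

text \<open>The 4 reflects the fraction \<open>par_c \<theta> / 4\<close>: the choice is rt + 1 <=
  (c/4) s, which also implies the condition on \<open>s\<close> in
  \<open>prob_not_spread\<close>.\<close>

definition par_s :: "real \<Rightarrow> nat \<Rightarrow> real \<Rightarrow> nat" where
  "par_s \<theta> n p = nat \<lceil>4 * real (par_r p * par_t \<theta> n + 1) / par_c \<theta>\<rceil>"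

abbreviation random_spread :: "real \<Rightarrow> nat \<Rightarrow> real \<Rightarrow> (nat set \<Rightarrow> bool) \<Rightarrow> bool" where
  "random_spread \<theta> n p f \<equiv>
     spread (gadj (bits_graph n f)) {..<n} (par_r p) (par_s \<theta> n p) (par_t \<theta> n) (par_c \<theta> / 4)"

text \<open>k >= np/2 calls for r >= 2/p; starting from 3/p survives the rounding down, since 1/p >=
  1.\<close>

lemma par_facts:
  assumes \<theta>: "0 < \<theta>" and p: "0 < p" "p \<le> 1 - \<theta>" and n: "3 \<le> n" and ln: "1 \<le> ln (real n)"
  defines "c \<equiv> par_c \<theta>" and "r \<equiv> par_r p" and "t \<equiv> par_t \<theta> n" and "s \<equiv> par_s \<theta> n p"
  shows "0 < c" "c \<le> 1" "c \<le> (1 - p) ^ r" "0 < r" "0 < t" "0 < s" "2 / p \<le> real r"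
    "16 * ln (real (n + 1)) \<le> c * real t" "16 * real r * ln (real (n + 1)) \<le> c * real s"
    "real (r * t + 1) \<le> c / 4 * real s" "real s \<le> 401 / c\<^sup>2 * (ln (real n) / p)"
proof -
  have p1: "p < 1" using \<theta> p by linarith
  show c0: "0 < c" and c1: "c \<le> 1" using \<theta> by (auto simp: c_def par_c_def)
  have r: "real r \<le> 3 / p" unfolding r_def par_r_def using p by (intro of_nat_floor) simp
  have "3 / p - 1 \<le> real r" unfolding r_def par_r_def using p by linarith
  moreover have "1 \<le> 1 / p" using p p1 by simp
  hence "2 / p \<le> 3 / p - 1" by (simp add: field_simps)
  ultimately show r2: "2 / p \<le> real r" by linarith
  have "0 < 2 / p" using p by simp
  hence "0 < real r" using r2 by linarith
  thus r0: "0 < r" by simp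
  show "c \<le> (1 - p) ^ r"
  proof -
    have "real r * (p / \<theta>) \<le> (3 / p) * (p / \<theta>)" using r p \<theta> by (intro mult_right_mono) auto
    hence "real r * (p / \<theta>) \<le> 3 / \<theta>" using p by simp
    hence "c \<le> exp (real r * (- (p / \<theta>)))" by (simp add: c_def par_c_def)
    also have "\<dots> = exp (- (p / \<theta>)) ^ r" by (rule exp_of_nat_mult)
    also have "\<dots> \<le> (1 - p) ^ r" using exp_ratio_le[OF \<theta> p(2,1)] by (intro power_mono) auto
    finally show ?thesis .
  qed
  have lnN: "ln (real (n + 1)) \<le> 2 * ln (real n)"
  proof -
    have "n + 1 \<le> n * n" using n mult_le_mono1[of 3 n n] by linarith
    hence "real (n + 1) \<le> real (n * n)" by (simp only: of_nat_le_iff)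
    hence "ln (real (n + 1)) \<le> ln (real n * real n)" using n by (subst ln_le_cancel_iff) auto
    thus ?thesis using n by (simp add: ln_mult)
  qed
  have lnN1: "1 \<le> ln (real (n + 1))"
  proof -
    have "ln (real n) \<le> ln (real (n + 1))" using n by (subst ln_le_cancel_iff) auto
    thus ?thesis using ln by linarith
  qed
  have tge: "16 * ln (real (n + 1)) / c \<le> real t"
    unfolding t_def par_t_def c_def by (rule real_nat_ceiling_ge)
  thus t: "16 * ln (real (n + 1)) \<le> c * real t" using c0 by (simp add: field_simps)
  have "0 < 16 * ln (real (n + 1)) / c" using lnN1 c0 by (intro divide_pos_pos) linarith+
  thus t0: "0 < t" using tge by linarith
  have sge: "4 * real (r * t + 1) / c \<le> real s"
    unfolding s_def par_s_def r_def t_def c_def by (rule real_nat_ceiling_ge)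
  thus cs: "real (r * t + 1) \<le> c / 4 * real s" using c0 by (simp add: field_simps)
  have "0 < r * t + 1" by simp
  hence "0 < real (r * t + 1)" by (simp only: of_nat_0_less_iff)
  hence s0: "0 < 4 * real (r * t + 1) / c" using c0 by (intro divide_pos_pos mult_pos_pos) (assumption | simp)+
  thus "0 < s" using sge by linarith
  have "real r * (16 * ln (real (n + 1))) \<le> real r * (c * real t)" using t by (intro mult_left_mono) auto
  also have "\<dots> = c * real (r * t)" by simp
  also have "\<dots> \<le> 1 * real (r * t)" using c1 by (intro mult_right_mono) auto
  also have "\<dots> \<le> real (r * t + 1)" by simp
  also have "\<dots> \<le> c / 4 * real s" by (rule cs)
  also have "\<dots> \<le> c * real s" using c0 by simp
  finally show "16 * real r * ln (real (n + 1)) \<le> c * real s" by (simp only: mult.assoc mult.left_commute)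
  define l where "l = ln (real n)"
  have l1: "1 \<le> l" using ln by (simp add: l_def)
  have ic: "1 \<le> 1 / c" using c0 c1 by simp
  have "real t \<le> 16 * ln (real (n + 1)) / c + 1"
    unfolding t_def par_t_def c_def[symmetric] using lnN1 c0
    by (intro real_nat_ceiling_le divide_nonneg_pos) auto
  also have "\<dots> \<le> 32 * l / c + l / c"
  proof (intro add_mono divide_right_mono)
    have "1 * 1 \<le> l * (1 / c)" using l1 ic by (intro mult_mono) auto
    thus "1 \<le> l / c" by simp
  qed (use lnN c0 in \<open>auto simp: l_def\<close>)
  finally have tle: "real t \<le> 33 * l / c" by (simp add: add_divide_distrib[symmetric])
  \<comment> \<open>As \<open>Q\<close> is at least 1, additive ones are absorbed by raising
    constants: 99 to 100, 400 to 401.\<close>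
  define Q where "Q = l / (p * c)"
  have big: "1 \<le> Q"
  proof -
    have "p * c \<le> 1 * 1" using p p1 c0 c1 by (intro mult_mono) auto
    thus ?thesis using l1 p c0 by (simp add: le_divide_eq Q_def)
  qed
  have "real (r * t) \<le> (3 / p) * (33 * l / c)" unfolding of_nat_mult
    using r tle p by (intro mult_mono) auto
  hence "real (r * t + 1) \<le> 99 * Q + 1" using p by (simp add: Q_def)
  hence rt: "real (r * t + 1) \<le> 100 * Q"
    by (rule order_trans) (use big in linarith)
  have "1 * 1 \<le> Q * (1 / c)" using big ic by (intro mult_mono) auto
  hence Qc: "1 \<le> Q / c" by simp
  have "real s \<le> 4 * real (r * t + 1) / c + 1"
    unfolding s_def par_s_def r_def[symmetric] t_def[symmetric] c_def[symmetric]
    using s0 by (intro real_nat_ceiling_le less_imp_le)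
  also have "\<dots> \<le> 4 * (100 * Q) / c + 1"
    using rt c0 by (intro add_right_mono divide_right_mono mult_left_mono) auto
  also have "\<dots> = 400 * (Q / c) + 1" by simp
  also have "\<dots> \<le> 401 * (Q / c)" using Qc by linarith
  also have "\<dots> = 401 / c\<^sup>2 * (l / p)" by (simp add: Q_def power2_eq_square)
  finally show "real s \<le> 401 / c\<^sup>2 * (ln (real n) / p)" by (simp only: l_def)
qed

text \<open>400000 exceeds 24 * 401 * 32: 24 from \<open>strongly_colorable_if_spread\<close>, 401
  from the bound on \<open>par_s\<close>, 16 from the square of \<open>par_c \<theta> / 4\<close>,
  and 2 from k >= np/2.\<close>

lemma strongly_colorable_bits_graph:
  assumes \<theta>: "0 < \<theta>" and p: "0 < p" "p \<le> 1 - \<theta>" and n: "3 \<le> n" and ln: "1 \<le> ln (real n)"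
    and X: "400000 / par_c \<theta> ^ 4 * ln (real n) \<le> real n * p\<^sup>2"
    and sp: "random_spread \<theta> n p f"
    and \<Delta>: "real n * p / 2 \<le> real (maxdeg n f)"
    and k: "maxdeg n f < k" and x: "x < n"
    and deg: "\<And>u. u < n \<Longrightarrow> u \<noteq> x \<Longrightarrow> degree (bits_graph n f) u + 8 * par_s \<theta> n p \<le> k"
  shows "strongly_colorable (bits_graph n f) k"
proof (rule strongly_colorable_if_spread[OF simple_bits_graph, where r = "par_r p" and s = "par_s \<theta> n p"
      and t = "par_t \<theta> n" and c = "par_c \<theta> / 4" and x = x])
  note F = par_facts[OF assms(1-5)]
  let ?c = "par_c \<theta>" and ?s = "par_s \<theta> n p"
  show "0 < k" using k by simp
  have np: "real n * p / 2 \<le> real k" using \<Delta> k by linarith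
  have "real n = (2 / p) * (real n * p / 2)" using p by simp
  also have "\<dots> \<le> real (par_r p) * real k" using F(7) np p by (intro mult_mono) auto
  finally have "real n \<le> real (par_r p * k)" by simp
  thus "card (verts (bits_graph n f)) \<le> par_r p * k" by (simp only: of_nat_le_iff verts_bits_graph card_lessThan)
  have "24 * real ?s \<le> 24 * (401 / ?c\<^sup>2 * (ln (real n) / p))" using F(11) by simp
  also have "\<dots> \<le> (?c / 4)\<^sup>2 * (real n * p / 2)"
  proof -
    have "400000 * ln (real n) \<le> (real n * p\<^sup>2) * ?c ^ 4"
      using X F(1) by (simp add: field_simps)
    hence "24 * 401 * 32 * ln (real n) \<le> (real n * p\<^sup>2) * ?c ^ 4" using ln by linarith
    also have "?c ^ 4 = ?c\<^sup>2 * ?c\<^sup>2" by (simp add: power2_eq_square power4_eq_xxxx)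
    finally have 1: "24 * 401 * 32 * ln (real n) \<le> (real n * p\<^sup>2) * (?c\<^sup>2 * ?c\<^sup>2)" .
    have "24 * (401 / ?c\<^sup>2 * (ln (real n) / p)) = (24 * 401 * 32 * ln (real n)) / (32 * ?c\<^sup>2 * p)"
      using F(1) p by (simp add: field_simps)
    also have "\<dots> \<le> ((real n * p\<^sup>2) * (?c\<^sup>2 * ?c\<^sup>2)) / (32 * ?c\<^sup>2 * p)"
      using 1 F(1) p by (intro divide_right_mono) auto
    also have "\<dots> = (?c / 4)\<^sup>2 * (real n * p / 2)"
      using F(1) p by (simp add: field_simps power2_eq_square)
    finally show ?thesis .
  qed
  also have "\<dots> \<le> (?c / 4)\<^sup>2 * real k" using np by (intro mult_left_mono) auto
  finally show "24 * real ?s \<le> (?c / 4)\<^sup>2 * real k" .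
  show "degree (bits_graph n f) x < k" using degree_le_max_degree[OF x, of f] k by linarith
qed (use par_facts[OF assms(1-5)] sp deg in auto)

text \<open>For the maximum degree, vertex 0 alone suffices: its lower tail exponent at np/2 is
  about -np/10, and \<open>X\<close> makes this at most -ln n.\<close>

lemma prob_not_spread_or_small_degree:
  assumes \<theta>: "0 < \<theta>" and p: "0 < p" "p \<le> 1 - \<theta>" and n: "3 \<le> n" and ln: "1 \<le> ln (real n)"
    and X: "100 * ln (real n) \<le> real n * p"
  shows "Pr (bits (all_edges n) p)
      {f. \<not> (random_spread \<theta> n p f
             \<and> real n * p / 2 \<le> real (maxdeg n f))} \<le> 2 / real n"
proof -
  let ?D = "bits (all_edges n) p"
  let ?S = "\<lambda>f. random_spread \<theta> n p f"
  note F = par_facts[OF assms(1-5)]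
  have p1: "p \<le> 1" using p \<theta> by linarith
  have "Pr ?D {f. \<not> (?S f \<and> real n * p / 2 \<le> real (maxdeg n f))}
      \<le> Pr ?D ({f. \<not> ?S f} \<union> {f. real (degree (bits_graph n f) 0) \<le> real n * p / 2})"
  proof (rule measure_pmf.finite_measure_mono)
    have "real (degree (bits_graph n f) 0) \<le> real (maxdeg n f)" for f
      using degree_le_max_degree[of 0 n f] n by simp
    hence "real (degree (bits_graph n f) 0) \<le> real n * p / 2"
      if "\<not> real n * p / 2 \<le> real (maxdeg n f)" for f
      using that order_trans[of _ "real (maxdeg n f)" "real n * p / 2"] by fastforce
    thus "{f. \<not> (?S f \<and> real n * p / 2 \<le> real (maxdeg n f))}
      \<subseteq> {f. \<not> ?S f} \<union> {f. real (degree (bits_graph n f) 0) \<le> real n * p / 2}" by blast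
  qed auto
  also have "\<dots> \<le> Pr ?D {f. \<not> ?S f} + Pr ?D {f. real (degree (bits_graph n f) 0) \<le> real n * p / 2}"
    by (intro measure_Un_le) auto
  also have "Pr ?D {f. \<not> ?S f} \<le> 1 / real (n + 1)"
    using F p p1 by (intro prob_not_spread) auto
  also have "1 / real (n + 1) \<le> 1 / real n" using n by (intro divide_left_mono) auto
  also have "Pr ?D {f. real (degree (bits_graph n f) 0) \<le> real n * p / 2} \<le> 1 / real n"
  proof -
    have "Pr ?D {f. real (degree (bits_graph n f) 0) \<le> real n * p / 2} =
        Pr (binomial_pmf (n - 1) p) {i. real i \<le> real n * p / 2}"
      using n p p1 by (intro prob_degree) auto
    also have "\<dots> \<le> exp (real n * p / 2 - 3/5 * (real (n - 1) * p))"
      by (rule binomial_lower_tail) (use p p1 in auto)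
    also have "real n * p / 2 - 3/5 * (real (n - 1) * p) \<le> - ln (real n)"
    proof -
      have "real (n - 1) * p = real n * p - p" using n by (simp add: of_nat_diff algebra_simps)
      thus ?thesis using X p1 ln by (simp add: algebra_simps)
    qed
    also have "exp (- ln (real n)) = 1 / real n" using n by (simp add: exp_minus inverse_eq_divide)
    finally show ?thesis by simp
  qed
  finally show ?thesis by simp
qed

lemma almost_surelyI:
  assumes "\<And>e. e > 0 \<Longrightarrow> \<forall>\<^sub>F n in sequentially. Pr (Gnp n (p n)) {G. \<not> Q G} \<le> e"
  shows "almost_surely p Q"
  unfolding almost_surely_def
proof (rule tendstoI)
  fix e :: real assume e: "0 < e"
  have "\<forall>\<^sub>F n in sequentially. Pr (Gnp n (p n)) {G. \<not> Q G} \<le> e / 2"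
    by (rule assms) (use e in simp)
  thus "\<forall>\<^sub>F n in sequentially. dist (Pr (Gnp n (p n)) {G. Q G}) 1 < e"
  proof eventually_elim
    case (elim n)
    have "{G. \<not> Q G} = UNIV - {G. Q G}" by auto
    hence "Pr (Gnp n (p n)) {G. \<not> Q G} = 1 - Pr (Gnp n (p n)) {G. Q G}"
      using measure_pmf.prob_compl[of "{G. Q G}" "Gnp n (p n)"] by simp
    moreover have "Pr (Gnp n (p n)) {G. Q G} \<le> 1" by (rule measure_pmf.prob_le_1)
    ultimately show ?case using elim e by (simp add: dist_real_def)
  qed
qed

lemma eventually_ln_ge: "\<forall>\<^sub>F n in sequentially. a \<le> ln (real n)"
  using filterlim_compose[OF ln_at_top filterlim_real_sequentially]
  by (auto simp: filterlim_at_top)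

text \<open>Raising to the power \<open>b\<close> removes the root. The constant \<open>X\<close> is
  arbitrary because the quotient tends to infinity; \<open>max 1 X\<close> is used since its
  \<open>b\<close>-th power dominates \<open>X\<close>.\<close>

lemma eventually_powr_ge:
  assumes h: "filterlim (\<lambda>n. p n / (ln (real n) ^ a / real n) powr (1 / real b)) at_top sequentially"
    and b: "0 < b"
  shows "\<forall>\<^sub>F n in sequentially. 0 < p n \<and> X * ln (real n) ^ a \<le> real n * p n ^ b"
proof -
  have "\<forall>\<^sub>F n in sequentially. max 1 X \<le> p n / (ln (real n) ^ a / real n) powr (1 / real b)"
    using h unfolding filterlim_at_top by blast
  thus ?thesis using eventually_ln_ge[of 1] eventually_gt_at_top[of 0]
  proof eventually_elim
    case (elim n)
    let ?y = "ln (real n) ^ a / real n"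
    have "0 < ln (real n)" using elim(2) by linarith
    hence y: "0 < ?y" using elim(3) by (intro divide_pos_pos zero_less_power) simp_all
    let ?q = "?y powr (1 / real b)"
    have "?y \<noteq> 0" using y by linarith
    hence q: "0 < ?q" by (simp only: powr_gt_zero) simp
    have "?q ^ b = ?q powr real b" using q by (rule powr_realpow[symmetric])
    also have "\<dots> = ?y powr (1 / real b * real b)" by (rule powr_powr)
    also have "\<dots> = ?y powr 1" using b by simp
    also have "\<dots> = ?y" using y by (intro powr_one less_imp_le)
    finally have q_pow: "?q ^ b = ?y" .
    have le: "max 1 X * ?q \<le> p n" using elim(1) q by (simp only: pos_le_divide_eq)
    have "0 < max 1 X * ?q" using q by (intro mult_pos_pos) auto
    hence p0: "0 < p n" using le by linarith
    have "X * ?y \<le> max 1 X ^ b * ?y"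
    proof (rule mult_right_mono)
      have "max 1 X ^ 1 \<le> max 1 X ^ b" using b by (intro power_increasing) auto
      thus "X \<le> max 1 X ^ b" by simp
    qed (use y in simp)
    also have "\<dots> = (max 1 X * ?q) ^ b" by (simp add: power_mult_distrib q_pow)
    also have "\<dots> \<le> p n ^ b" using le \<open>0 < max 1 X * ?q\<close> by (intro power_mono) auto
    finally have "real n * (X * ?y) \<le> real n * p n ^ b" by (intro mult_left_mono) auto
    moreover have "real n * (X * ?y) = X * ln (real n) ^ a" using elim by simp
    ultimately show ?case using p0 by simp
  qed
qed

section \<open>The strong chromatic number of the random graph\<close>

text \<open>With k = floor((1 + \<epsilon>)\<Delta>) every vertex has slack 8s, so any vertex can
  serve as \<open>x\<close>. The 10000 yields 5000 \<open>Q\<close> <= \<epsilon>\<Delta>, while 8s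
  + 1 <= 9s is at most 9 * 401 \<open>Q\<close>.\<close>

lemma strong_chromatic_number_approx:
  assumes \<theta>: "0 < \<theta>" and p: "0 < p" "p \<le> 1 - \<theta>" and n: "3 \<le> n" and ln: "1 \<le> ln (real n)"
    and X: "400000 / par_c \<theta> ^ 4 * ln (real n) \<le> real n * p\<^sup>2"
    and \<epsilon>: "0 < \<epsilon>" and Y: "10000 / (\<epsilon> * (par_c \<theta>)\<^sup>2) * ln (real n) \<le> real n * p\<^sup>2"
    and sp: "random_spread \<theta> n p f"
    and \<Delta>: "real n * p / 2 \<le> real (maxdeg n f)"
  shows "(1 - \<epsilon>) * real (maxdeg n f) \<le> real (strong_chromatic_number (bits_graph n f))"
    "real (strong_chromatic_number (bits_graph n f)) \<le> (1 + \<epsilon>) * real (maxdeg n f)"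
proof -
  note F = par_facts[OF assms(1-5)]
  define d where "d = maxdeg n f"
  define k where "k = nat \<lfloor>(1 + \<epsilon>) * real d\<rfloor>"
  let ?c = "par_c \<theta>" and ?s = "par_s \<theta> n p"
  have "10000 * ln (real n) \<le> \<epsilon> * ?c\<^sup>2 * (real n * p\<^sup>2)"
    using Y \<epsilon> F(1) by (simp add: field_simps)
  hence "10000 * ln (real n) / (2 * ?c\<^sup>2 * p) \<le> \<epsilon> * ?c\<^sup>2 * (real n * p\<^sup>2) / (2 * ?c\<^sup>2 * p)"
    using F(1) p by (intro divide_right_mono) auto
  also have "\<dots> = \<epsilon> * (real n * p / 2)" using F(1) p by (simp add: power2_eq_square)
  also have "\<dots> \<le> \<epsilon> * real d" using \<Delta> \<epsilon> unfolding d_def by (intro mult_left_mono) auto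
  finally have 1: "10000 * ln (real n) / (2 * ?c\<^sup>2 * p) \<le> \<epsilon> * real d" .
  define Q where "Q = 1 / ?c\<^sup>2 * (ln (real n) / p)"
  have "10000 * ln (real n) / (2 * ?c\<^sup>2 * p) = 5000 * Q" by (simp add: Q_def)
  moreover have "real ?s \<le> 401 * Q" using F(11) by (simp add: Q_def)
  moreover have "1 \<le> real ?s" using F(6) by linarith
  ultimately have 2: "8 * real ?s + 1 \<le> \<epsilon> * real d" using 1 by linarith
  have "(1 + \<epsilon>) * real d = real d + \<epsilon> * real d" by (simp add: algebra_simps)
  hence dk: "d + 8 * ?s \<le> k" using 2 unfolding k_def by linarith
  have kle: "real k \<le> (1 + \<epsilon>) * real d" unfolding k_def using \<epsilon> by (intro of_nat_floor) simp
  have dk': "d < k" using dk F(6) by linarith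
  have "strongly_colorable (bits_graph n f) k"
  proof (rule strongly_colorable_bits_graph[OF assms(1-6) sp \<Delta>, where x = 0])
    show "maxdeg n f < k" using dk' by (simp add: d_def)
    show "degree (bits_graph n f) u + 8 * ?s \<le> k" if "u < n" for u
      using degree_le_max_degree[OF that, of f] dk unfolding d_def by linarith
  qed (use n in auto)
  hence b: "d < strong_chromatic_number (bits_graph n f)" "strong_chromatic_number (bits_graph n f) \<le> k"
    using strong_chromatic_number_bounds[OF simple_bits_graph, of n f k] dk' n
    by (auto simp: d_def lessThan_empty_iff)
  show "real (strong_chromatic_number (bits_graph n f)) \<le> (1 + \<epsilon>) * real (maxdeg n f)"
    using b(2) kle unfolding d_def by linarith
  have "(1 - \<epsilon>) * real d \<le> 1 * real d" using \<epsilon> by (intro mult_right_mono) auto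
  thus "(1 - \<epsilon>) * real (maxdeg n f) \<le> real (strong_chromatic_number (bits_graph n f))"
    using b(1) unfolding d_def by linarith
qed

lemma strong_chromatic_number_exact:
  assumes \<theta>: "0 < \<theta>" and p: "0 < p" "p \<le> 1 - \<theta>" and n: "3 \<le> n" and ln: "1 \<le> ln (real n)"
    and X: "400000 / par_c \<theta> ^ 4 * ln (real n) \<le> real n * p\<^sup>2"
    and sp: "random_spread \<theta> n p f"
    and \<Delta>: "real n * p / 2 \<le> real (maxdeg n f)"
    and gap: "has_gap n (8 * par_s \<theta> n p) f"
  shows "strong_chromatic_number (bits_graph n f) = maxdeg n f + 1"
proof -
  let ?d = "maxdeg n f"
  obtain x where x: "x < n" "\<And>u. u < n \<Longrightarrow> u \<noteq> x \<Longrightarrow> degree (bits_graph n f) u + 8 * par_s \<theta> n p < degree (bits_graph n f) x"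
    using gap by blast
  have "strongly_colorable (bits_graph n f) (?d + 1)"
  proof (rule strongly_colorable_bits_graph[OF assms(1-6) sp \<Delta> _ x(1)])
    show "degree (bits_graph n f) u + 8 * par_s \<theta> n p \<le> ?d + 1" if "u < n" "u \<noteq> x" for u
      using x(2)[OF that] degree_le_max_degree[OF x(1), of f] by linarith
  qed auto
  hence "?d < strong_chromatic_number (bits_graph n f)" "strong_chromatic_number (bits_graph n f) \<le> ?d + 1"
    using strong_chromatic_number_bounds[OF simple_bits_graph, of n f "?d + 1"] n
    by (auto simp: lessThan_empty_iff)
  thus ?thesis by linarith
qed

theorem theorem1p1:
  fixes \<theta> :: real and p :: "nat \<Rightarrow> real"
  assumes "\<theta> > 0"
    and "\<And>n. 0 \<le> p n"
    and "\<And>n. p n < 1 - \<theta>"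
  shows "(filterlim (\<lambda>n. p n / ((ln (real n)) ^ 4 / real n) powr (1/3)) at_top sequentially
            \<longrightarrow> almost_surely p (\<lambda>G. strong_chromatic_number G = max_degree G + 1))
       \<and> (filterlim (\<lambda>n. p n / (ln (real n) / real n) powr (1/2)) at_top sequentially
            \<longrightarrow> (\<forall>\<epsilon>>0. almost_surely p
                  (\<lambda>G. (1 - \<epsilon>) * real (max_degree G) \<le> real (strong_chromatic_number G)
                     \<and> real (strong_chromatic_number G) \<le> (1 + \<epsilon>) * real (max_degree G))))"
proof (intro conjI impI allI)
  note \<theta> = assms(1)
  have p1: "p n \<le> 1 - \<theta>" "p n \<le> 1" for n using assms(3)[of n] \<theta> by linarith+
  have \<theta>1: "\<theta> \<le> 1" using assms(2)[of 0] assms(3)[of 0] by linarith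
  have c: "0 < par_c \<theta>" by (simp add: par_c_def)
  {
    assume h: "filterlim (\<lambda>n. p n / ((ln (real n)) ^ 4 / real n) powr (1/3)) at_top sequentially"
    show "almost_surely p (\<lambda>G. strong_chromatic_number G = max_degree G + 1)"
    proof (rule almost_surelyI)
      fix e :: real assume e: "0 < e"
      \<comment> \<open>Three errors of at most e/3 each: 2/n, 1/\<omega> and the gap term. \<kappa>
        bounds the ratio of 2g + 1 to \<open>R\<close> so that the gap lemma applies and its last
        term is at most e/3 (2880 = 3 * 960). For g = 8s, 2g + 1 <= 17s, whence 6817 = 17 * 401 in
        \<open>A\<close>.\<close>
      define \<omega> where "\<omega> = max 1 (3 / e)"
      define \<kappa> where "\<kappa> = min (\<theta> / 192) (e * \<theta> / (2880 * \<omega>\<^sup>2))"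
      define A where "A = 6817 / (par_c \<theta>)\<^sup>2"
      define X where "X = max (400000 / par_c \<theta> ^ 4) (max 100 (2 * A\<^sup>2 / \<kappa>\<^sup>2))"
      have \<omega>: "1 \<le> \<omega>" "1 / \<omega> \<le> e / 3"
      proof -
        show "1 \<le> \<omega>" by (simp add: \<omega>_def)
        have "1 / \<omega> \<le> 1 / (3 / e)" using e by (intro divide_left_mono) (auto simp: \<omega>_def max_def)
        thus "1 / \<omega> \<le> e / 3" by simp
      qed
      have \<kappa>: "0 < \<kappa>" "\<kappa> \<le> \<theta> / 192" "\<kappa> \<le> e * \<theta> / (2880 * \<omega>\<^sup>2)"
        using e \<theta> \<omega>(1) by (auto simp: \<kappa>_def)
      have A: "0 < A" using c by (simp add: A_def)
      have X: "400000 / par_c \<theta> ^ 4 \<le> X" "100 \<le> X" "2 * A\<^sup>2 / \<kappa>\<^sup>2 \<le> X" by (simp_all add: X_def)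
      have ev: "\<forall>\<^sub>F n in sequentially. 0 < p n \<and> X * ln (real n) ^ 4 \<le> real n * p n ^ 3"
        using h by (intro eventually_powr_ge) simp_all
      have ev2: "\<forall>\<^sub>F n in sequentially. max \<omega> (6 / e) \<le> real n"
        using filterlim_real_sequentially unfolding filterlim_at_top by blast
      show "\<forall>\<^sub>F n in sequentially. Pr (Gnp n (p n))
          {G. \<not> strong_chromatic_number G = max_degree G + 1} \<le> e"
        using ev ev2 eventually_ln_ge[of 1] eventually_ge_at_top[of 4]
      proof eventually_elim
        case (elim n)
        let ?l = "ln (real n)" and ?s = "par_s \<theta> n (p n)" and ?D = "bits (all_edges n) (p n)"
        have p0: "0 < p n" and np3: "X * ?l ^ 4 \<le> real n * p n ^ 3" using elim by auto
        have n: "3 \<le> n" "4 \<le> n" "0 < real n" using elim by auto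
        note F = par_facts[OF \<theta> p0 p1(1) n(1) elim(3)]
        have "?l ^ 1 \<le> ?l ^ 4" "?l ^ 3 \<le> ?l ^ 4" using elim(3) by (intro power_increasing; simp)+
        hence l4: "?l \<le> ?l ^ 4" "?l ^ 3 \<le> ?l ^ 4" by simp_all
        have Xl: "X * ?l \<le> real n * p n ^ 3" "X * ?l ^ 3 \<le> real n * p n ^ 3"
          using mult_left_mono[OF l4(1), of X] mult_left_mono[OF l4(2), of X] X(2) np3 by linarith+
        have "p n ^ 3 \<le> p n ^ 2" "p n ^ 3 \<le> p n ^ 1" using p0 p1 by (intro power_decreasing; simp)+
        hence "real n * p n ^ 3 \<le> real n * (p n)\<^sup>2" "real n * p n ^ 3 \<le> real n * p n"
          by (simp_all add: mult_left_mono)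
        hence np2: "X * ?l \<le> real n * (p n)\<^sup>2" and np1: "X * ?l \<le> real n * p n" using Xl(1) by linarith+
        have X4: "400000 / par_c \<theta> ^ 4 * ?l \<le> real n * (p n)\<^sup>2"
          using mult_right_mono[OF X(1), of ?l] elim(3) np2 by linarith
        have X100: "100 * ?l \<le> real n * p n"
          using mult_right_mono[OF X(2), of ?l] elim(3) np1 by linarith
        define R where "R = sqrt (real (n - 2) * p n / ?l)"
        have gR: "real (2 * (8 * ?s) + 1) \<le> \<kappa> * R"
        proof -
          have "real (2 * (8 * ?s) + 1) \<le> 17 * real ?s" using F(6) by simp
          also have "\<dots> \<le> A * (?l / p n)" using F(11) by (simp add: A_def)
          also have "\<dots> \<le> \<kappa> * R"
          proof -
            \<comment> \<open>Squared, and with n - 2 >= n/2 from n >= 4, this follows from \<open>2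
              * A\<^sup>2 / \<kappa>\<^sup>2 * ?l ^ 3 \<le> real n * p n ^ 3\<close>: the gap beats
              \<open>s\<close> because np^3 is large.\<close>
            have "A * (?l / p n) / \<kappa> \<le> R"
              unfolding R_def
            proof (rule real_le_rsqrt)
              have "2 * A\<^sup>2 / \<kappa>\<^sup>2 * ?l ^ 3 \<le> real n * p n ^ 3"
                using mult_right_mono[OF X(3), of "?l ^ 3"] elim(3) Xl(2) by simp
              hence "2 * A\<^sup>2 / \<kappa>\<^sup>2 * ?l ^ 3 / (2 * (p n)\<^sup>2 * ?l) \<le> real n * p n ^ 3 / (2 * (p n)\<^sup>2 * ?l)"
                using elim(3) by (intro divide_right_mono) auto
              also have "2 * A\<^sup>2 / \<kappa>\<^sup>2 * ?l ^ 3 / (2 * (p n)\<^sup>2 * ?l) = (A * (?l / p n) / \<kappa>)\<^sup>2"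
                using elim(3) by (simp add: power2_eq_square power3_eq_cube mult_ac)
              also have "real n * p n ^ 3 / (2 * (p n)\<^sup>2 * ?l) = (real n / 2) * p n / ?l"
                using p0 by (simp add: power2_eq_square power3_eq_cube)
              also have "\<dots> \<le> real (n - 2) * p n / ?l"
                using n p0 elim(3) by (intro divide_right_mono mult_right_mono) auto
              finally show "(A * (?l / p n) / \<kappa>)\<^sup>2 \<le> real (n - 2) * p n / ?l" .
            qed
            thus ?thesis using \<kappa>(1) by (simp only: pos_divide_le_eq mult.commute)
          qed
          finally show ?thesis .
        qed
        have "0 < real (2 * (8 * ?s) + 1)" by simp
        hence "0 < \<kappa> * R" using gR by (rule less_le_trans)
        hence R0: "0 < R" using \<kappa>(1) by (simp add: zero_less_mult_iff)
        have g1: "192 * real (2 * (8 * ?s) + 1) \<le> \<theta> * R"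
        proof -
          note gR
          also have "\<kappa> * R \<le> \<theta> / 192 * R" using \<kappa>(2) R0 by (intro mult_right_mono) auto
          finally have "192 * real (2 * (8 * ?s) + 1) \<le> 192 * (\<theta> / 192 * R)" by (intro mult_left_mono) auto
          thus ?thesis by simp
        qed
        have "192 * 1 \<le> 192 * real (2 * (8 * ?s) + 1)" by (intro mult_left_mono) auto
        also note g1
        finally have R24: "24 \<le> \<theta> * R" by simp
        let ?S = "\<lambda>f. random_spread \<theta> n (p n) f
             \<and> real n * p n / 2 \<le> real (maxdeg n f)"
        let ?G = "\<lambda>f. has_gap n (8 * ?s) f"
        have "Pr (Gnp n (p n)) {G. \<not> strong_chromatic_number G = max_degree G + 1}
            \<le> Pr ?D ({f. \<not> ?S f} \<union> {f. \<not> ?G f})"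
          unfolding prob_Gnp
          using strong_chromatic_number_exact[OF \<theta> p0 p1(1) n(1) elim(3) X4]
          by (intro measure_pmf.finite_measure_mono) (blast | simp)+
        also have "\<dots> \<le> Pr ?D {f. \<not> ?S f} + Pr ?D {f. \<not> ?G f}"
          by (intro measure_Un_le) auto
        also have "Pr ?D {f. \<not> ?S f} \<le> 2 / real n"
          by (rule prob_not_spread_or_small_degree[OF \<theta> p0 p1(1) n(1) elim(3) X100])
        also have "Pr ?D {f. \<not> ?G f} \<le> 1 / \<omega> + 960 * \<omega>\<^sup>2 * real (2 * (8 * ?s) + 1) / (\<theta> * R)"
          using elim(2) assms(3)[of n] \<theta>
          by (intro prob_no_gap_bound[OF \<theta> \<theta>1 n(2) p0 p1(1) _ R_def elim(3) R24 g1 \<omega>(1)]) auto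
        also have "960 * \<omega>\<^sup>2 * real (2 * (8 * ?s) + 1) / (\<theta> * R) \<le> e / 3"
        proof -
          have "real (2 * (8 * ?s) + 1) \<le> e * \<theta> / (2880 * \<omega>\<^sup>2) * R"
            using gR mult_right_mono[OF \<kappa>(3), of R] R0 by (meson less_imp_le order_trans)
          hence "960 * \<omega>\<^sup>2 * real (2 * (8 * ?s) + 1) \<le> 960 * \<omega>\<^sup>2 * (e * \<theta> / (2880 * \<omega>\<^sup>2) * R)"
            by (intro mult_left_mono) auto
          also have "\<dots> = e / 3 * (\<theta> * R)" using \<omega>(1) by simp
          finally show ?thesis using \<theta> R0 by (subst pos_divide_le_eq) auto
        qed
        also have "2 / real n \<le> e / 3"
        proof -
          have "6 / e \<le> real n" using elim(2) by simp
          thus ?thesis using e n by (simp add: field_simps)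
        qed
        finally show ?case using \<omega>(2) by simp
      qed
    qed
  }
  {
    fix \<epsilon> :: real
    assume h: "filterlim (\<lambda>n. p n / (ln (real n) / real n) powr (1/2)) at_top sequentially" and \<epsilon>: "0 < \<epsilon>"
    show "almost_surely p (\<lambda>G. (1 - \<epsilon>) * real (max_degree G) \<le> real (strong_chromatic_number G)
                     \<and> real (strong_chromatic_number G) \<le> (1 + \<epsilon>) * real (max_degree G))"
    proof (rule almost_surelyI)
      fix e :: real assume e: "0 < e"
      define X where "X = max (400000 / par_c \<theta> ^ 4) (max 100 (10000 / (\<epsilon> * (par_c \<theta>)\<^sup>2)))"
      have X: "400000 / par_c \<theta> ^ 4 \<le> X" "100 \<le> X" "10000 / (\<epsilon> * (par_c \<theta>)\<^sup>2) \<le> X" by (simp_all add: X_def)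
      have ev: "\<forall>\<^sub>F n in sequentially. 0 < p n \<and> X * ln (real n) ^ 1 \<le> real n * p n ^ 2"
        using h by (intro eventually_powr_ge) simp_all
      have ev2: "\<forall>\<^sub>F n in sequentially. 2 / e \<le> real n"
        using filterlim_real_sequentially unfolding filterlim_at_top by blast
      show "\<forall>\<^sub>F n in sequentially. Pr (Gnp n (p n))
          {G. \<not> ((1 - \<epsilon>) * real (max_degree G) \<le> real (strong_chromatic_number G)
                     \<and> real (strong_chromatic_number G) \<le> (1 + \<epsilon>) * real (max_degree G))} \<le> e"
        using ev ev2 eventually_ln_ge[of 1] eventually_ge_at_top[of 4]
      proof eventually_elim
        case (elim n)
        let ?l = "ln (real n)" and ?D = "bits (all_edges n) (p n)"
        have p0: "0 < p n" and np2: "X * ?l \<le> real n * (p n)\<^sup>2" using elim by auto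
        have n: "3 \<le> n" "0 < real n" using elim by auto
        have "p n ^ 2 \<le> p n ^ 1" using p0 p1 by (intro power_decreasing; simp)
        hence "real n * (p n)\<^sup>2 \<le> real n * p n" by (simp add: mult_left_mono)
        hence X100: "100 * ?l \<le> real n * p n"
          using mult_right_mono[OF X(2), of ?l] elim(3) np2 by linarith
        have X4: "400000 / par_c \<theta> ^ 4 * ?l \<le> real n * (p n)\<^sup>2"
          using mult_right_mono[OF X(1), of ?l] elim(3) np2 by linarith
        have Y: "10000 / (\<epsilon> * (par_c \<theta>)\<^sup>2) * ?l \<le> real n * (p n)\<^sup>2"
          using mult_right_mono[OF X(3), of ?l] elim(3) np2 by linarith
        let ?S = "\<lambda>f. random_spread \<theta> n (p n) f
             \<and> real n * p n / 2 \<le> real (maxdeg n f)"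
        have "Pr (Gnp n (p n))
          {G. \<not> ((1 - \<epsilon>) * real (max_degree G) \<le> real (strong_chromatic_number G)
                     \<and> real (strong_chromatic_number G) \<le> (1 + \<epsilon>) * real (max_degree G))}
            \<le> Pr ?D {f. \<not> ?S f}"
          unfolding prob_Gnp
          using strong_chromatic_number_approx[OF \<theta> p0 p1(1) n(1) elim(3) X4 \<epsilon> Y]
          by (intro measure_pmf.finite_measure_mono) (blast | simp)+
        also have "\<dots> \<le> 2 / real n"
          by (rule prob_not_spread_or_small_degree[OF \<theta> p0 p1(1) n(1) elim(3) X100])
        also have "\<dots> \<le> e" using elim(2) e n by (simp add: field_simps)
        finally show ?case .
      qed
    qed
  }
qed

end
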